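(* Let $v$ be a self-similar weak solution of $u_t+f(u)_x=0$, with associated sets $\mathcal S,\mathcal S',\operatorname{iso}(\mathcal S),\mathcal C,\mathcal W,\mathcal R,\mathcal E$. Then there is a partition $$\mathbb R=\operatorname{iso}(\mathcal S)\sqcup\mathcal R\sqcup(\mathcal C\sqcup\mathcal E)\sqcup\mathcal S'$$ of the speed axis into disjoint sets, where: (i) $\operatorname{iso}(\mathcal S)$ is a countable set of isolated ess-im discontinuities of $v$; (ii) $\mathcal R$ is a countable union of connected components (open intervals), in each of which $v$ is (a.e. equal to) a rarefaction wave; (iii) $\mathcal C$ is a countable union of connected components (open intervals), in each of which $v$ is (a.e. equal to a) constant; (iv) $\mathcal E$ is a countable set of isolated points, each an ess-im continuity point of $v$ that is an endpoint of a connected component of $\mathcal C$; (v) $\mathcal S'$ is the set of limit points of ess-im discontinuities of $v$.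
   Context: "Countable" means finite or countably infinite. Let $n\ge 1$, let $\mathbb U\subseteq\mathbb R^n$ be open, let $f:\mathbb U\to\mathbb R^n$ be $C^2$, and $A:=Df$. $\mathbb U_{SH}\subseteq\mathbb U$ is the set of states $u$ at which $A(u)$ has $n$ real, distinct eigenvalues $\lambda_1(u)<\dots<\lambda_n(u)$. It is assumed that the convex hull of $\mathbb U_{SH}$ is contained in $\mathbb U$. For $v\in L^\infty(\mathbb R;\mathbb R^n)$ and measurable $J\subseteq\mathbb R$, $\operatorname{ess\,im} v|_J$ is the set of $u\in\mathbb R^n$ such that $v^{-1}[U]\cap J$ has positive Lebesgue measure for every neighborhood $U$ of $u$; $\operatorname{ess\,im}v:=\operatorname{ess\,im}v|_{\mathbb R}$. Set $\mathcal A(v;\xi):=\bigcap_{r>0}\operatorname{ess\,im}v|_{(\xi-r,\xi+r)}$. The point $\xi$ is an ess-im continuity point for $v$ if $\mathcal A(v;\xi)$ is a singleton, whose element is denoted $\overline v(\xi)$; otherwise it is an ess-im discontinuity point. On an open interval of ess-im continuity points, $\overline v$ is continuous and equals $v$ a.e. A self-similar weak solution is a function $v\in L^\infty(\mathbb R;\mathbb R^n)$ with $\operatorname{ess\,im}v\subseteq\mathbb U_{SH}$ such that $\int_{-\infty}^\infty\{\frac{d\psi}{d\xi}\cdot[-\xi v+f(v)]-\psi\cdot v\}\,d\xi=0$ for all $\psi\in C^1_c(\mathbb R;\mathbb R^n)$. For such $v$: $\mathcal S$ is the set of ess-im discontinuity points; $\mathcal C$ is the set of ess-im continuity points $\xi$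 with $\det[-\xi I+A(\overline v(\xi))]\ne0$; $\mathcal W$ is the set of ess-im continuity points $\xi$ with $\det[-\xi I+A(\overline v(\xi))]=0$; $\mathcal S'$ is the set of limit points of $\mathcal S$ in $\mathbb R$; $\operatorname{iso}(\mathcal S):=\mathcal S\setminus\mathcal S'$; $\mathcal R:=\operatorname{int}\mathcal W$; $\mathcal E:=(\mathcal W\setminus\mathcal R)\setminus\mathcal S'$. A rarefaction integral curve for a characteristic speed $\lambda=\lambda_i$ is a $C^1$ curve $\mathcal U:I\to\mathbb U_{SH}$ on a nonempty open interval $I$ solving $d\mathcal U/d\eta=r(\mathcal U(\eta))$, where $r$ is a (locally defined) $C^1$ nowhere-vanishing field of right eigenvectors of $A$ for $\lambda$. A rarefaction wave on a nonempty open interval $J$ is a continuous curve $\mathcal U\circ w:J\to\mathbb U_{SH}$ with $\mathcal U:I\to\mathbb U_{SH}$ a rarefaction integral curve for some $\lambda=\lambda_i$, $w:J\to I$ a homeomorphism, and $\lambda(\mathcal U(w(\xi)))=\xi$ for all $\xi\in J$. *)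

theory Defs
  imports "HOL-Analysis.Analysis"
begin

(* C1_on and C2_on are meant for open S only: derivatives are taken "at x", not "at x within S". *)

definition C1_on :: "'a::real_normed_vector set \<Rightarrow> ('a \<Rightarrow> 'b::real_normed_vector) \<Rightarrow> bool" where
  "C1_on S f \<longleftrightarrow>
     (\<exists>f' :: 'a \<Rightarrow> 'a \<Rightarrow>\<^sub>L 'b.
        (\<forall>x\<in>S. (f has_derivative blinfun_apply (f' x)) (at x)) \<and> continuous_on S f')"

definition C2_on :: "'a::real_normed_vector set \<Rightarrow> ('a \<Rightarrow> 'b::real_normed_vector) \<Rightarrow> bool" where
  "C2_on S f \<longleftrightarrow>
     (\<exists>f' :: 'a \<Rightarrow> 'a \<Rightarrow>\<^sub>L 'b.
        (\<forall>x\<in>S. (f has_derivative blinfun_apply (f' x)) (at x)) \<and> C1_on S f')"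


definition flux_matrix :: "(real^'n \<Rightarrow> real^'n) \<Rightarrow> real^'n \<Rightarrow> real^'n^'n" where
  "flux_matrix f u = jacobian f (at u)"

definition right_eigenvector :: "real^'n^'n \<Rightarrow> real \<Rightarrow> real^'n \<Rightarrow> bool" where
  "right_eigenvector M \<mu> r \<longleftrightarrow> r \<noteq> 0 \<and> M *v r = \<mu> *\<^sub>R r"

definition real_eigenvalues :: "real^'n^'n \<Rightarrow> real set" where
  "real_eigenvalues M = {\<mu>. \<exists>r. right_eigenvector M \<mu> r}"

(* An n x n matrix has at most n eigenvalues, so having n distinct real ones
   forces all eigenvalues to be real and simple. *)
definition strictly_hyperbolic_set ::
    "(real^'n \<Rightarrow> real^'n) \<Rightarrow> (real^'n) set \<Rightarrow> (real^'n) set" where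
  "strictly_hyperbolic_set f \<U> =
     {u \<in> \<U>. card (real_eigenvalues (flux_matrix f u)) = CARD('n)}"

(* On the strictly hyperbolic set, char_speed f i is the eigenvalue with exactly i smaller ones,
   0 <= i < n (so lambda_(i+1) when counting from 1). *)
definition char_speed :: "(real^'n \<Rightarrow> real^'n) \<Rightarrow> nat \<Rightarrow> real^'n \<Rightarrow> real" where
  "char_speed f i u = sorted_list_of_set (real_eigenvalues (flux_matrix f u)) ! i"


(* Neighbourhoods are taken open, so that the preimages are measurable. *)
definition ess_im_on :: "(real \<Rightarrow> 'a::topological_space) \<Rightarrow> real set \<Rightarrow> 'a set" where
  "ess_im_on v J = {u. \<forall>U. open U \<and> u \<in> U \<longrightarrow> emeasure lebesgue (v -` U \<inter> J) > 0}"

definition ess_im :: "(real \<Rightarrow> 'a::topological_space) \<Rightarrow> 'a set" where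
  "ess_im v = ess_im_on v UNIV"

definition ess_im_at :: "(real \<Rightarrow> 'a::topological_space) \<Rightarrow> real \<Rightarrow> 'a set" where
  "ess_im_at v \<xi> = (\<Inter>r\<in>{0<..}. ess_im_on v {\<xi> - r<..<\<xi> + r})"

definition ess_im_continuity_point :: "(real \<Rightarrow> 'a::topological_space) \<Rightarrow> real \<Rightarrow> bool" where
  "ess_im_continuity_point v \<xi> \<longleftrightarrow> is_singleton (ess_im_at v \<xi>)"

definition ess_im_value :: "(real \<Rightarrow> 'a::topological_space) \<Rightarrow> real \<Rightarrow> 'a" where
  "ess_im_value v \<xi> = the_elem (ess_im_at v \<xi>)"


definition Linf :: "(real \<Rightarrow> 'a::real_normed_vector) \<Rightarrow> bool" where
  "Linf v \<longleftrightarrow> v \<in> borel_measurable lebesgue \<and> (\<exists>B. AE \<xi> in lebesgue. norm (v \<xi>) \<le> B)"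

(* Elements of L^infinity are represented by functions. A representative may leave \<U> on a null set,
   where f (v \<xi>) is irrelevant to the integral. *)
definition self_similar_weak_solution ::
    "(real^'n \<Rightarrow> real^'n) \<Rightarrow> (real^'n) set \<Rightarrow> (real \<Rightarrow> real^'n) \<Rightarrow> bool" where
  "self_similar_weak_solution f \<U> v \<longleftrightarrow>
     Linf v \<and> ess_im v \<subseteq> strictly_hyperbolic_set f \<U> \<and>
     (\<forall>\<psi> :: real \<Rightarrow> real^'n.
        \<psi> C1_differentiable_on UNIV \<and> compact (closure (support_on UNIV \<psi>)) \<longrightarrow>
        (LINT \<xi>|lebesgue. vector_derivative \<psi> (at \<xi>) \<bullet> (- \<xi> *\<^sub>R v \<xi> + f (v \<xi>)) - \<psi> \<xi> \<bullet> v \<xi>) = 0)"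


definition set_S :: "(real \<Rightarrow> real^'n) \<Rightarrow> real set" where
  "set_S v = {\<xi>. \<not> ess_im_continuity_point v \<xi>}"

definition set_C :: "(real^'n \<Rightarrow> real^'n) \<Rightarrow> (real \<Rightarrow> real^'n) \<Rightarrow> real set" where
  "set_C f v = {\<xi>. ess_im_continuity_point v \<xi> \<and>
                   det (- mat \<xi> + flux_matrix f (ess_im_value v \<xi>)) \<noteq> 0}"

definition set_W :: "(real^'n \<Rightarrow> real^'n) \<Rightarrow> (real \<Rightarrow> real^'n) \<Rightarrow> real set" where
  "set_W f v = {\<xi>. ess_im_continuity_point v \<xi> \<and>
                   det (- mat \<xi> + flux_matrix f (ess_im_value v \<xi>)) = 0}"

definition set_S' :: "(real \<Rightarrow> real^'n) \<Rightarrow> real set" where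
  "set_S' v = {\<xi>. \<xi> islimpt set_S v}"

definition set_isoS :: "(real \<Rightarrow> real^'n) \<Rightarrow> real set" where
  "set_isoS v = set_S v - set_S' v"

definition set_R :: "(real^'n \<Rightarrow> real^'n) \<Rightarrow> (real \<Rightarrow> real^'n) \<Rightarrow> real set" where
  "set_R f v = interior (set_W f v)"

definition set_E :: "(real^'n \<Rightarrow> real^'n) \<Rightarrow> (real \<Rightarrow> real^'n) \<Rightarrow> real set" where
  "set_E f v = (set_W f v - set_R f v) - set_S' v"


definition open_interval :: "real set \<Rightarrow> bool" where
  "open_interval J \<longleftrightarrow> open J \<and> is_interval J \<and> J \<noteq> {}"

(* The eigenvector field r is only required on some open subset D of the strictly hyperbolic set
   that contains the curve. *)
definition rarefaction_integral_curve ::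
    "(real^'n \<Rightarrow> real^'n) \<Rightarrow> (real^'n) set \<Rightarrow> nat \<Rightarrow> real set \<Rightarrow> (real \<Rightarrow> real^'n) \<Rightarrow> bool" where
  "rarefaction_integral_curve f \<U> i I c \<longleftrightarrow>
     i < CARD('n) \<and> open_interval I \<and> c C1_differentiable_on I \<and>
     c ` I \<subseteq> strictly_hyperbolic_set f \<U> \<and>
     (\<exists>D r. open D \<and> D \<subseteq> strictly_hyperbolic_set f \<U> \<and> c ` I \<subseteq> D \<and> C1_on D r \<and>
        (\<forall>u\<in>D. right_eigenvector (flux_matrix f u) (char_speed f i u) (r u)) \<and>
        (\<forall>\<eta>\<in>I. (c has_vector_derivative r (c \<eta>)) (at \<eta>)))"

definition rarefaction_wave ::
    "(real^'n \<Rightarrow> real^'n) \<Rightarrow> (real^'n) set \<Rightarrow> real set \<Rightarrow> (real \<Rightarrow> real^'n) \<Rightarrow> bool" where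
  "rarefaction_wave f \<U> J g \<longleftrightarrow>
     open_interval J \<and>
     (\<exists>i I c w w'. rarefaction_integral_curve f \<U> i I c \<and> homeomorphism J I w w' \<and>
        (\<forall>\<xi>\<in>J. g \<xi> = c (w \<xi>) \<and> char_speed f i (c (w \<xi>)) = \<xi>))"

end

theory Submission
  imports Defs
begin

text \<open>
  In integrated form, a weak solution satisfies
  \<open>f(v(y)) - f(v(x)) - x (v(y) - v(x)) = \<integral>\<^bsub>x\<^esub>\<^bsup>y\<^esup> (v(y) - v(t)) dt\<close> for almost all \<open>x \<le> y\<close>.
  Near a point \<open>\<xi>\<close> of \<open>\<C>\<close> the left-hand side is \<open>(A(v(\<xi>)) - \<xi>)(v(y) - v(x))\<close> up to a small
  relative error, with an invertible matrix, so the oscillation of \<open>v\<close> on a short interval is at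
  most half of itself, and \<open>v\<close> is locally constant on the open set \<open>\<C>\<close>.
  Near a point of \<open>\<W>\<close> outside \<open>\<S>'\<close> a simple eigenvalue is singled out, and a component of \<open>\<C>\<close> cannot have
  both endpoints nearby, since its constant state has only one eigenvalue there; hence \<open>\<W>\<close> is locally
  an interval.
  On a component of \<open>\<R>\<close> one has \<open>\<lambda>\<^sub>i(v(\<xi>)) = \<xi>\<close>, so \<open>\<bar>y - x\<bar>\<close> is at most a multiple of
  \<open>\<bar>v(y) - v(x)\<bar>\<close>, and the identity gives \<open>(A(v(\<xi>)) - \<xi>)(v(y) - v(x)) = o(\<bar>v(y) - v(x)\<bar>)\<close>:
  the curve has the eigenvector as a tangent in a strong sense, and its arclength parametrization is an
  integral curve of the unit eigenvector field.
\<close>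

subsection \<open>Essential images\<close>

text \<open>In the sense of distributions the equation says that
  \<open>- \<xi> *\<^sub>R v \<xi> + f (v \<xi>)\<close> has derivative \<open>- v\<close>; the du
  Bois-Reymond lemma integrates this between almost all pairs of points. Increments of f are
  compared with the derivative at one fixed state, uniformly over both end states, so that a single
  matrix governs all chords near \<xi>. The obstacle is that genuine nonlinearity is not assumed.
  Where the derivative of \<lambda> along the eigenvector vanishes, the state as a function of the
  speed cannot be differentiable. What survives is a statement about the directions of chords,
  uniform in both endpoints, and this suffices to make arclength finite and a C^1 parameter. A
  simple eigenvalue determines a unit eigenvector only up to sign. For the tangent the sign is fixed
  because the component of the state along the eigenvector is injective, hence monotone, in the
  speed; for the eigenvector field around the curve it is fixed by comparison with the
  tangent.\<close>

lemma open_in_sets_lebesgue [simp]: "open A \<Longrightarrow> A \<in> sets lebesgue" for A :: "'a::euclidean_space set"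
  by (simp add: borel_open)

text \<open>The points outside the essential image are covered by open sets with null preimage in J.
  By the Lindelof property countably many of these sets have the same union.\<close>

lemma AE_in_ess_im_on:
  fixes v :: "real \<Rightarrow> 'a::second_countable_topology"
  assumes v: "v \<in> borel_measurable lebesgue" and J: "J \<in> sets lebesgue"
  shows "AE \<xi> in lebesgue. \<xi> \<in> J \<longrightarrow> v \<xi> \<in> ess_im_on v J"
proof -
  define \<F> where "\<F> = {U. open U \<and> emeasure lebesgue (v -` U \<inter> J) = 0}"
  obtain \<F>' where \<F>': "\<F>' \<subseteq> \<F>" "countable \<F>'" "\<Union>\<F>' = \<Union>\<F>"
    using Lindelof[of \<F>] unfolding \<F>_def by blast
  have "AE \<xi> in lebesgue. \<not> (\<xi> \<in> J \<and> v \<xi> \<in> U)" if "U \<in> \<F>'" for U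
  proof -
    have U: "open U" "emeasure lebesgue (v -` U \<inter> J) = 0" using that \<F>' by (auto simp: \<F>_def)
    have "v -` U \<inter> J \<in> sets lebesgue"
      using measurable_sets[OF v, of U] U J by auto
    with U have "v -` U \<inter> J \<in> null_sets lebesgue" by auto
    from AE_not_in[OF this] show ?thesis by eventually_elim auto
  qed
  then have "AE \<xi> in lebesgue. \<forall>U\<in>\<F>'. \<not> (\<xi> \<in> J \<and> v \<xi> \<in> U)"
    unfolding AE_ball_countable[OF \<F>'(2)] by blast
  then show ?thesis
  proof eventually_elim
    case (elim \<xi>)
    then have "\<xi> \<in> J \<longrightarrow> v \<xi> \<notin> \<Union>\<F>" using \<F>' by blast
    then show ?case by (auto simp: ess_im_on_def \<F>_def zero_less_iff_neq_zero)
  qed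
qed

text \<open>A compactness argument: v is essentially bounded, and the part of the bounding ball
  outside V is compact. Each of its points lies outside some \<open>ess_im_on\<close> and so has a
  neighbourhood and a radius with null preimage; finitely many of these give a common
  radius.\<close>

lemma AE_near_ess_im_at:
  fixes v :: "real \<Rightarrow> 'a::euclidean_space"
  assumes v: "Linf v" and V: "open V" "ess_im_at v \<xi> \<subseteq> V"
  obtains r where "r > 0" "AE \<eta> in lebesgue. \<eta> \<in> ball \<xi> r \<longrightarrow> v \<eta> \<in> V"
proof -
  have vm: "v \<in> borel_measurable lebesgue" using v by (auto simp: Linf_def)
  obtain B where B: "AE \<eta> in lebesgue. norm (v \<eta>) \<le> B" using v by (auto simp: Linf_def)
  let ?K = "cball 0 B - V"
  have "compact ?K" using V by (simp add: compact_diff)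
  have "\<exists>r U. r > 0 \<and> open U \<and> x \<in> U \<and> emeasure lebesgue (v -` U \<inter> {\<xi> - r<..<\<xi> + r}) = 0" if "x \<in> ?K" for x
  proof -
    have "x \<notin> ess_im_at v \<xi>" using that V by auto
    then obtain r where "r > 0" "x \<notin> ess_im_on v {\<xi> - r<..<\<xi> + r}" by (auto simp: ess_im_at_def)
    then show ?thesis unfolding ess_im_on_def by (auto simp: not_gr_zero)
  qed
  then obtain r U where rU: "\<And>x. x \<in> ?K \<Longrightarrow> r x > 0 \<and> open (U x) \<and> x \<in> U x \<and>
       emeasure lebesgue (v -` U x \<inter> {\<xi> - r x<..<\<xi> + r x}) = 0" by metis
  obtain T where T: "T \<subseteq> ?K" "finite T" "?K \<subseteq> (\<Union>x\<in>T. U x)"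
    using compactE_image[OF \<open>compact ?K\<close>, of ?K U] rU by blast
  \<comment> \<open>The 1 keeps \<open>Min\<close> defined when the cover is empty, that is, when V
    contains the whole ball.\<close>
  define \<rho> where "\<rho> = Min (insert 1 (r ` T))"
  have \<rho>: "\<rho> > 0" "\<And>x. x \<in> T \<Longrightarrow> \<rho> \<le> r x"
    using T rU by (auto simp: \<rho>_def subset_iff)
  have "AE \<eta> in lebesgue. \<not> (\<eta> \<in> ball \<xi> \<rho> \<and> v \<eta> \<in> U x)" if "x \<in> T" for x
  proof -
    have x: "x \<in> ?K" using that T by auto
    have "v -` U x \<inter> {\<xi> - r x<..<\<xi> + r x} \<in> sets lebesgue"
      using measurable_sets[OF vm, of "U x"] rU[OF x] by auto
    with rU[OF x] have "v -` U x \<inter> {\<xi> - r x<..<\<xi> + r x} \<in> null_sets lebesgue" by auto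
    from AE_not_in[OF this] show ?thesis
    proof eventually_elim
      case (elim \<eta>)
      then show ?case using \<rho>(2)[OF that] by (auto simp: dist_real_def)
    qed
  qed
  then have "AE \<eta> in lebesgue. \<forall>x\<in>T. \<not> (\<eta> \<in> ball \<xi> \<rho> \<and> v \<eta> \<in> U x)"
    unfolding AE_finite_all[OF T(2)] by blast
  then have "AE \<eta> in lebesgue. \<eta> \<in> ball \<xi> \<rho> \<longrightarrow> v \<eta> \<in> V" using B
  proof eventually_elim
    case (elim \<eta>)
    then show ?case using T(3) by (auto simp: subset_iff)
  qed
  with \<rho>(1) show ?thesis using that by blast
qed

lemma ball_AE_nonempty:
  assumes "AE \<eta> in lebesgue. \<eta> \<in> ball \<xi> r \<longrightarrow> P \<eta>" "r > (0::real)"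
  obtains \<eta> where "\<eta> \<in> ball \<xi> r" "P \<eta>"
proof (rule ccontr)
  assume "\<not> thesis"
  with that have "\<And>\<eta>. \<eta> \<in> ball \<xi> r \<Longrightarrow> \<not> P \<eta>" by blast
  with assms(1) have "AE \<eta> in lebesgue. \<eta> \<notin> ball \<xi> r"
    by (elim eventually_mono) blast
  then have "ball \<xi> r \<in> null_sets lebesgue" by (simp add: AE_iff_null_sets)
  then show False using \<open>r > 0\<close> open_not_negligible[of "ball \<xi> r"] by (auto simp: negligible_iff_null_sets)
qed

lemma ess_im_at_nonempty:
  fixes v :: "real \<Rightarrow> 'a::euclidean_space"
  assumes "Linf v"
  shows "ess_im_at v \<xi> \<noteq> {}"
proof
  assume "ess_im_at v \<xi> = {}"
  then obtain r where r: "r > 0" "AE \<eta> in lebesgue. \<eta> \<in> ball \<xi> r \<longrightarrow> v \<eta> \<in> {}"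
    using AE_near_ess_im_at[OF assms, of "{}" \<xi>] by auto
  show False using ball_AE_nonempty[OF r(2,1)] by blast
qed

text \<open>Counterpart of \<open>AE_near_ess_im_at\<close> for an arbitrary set V: the complement
  of the closure is an open set that v meets near \<eta> only in a null set. With a singleton V it
  identifies constant states.\<close>

lemma ess_im_at_subset_closure:
  assumes V: "AE \<eta> in lebesgue. \<eta> \<in> ball \<xi> r \<longrightarrow> v \<eta> \<in> V" and \<eta>: "\<eta> \<in> ball \<xi> r"
  shows "ess_im_at v \<eta> \<subseteq> closure V"
proof
  fix u assume u: "u \<in> ess_im_at v \<eta>"
  obtain d where d: "d > 0" "ball \<eta> d \<subseteq> ball \<xi> r" using openE[OF open_ball \<eta>] by blast
  show "u \<in> closure V"
  proof (rule ccontr)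
    assume "u \<notin> closure V"
    then have "emeasure lebesgue (v -` (- closure V) \<inter> {\<eta> - d<..<\<eta> + d}) > 0"
      using u d unfolding ess_im_at_def ess_im_on_def by (simp add: open_Compl)
    moreover have "AE t in lebesgue. t \<notin> v -` (- closure V) \<inter> {\<eta> - d<..<\<eta> + d}"
      using V
    proof eventually_elim
      case (elim t)
      then show ?case using d closure_subset[of V] by (auto simp: subset_iff dist_real_def)
    qed
    then have "emeasure lebesgue {t \<in> space lebesgue. t \<in> v -` (- closure V) \<inter> {\<eta> - d<..<\<eta> + d}} = 0"
      by (rule emeasure_eq_0_AE)
    moreover have "{t \<in> space lebesgue. t \<in> v -` (- closure V) \<inter> {\<eta> - d<..<\<eta> + d}} = v -` (- closure V) \<inter> {\<eta> - d<..<\<eta> + d}"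
      by auto
    ultimately show False by simp
  qed
qed

lemma ess_im_at_subset_ess_im:
  assumes v: "v \<in> borel_measurable lebesgue"
  shows "ess_im_at v \<xi> \<subseteq> ess_im v"
proof
  fix u assume "u \<in> ess_im_at v \<xi>"
  then have u: "u \<in> ess_im_on v {\<xi> - 1<..<\<xi> + 1}" by (auto simp: ess_im_at_def)
  show "u \<in> ess_im v" unfolding ess_im_def ess_im_on_def
  proof (safe)
    fix U assume U: "open U" "u \<in> U"
    have "0 < emeasure lebesgue (v -` U \<inter> {\<xi> - 1<..<\<xi> + 1})" using u U by (auto simp: ess_im_on_def)
    also have "\<dots> \<le> emeasure lebesgue (v -` U \<inter> UNIV)"
      using measurable_sets[OF v, of U] U by (intro emeasure_mono) auto
    finally show "0 < emeasure lebesgue (v -` U \<inter> UNIV)" .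
  qed
qed

lemma ess_im_at_eq_value:
  assumes "ess_im_continuity_point v \<xi>"
  shows "ess_im_at v \<xi> = {ess_im_value v \<xi>}"
  using assms by (auto simp: ess_im_continuity_point_def ess_im_value_def is_singleton_the_elem)

lemma ess_im_continuity_pointI:
  assumes "ess_im_at v \<xi> = {u}"
  shows "ess_im_continuity_point v \<xi>" "ess_im_value v \<xi> = u"
  using assms by (auto simp: ess_im_continuity_point_def ess_im_value_def)

lemma AE_const_ess_im:
  fixes v :: "real \<Rightarrow> 'a::euclidean_space"
  assumes "Linf v" "AE \<eta> in lebesgue. \<eta> \<in> ball \<xi> r \<longrightarrow> v \<eta> = u" "\<eta> \<in> ball \<xi> r"
  shows "ess_im_at v \<eta> = {u}"
  using ess_im_at_subset_closure[of \<xi> r v "{u}" \<eta>] assms ess_im_at_nonempty[OF assms(1), of \<eta>] by auto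

lemma AE_near_ess_im_value:
  fixes v :: "real \<Rightarrow> 'a::euclidean_space"
  assumes v: "Linf v" and c: "ess_im_continuity_point v \<xi>" and e: "e > 0"
  obtains r where "r > 0" "AE \<eta> in lebesgue. \<eta> \<in> ball \<xi> r \<longrightarrow> dist (ess_im_value v \<xi>) (v \<eta>) < e"
    "\<And>\<eta>. \<eta> \<in> ball \<xi> r \<Longrightarrow> ess_im_continuity_point v \<eta> \<Longrightarrow> dist (ess_im_value v \<xi>) (ess_im_value v \<eta>) < e"
proof -
  \<comment> \<open>Radius e/2, since the values at neighbouring continuity points are only known to
    lie in the closure of this ball.\<close>
  obtain r where r: "r > 0" "AE \<eta> in lebesgue. \<eta> \<in> ball \<xi> r \<longrightarrow> v \<eta> \<in> ball (ess_im_value v \<xi>) (e/2)"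
    using AE_near_ess_im_at[OF v, of "ball (ess_im_value v \<xi>) (e/2)" \<xi>] e ess_im_at_eq_value[OF c] by auto
  show ?thesis
  proof (rule that[OF r(1)])
    show "AE \<eta> in lebesgue. \<eta> \<in> ball \<xi> r \<longrightarrow> dist (ess_im_value v \<xi>) (v \<eta>) < e"
      using r(2) by eventually_elim (use e in auto)
    fix \<eta> assume \<eta>: "\<eta> \<in> ball \<xi> r" "ess_im_continuity_point v \<eta>"
    then show "dist (ess_im_value v \<xi>) (ess_im_value v \<eta>) < e"
      using ess_im_at_subset_closure[OF r(2) \<eta>(1)] ess_im_at_eq_value[OF \<eta>(2)] e by auto
  qed
qed

lemma continuous_on_ess_im_value:
  fixes v :: "real \<Rightarrow> 'a::euclidean_space"
  assumes v: "Linf v" and G: "\<And>\<xi>. \<xi> \<in> G \<Longrightarrow> ess_im_continuity_point v \<xi>"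
  shows "continuous_on G (ess_im_value v)"
  unfolding continuous_on_iff
proof (intro ballI allI impI)
  fix \<xi> and e :: real assume "\<xi> \<in> G" "0 < e"
  then obtain r where "r > 0" "\<And>\<eta>. \<eta> \<in> ball \<xi> r \<Longrightarrow> ess_im_continuity_point v \<eta> \<Longrightarrow> dist (ess_im_value v \<xi>) (ess_im_value v \<eta>) < e"
    using AE_near_ess_im_value[OF v G] by metis
  then show "\<exists>d>0. \<forall>x'\<in>G. dist x' \<xi> < d \<longrightarrow> dist (ess_im_value v x') (ess_im_value v \<xi>) < e"
    using G by (metis dist_commute mem_ball)
qed

text \<open>Every point brings its own exceptional null set; Lindelof reduces the cover by balls to
  a countable one, so that the null sets can be united.\<close>

lemma AE_locally:
  fixes G :: "real set"
  assumes "\<And>\<xi>. \<xi> \<in> G \<Longrightarrow> \<exists>r>0. AE \<eta> in lebesgue. \<eta> \<in> ball \<xi> r \<longrightarrow> P \<eta>"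
  shows "AE \<eta> in lebesgue. \<eta> \<in> G \<longrightarrow> P \<eta>"
proof -
  define \<F> where "\<F> = {ball \<xi> r |\<xi> r. (AE \<eta> in lebesgue. \<eta> \<in> ball \<xi> r \<longrightarrow> P \<eta>)}"
  obtain \<F>' where \<F>': "\<F>' \<subseteq> \<F>" "countable \<F>'" "\<Union>\<F>' = \<Union>\<F>"
    by (rule Lindelof[of \<F>]) (auto simp: \<F>_def)
  have "G \<subseteq> \<Union>\<F>"
  proof
    fix \<xi> assume "\<xi> \<in> G"
    with assms obtain r where "r > 0" "AE \<eta> in lebesgue. \<eta> \<in> ball \<xi> r \<longrightarrow> P \<eta>" by blast
    then have "ball \<xi> r \<in> \<F>" "\<xi> \<in> ball \<xi> r" by (auto simp: \<F>_def)
    then show "\<xi> \<in> \<Union>\<F>" by blast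
  qed
  have "AE \<eta> in lebesgue. \<forall>U\<in>\<F>'. \<eta> \<in> U \<longrightarrow> P \<eta>"
    unfolding AE_ball_countable[OF \<F>'(2)]
  proof
    fix U assume "U \<in> \<F>'"
    then have "U \<in> \<F>" using \<F>' by blast
    then obtain \<xi> r where "U = ball \<xi> r" "AE \<eta> in lebesgue. \<eta> \<in> ball \<xi> r \<longrightarrow> P \<eta>"
      unfolding \<F>_def by blast
    then show "AE \<eta> in lebesgue. \<eta> \<in> U \<longrightarrow> P \<eta>" by (simp only:)
  qed
  then show ?thesis
  proof eventually_elim
    case (elim \<eta>)
    show ?case
    proof
      assume "\<eta> \<in> G"
      then have "\<eta> \<in> \<Union>\<F>'" using \<F>'(3) \<open>G \<subseteq> \<Union>\<F>\<close> by simp blast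
      then show "P \<eta>" using elim by blast
    qed
  qed
qed

text \<open>Near \<xi> both \<open>v\<close> and \<open>ess_im_value v\<close> are close to the
  value at \<xi>, hence to each other almost everywhere. Each tolerance
  \<open>inverse (Suc n)\<close> is settled locally, and countably many tolerances leave a null
  set.\<close>

lemma AE_eq_ess_im_value:
  fixes v :: "real \<Rightarrow> 'a::euclidean_space"
  assumes v: "Linf v" and "open G" and G: "\<And>\<xi>. \<xi> \<in> G \<Longrightarrow> ess_im_continuity_point v \<xi>"
  shows "AE \<xi> in lebesgue. \<xi> \<in> G \<longrightarrow> v \<xi> = ess_im_value v \<xi>"
proof -
  have "AE \<xi> in lebesgue. \<xi> \<in> G \<longrightarrow> dist (v \<xi>) (ess_im_value v \<xi>) < inverse (Suc n)" for n
  proof (rule AE_locally)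
    fix \<xi> assume \<xi>: "\<xi> \<in> G"
    obtain s where s: "s > 0" "ball \<xi> s \<subseteq> G" using \<xi> \<open>open G\<close> openE by blast
    define e where "e = inverse (real (Suc n)) / 2"
    have e: "e > 0" by (simp add: e_def)
    obtain r where r: "r > 0" "AE \<eta> in lebesgue. \<eta> \<in> ball \<xi> r \<longrightarrow> dist (ess_im_value v \<xi>) (v \<eta>) < e"
      "\<And>\<eta>. \<eta> \<in> ball \<xi> r \<Longrightarrow> ess_im_continuity_point v \<eta> \<Longrightarrow> dist (ess_im_value v \<xi>) (ess_im_value v \<eta>) < e"
      by (rule AE_near_ess_im_value[OF v G[OF \<xi>] e]) blast
    show "\<exists>r>0. AE \<eta> in lebesgue. \<eta> \<in> ball \<xi> r \<longrightarrow> dist (v \<eta>) (ess_im_value v \<eta>) < inverse (Suc n)"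
    proof (intro exI[of _ "min r s"] conjI)
      show "AE \<eta> in lebesgue. \<eta> \<in> ball \<xi> (min r s) \<longrightarrow> dist (v \<eta>) (ess_im_value v \<eta>) < inverse (Suc n)"
        using r(2)
      proof eventually_elim
        case (elim \<eta>)
        show ?case
        proof
          assume \<eta>: "\<eta> \<in> ball \<xi> (min r s)"
          with s have "ess_im_continuity_point v \<eta>" by (intro G) auto
          with r(3)[of \<eta>] elim \<eta> have "dist (ess_im_value v \<xi>) (v \<eta>) < e" "dist (ess_im_value v \<xi>) (ess_im_value v \<eta>) < e" by auto
          then show "dist (v \<eta>) (ess_im_value v \<eta>) < inverse (Suc n)"
            unfolding e_def by (rule dist_triangle_half_r)
        qed
      qed
    qed (use r s in auto)
  qed
  then have "AE \<xi> in lebesgue. \<forall>n. \<xi> \<in> G \<longrightarrow> dist (v \<xi>) (ess_im_value v \<xi>) < inverse (Suc n)"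
    unfolding AE_all_countable by blast
  then show ?thesis
  proof eventually_elim
    case (elim \<xi>)
    show ?case
    proof (rule impI, rule ccontr)
      assume "\<xi> \<in> G" "v \<xi> \<noteq> ess_im_value v \<xi>"
      then obtain n where "inverse (real (Suc n)) < dist (v \<xi>) (ess_im_value v \<xi>)"
        using reals_Archimedean by (metis zero_less_dist_iff)
      with elim \<open>\<xi> \<in> G\<close> show False by (smt (verit))
    qed
  qed
qed

subsection \<open>The du Bois-Reymond lemma\<close>

text \<open>The sets over which g integrates to zero form a Dynkin system containing the open
  intervals, which are stable under intersection and generate the Borel sets. The support condition
  lets intervals be cut off at -N and N and gives the vanishing total integral that complements
  require.\<close>

lemma AE_zero_of_interval_integrals:
  fixes g :: "real \<Rightarrow> real"
  assumes g: "integrable lborel g" and supp: "\<And>x. x \<notin> {-N<..<N} \<Longrightarrow> g x = 0"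
    and z: "\<And>a b. -N \<le> a \<Longrightarrow> a < b \<Longrightarrow> b \<le> N \<Longrightarrow> (LINT x:{a<..<b}|lborel. g x) = 0"
  shows "AE x in lborel. g x = 0"
proof (rule sigma_finite_measure.density_zero[OF lborel.sigma_finite_measure_axioms g])
  have z': "(LINT x:{a<..<b}|lborel. g x) = 0" for a b
  proof -
    have "(LINT x:{a<..<b}|lborel. g x) = (LINT x:{max a (-N)<..<min b N}|lborel. g x)"
      unfolding set_lebesgue_integral_def
      by (rule Bochner_Integration.integral_cong) (use supp in \<open>auto simp: indicator_def\<close>)
    also have "\<dots> = 0"
    proof (cases "max a (-N) < min b N")
      case True
      then show ?thesis by (intro z) auto
    next
      case False
      then have "{max a (-N)<..<min b N} = {}" by (simp only: greaterThanLessThan_empty_iff not_less)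
      then show ?thesis by (simp only: set_lebesgue_integral_def) simp
    qed
    finally show ?thesis .
  qed
  have tot: "(LINT x|lborel. g x) = 0"
  proof -
    have "(LINT x|lborel. g x) = (LINT x:{-N<..<N}|lborel. g x)"
      unfolding set_lebesgue_integral_def
      by (rule Bochner_Integration.integral_cong) (use supp in \<open>auto simp: indicator_def\<close>)
    then show ?thesis using z' by simp
  qed
  fix A :: "real set" assume "A \<in> sets lborel"
  then have "A \<in> sigma_sets UNIV (range (\<lambda>(a, b). box a b :: real set))"
    by (simp add: borel_eq_box)
  then have A: "A \<in> sigma_sets UNIV (range (\<lambda>(a, b). {a<..<b} :: real set))"
    by (simp add: box_real)
  have st: "Int_stable (range (\<lambda>(a, b). {a<..<b} :: real set))"
  proof (rule Int_stableI)
    fix A B assume "A \<in> range (\<lambda>(a, b). {a<..<b} :: real set)" "B \<in> range (\<lambda>(a, b). {a<..<b} :: real set)"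
    then obtain a b c d where "A = {a<..<b}" "B = {c<..<d}" by auto
    then have "A \<inter> B = (\<lambda>(a, b). {a<..<b}) (max a c, min b d)" by auto
    then show "A \<inter> B \<in> range (\<lambda>(a, b). {a<..<b} :: real set)" by blast
  qed
  have sub: "range (\<lambda>(a, b). {a<..<b} :: real set) \<subseteq> Pow UNIV" by simp
  from st sub A show "(LINT x:A|lborel. g x) = 0"
  proof (induction rule: sigma_sets_induct_disjoint)
    case (basic A)
    then show ?case using z' by auto
  next
    case empty
    then show ?case by (simp add: set_lebesgue_integral_def)
  next
    case (compl A)
    then have A: "A \<in> sets lborel" by (simp add: borel_eq_box box_real)
    have "(LINT x|lborel. g x) = (LINT x:A \<union> (UNIV - A)|lborel. g x)"
      by (simp add: set_lebesgue_integral_def)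
    also have "\<dots> = (LINT x:A|lborel. g x) + (LINT x:UNIV - A|lborel. g x)"
    proof (rule set_integral_Un)
      show "set_integrable lborel A g" "set_integrable lborel (UNIV - A) g"
        unfolding set_integrable_def using A g by (intro integrable_mult_indicator; simp)+
    qed auto
    finally show ?case using tot compl by simp
  next
    case (union A)
    then have A: "range A \<subseteq> sets lborel" by (simp add: borel_eq_box box_real)
    have "(LINT x:(\<Union>i. A i)|lborel. g x) = (\<Sum>i. (LINT x:A i|lborel. g x))"
    proof (rule lebesgue_integral_countable_add)
      show "A i \<inter> A j = {}" if "i \<noteq> j" for i j using union(1) that by (auto simp: disjoint_family_on_def)
      show "set_integrable lborel (\<Union>i. A i) g"
        unfolding set_integrable_def using A g by (intro integrable_mult_indicator) auto
    qed (use A in auto)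
    then show ?case using union by simp
  qed
qed

lemma continuous_antiderivative:
  fixes \<phi> :: "real \<Rightarrow> real"
  assumes c: "continuous_on UNIV \<phi>"
  shows "((\<lambda>u::real. LBINT y=ereal c..ereal u. \<phi> y) has_vector_derivative \<phi> x) (at x)"
proof -
  \<comment> \<open>The margin 1 puts x in the interior of an interval that also contains c, so that
    the derivative within the interval is the full derivative.\<close>
  define a b :: real where "a = min c x - 1" and "b = max c x + 1"
  have "((\<lambda>u::real. LBINT y=ereal c..ereal u. \<phi> y) has_vector_derivative \<phi> x) (at x within {a..b})"
    by (rule interval_integral_FTC2) (use continuous_on_subset[OF c] in \<open>auto simp: a_def b_def\<close>)
  moreover have "x \<in> interior {a..b}" by (auto simp: a_def b_def min_def max_def)
  ultimately show ?thesis by (simp only: at_within_interior)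
qed

text \<open>The trapezoids of slope n tend pointwise to the indicator of the open interval, with
  \<open>\<bar>g x\<bar>\<close> as dominating function. They are continuous, as derivatives of test
  functions have to be.\<close>

lemma integral_trapezoid_tendsto:
  fixes g :: "real \<Rightarrow> real"
  assumes "integrable lborel g" 
  shows "(\<lambda>n. LINT x|lborel. min 1 (real n * max 0 (min (x - a) (b - x))) * g x)
    \<longlonglongrightarrow> (LINT x:{a<..<b}|lborel. g x)"
  unfolding set_lebesgue_integral_def
proof (rule integral_dominated_convergence[where w = "\<lambda>x. \<bar>g x\<bar>"])
  have [measurable]: "g \<in> borel_measurable borel" using assms by auto
  show "(\<lambda>x. indicat_real {a<..<b} x *\<^sub>R g x) \<in> borel_measurable lborel" by measurable
  show "(\<lambda>x. min 1 (real n * max 0 (min (x - a) (b - x))) * g x) \<in> borel_measurable lborel" for n by measurable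
  show "integrable lborel (\<lambda>x. \<bar>g x\<bar>)" using assms by auto
  show "AE x in lborel. (\<lambda>n. min 1 (real n * max 0 (min (x - a) (b - x))) * g x) \<longlonglongrightarrow> indicat_real {a<..<b} x *\<^sub>R g x"
  proof (rule AE_I2)
    fix x
    show "(\<lambda>n. min 1 (real n * max 0 (min (x - a) (b - x))) * g x) \<longlonglongrightarrow> indicat_real {a<..<b} x *\<^sub>R g x"
    proof (cases "x \<in> {a<..<b}")
      case True
      then have m: "min (x - a) (b - x) > 0" by auto
      obtain m where m': "1 < real m * min (x - a) (b - x)" using reals_Archimedean3[OF m] by blast
      have "eventually (\<lambda>n. min 1 (real n * max 0 (min (x - a) (b - x))) * g x = indicat_real {a<..<b} x *\<^sub>R g x) sequentially"
        using eventually_ge_at_top[of m]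
      proof eventually_elim
        case (elim n)
        then have "real m * min (x - a) (b - x) \<le> real n * min (x - a) (b - x)"
          using m by (intro mult_right_mono) auto
        then have "1 \<le> real n * min (x - a) (b - x)" using m' by linarith
        moreover have "max 0 (min (x - a) (b - x)) = min (x - a) (b - x)" using m by simp
        ultimately show ?case using True by simp
      qed
      then show ?thesis by (rule tendsto_eventually)
    next
      case False
      then have "max 0 (min (x - a) (b - x)) = 0" by (auto simp: max_def min_def)
      then show ?thesis using False by simp
    qed
  qed
  show "AE x in lborel. norm (min 1 (real n * max 0 (min (x - a) (b - x))) * g x) \<le> \<bar>g x\<bar>" for n
    by (rule AE_I2) (auto simp: abs_mult intro!: mult_left_le_one_le)
qed

text \<open>Integration by parts turns \<open>weak\<close> into orthogonality of p + Q, with Q the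
  antiderivative of q, to all continuous \<phi> of mean zero that vanish off (-N, N). A function
  orthogonal to all of these is constant. The test function is \<Phi>, and \<phi> is its
  derivative.\<close>

lemma du_Bois_Reymond:
  fixes p q :: "real \<Rightarrow> real"
  assumes [measurable]: "p \<in> borel_measurable borel" "q \<in> borel_measurable borel"
    and B: "\<And>x. x \<in> {-N..N} \<Longrightarrow> \<bar>p x\<bar> \<le> B" "\<And>x. x \<in> {-N..N} \<Longrightarrow> \<bar>q x\<bar> \<le> B" and N: "N > 0"
    and weak: "\<And>\<phi> \<Phi>. continuous_on UNIV \<phi> \<Longrightarrow> (\<And>x. (\<Phi> has_vector_derivative \<phi> x) (at x)) \<Longrightarrow>
       (\<And>x. x \<notin> {-N..N} \<Longrightarrow> \<phi> x = 0) \<Longrightarrow> (\<And>x. x \<notin> {-N..N} \<Longrightarrow> \<Phi> x = 0) \<Longrightarrow>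
       (LINT x|lborel. \<phi> x * p x - \<Phi> x * q x) = 0"
  obtains k where "AE x in lborel. x \<in> {-N<..<N} \<longrightarrow> p x + (LINT t:{-N..x}|lborel. q t) = k"
proof -
  have bdd: "integrable lborel f" if "f \<in> borel_measurable borel" "\<And>x. x \<in> {-N..N} \<Longrightarrow> \<bar>f x\<bar> \<le> C" "\<And>x. x \<notin> {-N..N} \<Longrightarrow> f x = 0" for f :: "real \<Rightarrow> real" and C
    by (rule integrableI_bounded_set[where A = "{-N..N}" and B = C]) (use that N in auto)
  define Q where "Q x = (LINT t:{-N..x}|lborel. q t)" for x
  have Qm [measurable]: "Q \<in> borel_measurable borel"
  proof -
    have [measurable]: "Measurable.pred (borel \<Otimes>\<^sub>M borel) (\<lambda>z::real \<times> real. snd z \<in> {-N..fst z})"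
      by simp
    show ?thesis unfolding Q_def set_lebesgue_integral_def indicator_def by measurable
  qed
  have QB: "\<bar>Q x\<bar> \<le> 2 * N * B" if "x \<in> {-N..N}" for x
  proof -
    have B0: "B \<ge> 0" using B(1)[of 0] N by auto
    have "\<bar>Q x\<bar> \<le> (LINT t|lborel. indicat_real {-N..N} t * B)"
      unfolding Q_def set_lebesgue_integral_def
    proof (rule integral_abs_bound_integral)
      show "integrable lborel (\<lambda>t. indicat_real {-N..x} t *\<^sub>R q t)"
        by (rule bdd[where C = B]) (use that B B0 in \<open>auto simp: indicator_def\<close>)
      show "integrable lborel (\<lambda>t. indicat_real {-N..N} t * B)"
        by (rule bdd[where C = B]) (use B0 in \<open>auto simp: indicator_def\<close>)
    qed (use that B B0 in \<open>auto simp: indicator_def\<close>)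
    also have "\<dots> = 2 * N * B" using N by (simp add: measure_def)
    finally show ?thesis .
  qed
  define g where "g x = indicat_real {-N<..<N} x * (p x + Q x)" for x
  have gint: "integrable lborel g"
  proof (rule bdd[where C = "B + 2 * N * B"])
    show "g \<in> borel_measurable borel" unfolding g_def by measurable
    fix x :: real
    show "\<bar>g x\<bar> \<le> B + 2 * N * B" if "x \<in> {-N..N}"
    proof -
      have "\<bar>g x\<bar> \<le> \<bar>p x + Q x\<bar>" by (simp add: g_def indicator_def)
      also have "\<dots> \<le> B + 2 * N * B" using B(1)[OF that] QB[OF that] by linarith
      finally show ?thesis .
    qed
    show "g x = 0" if "x \<notin> {-N..N}" using that by (auto simp: g_def)
  qed
  \<comment> \<open>Mean zero is what makes the antiderivative \<Phi> vanish to the right of N, so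
    that it is an admissible test function.\<close>
  have key: "(LINT x|lborel. \<phi> x * g x) = 0"
    if c: "continuous_on UNIV \<phi>" and s: "\<And>x. x \<notin> {-N<..<N} \<Longrightarrow> \<phi> x = 0" and m: "(LINT x|lborel. \<phi> x) = 0" for \<phi>
  proof -
    have [measurable]: "\<phi> \<in> borel_measurable borel" using c by (rule borel_measurable_continuous_onI)
    obtain C where C: "\<And>x. x \<in> {-N..N} \<Longrightarrow> \<bar>\<phi> x\<bar> \<le> C"
    proof -
      have "compact (\<phi> ` {-N..N})" using c by (intro compact_continuous_image continuous_on_subset[OF c]) auto
      then obtain C where "\<And>y. y \<in> \<phi> ` {-N..N} \<Longrightarrow> norm y \<le> C" by (meson bounded_iff compact_imp_bounded)
      then have "\<bar>\<phi> x\<bar> \<le> C" if "x \<in> {-N..N}" for x using that by (simp flip: real_norm_def)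
      then show ?thesis by (rule that)
    qed
    have C0: "C \<ge> 0" using C[of 0] N by auto
    have B0: "B \<ge> 0" using B(1)[of 0] N by auto
    define \<Phi> :: "real \<Rightarrow> real" where "\<Phi> u = (LBINT y=ereal (-N)..ereal u. \<phi> y)" for u
    have s': "-N < x \<and> x < N" if "\<phi> x \<noteq> 0" for x using s[of x] that by auto
    have \<phi>int: "integrable lborel \<phi>" by (rule bdd[where C = C]) (use C s in auto)
    have \<Phi>1: "\<Phi> u = (LINT y:{-N..u}|lborel. \<phi> y)" if "-N \<le> u" for u
      unfolding \<Phi>_def using that by (simp add: interval_integral_Icc)
    \<comment> \<open>By mean zero \<Phi> is also minus the integral over the part to the right;
      this is the inner integral that appears when the order of integration is exchanged
      below.\<close>
    have tail: "\<Phi> u = - (LINT y|lborel. indicat_real {u..N} y * \<phi> y)" if "u \<in> {-N..N}" for u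
    proof -
      have "0 = (LINT y|lborel. indicat_real {-N..u} y * \<phi> y + indicat_real {u..N} y * \<phi> y)"
        unfolding m[symmetric]
      proof (rule integral_cong_AE)
        have "AE y in lborel. y \<noteq> u" by (rule AE_lborel_singleton)
        then show "AE y in lborel. \<phi> y = indicat_real {-N..u} y * \<phi> y + indicat_real {u..N} y * \<phi> y"
          by eventually_elim (use that s' in \<open>fastforce simp: indicator_def\<close>)
      qed measurable
      also have "\<dots> = (LINT y|lborel. indicat_real {-N..u} y * \<phi> y) + (LINT y|lborel. indicat_real {u..N} y * \<phi> y)"
        by (rule Bochner_Integration.integral_add)
          (use \<phi>int in \<open>auto intro!: integrable_mult_indicator[where 'b = real, simplified]\<close>)
      finally show ?thesis using \<Phi>1[of u] that by (simp add: set_lebesgue_integral_def)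
    qed
    have \<Phi>0: "\<Phi> u = 0" if "u \<notin> {-N..N}" for u
    proof (cases "u < -N")
      case True
      then have "\<Phi> u = - (LINT y:{u..-N}|lborel. \<phi> y)"
        unfolding \<Phi>_def by (subst interval_integral_endpoints_reverse) (simp add: interval_integral_Icc)
      also have "\<dots> = 0"
      proof -
        have "indicat_real {u..-N} y *\<^sub>R \<phi> y = 0" for y using s[of y] by (auto simp: indicator_def)
        then show ?thesis by (simp only: set_lebesgue_integral_def) simp
      qed
      finally show ?thesis .
    next
      case False
      then have "u > N" using that by auto
      then have "\<Phi> u = (LINT y:{-N..u}|lborel. \<phi> y)" using \<Phi>1 N by auto
      also have "\<dots> = (LINT y|lborel. \<phi> y)"
        unfolding set_lebesgue_integral_def
        by (intro Bochner_Integration.integral_cong) (use s' \<open>u > N\<close> in \<open>fastforce simp: indicator_def\<close>)+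
      finally show ?thesis using m by simp
    qed
    have der: "(\<Phi> has_vector_derivative \<phi> x) (at x)" for x
      unfolding \<Phi>_def by (rule continuous_antiderivative[OF c])
    have [measurable]: "\<Phi> \<in> borel_measurable borel"
      by (rule borel_measurable_continuous_onI)
        (use der in \<open>auto intro!: continuous_at_imp_continuous_on has_vector_derivative_continuous\<close>)
    have \<Phi>B: "\<bar>\<Phi> u\<bar> \<le> 2 * N * C" if "u \<in> {-N..N}" for u
    proof -
      have "\<bar>\<Phi> u\<bar> \<le> (LINT y|lborel. indicat_real {-N..N} y * C)"
        unfolding tail[OF that] abs_minus_cancel
      proof (rule integral_abs_bound_integral)
        show "integrable lborel (\<lambda>y. indicat_real {u..N} y * \<phi> y)"
          by (rule bdd[where C = C]) (use that C C0 in \<open>auto simp: indicator_def\<close>)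
        show "integrable lborel (\<lambda>t. indicat_real {-N..N} t * C)"
          by (rule bdd[where C = C]) (use C0 in \<open>auto simp: indicator_def\<close>)
      qed (use that C C0 in \<open>auto simp: indicator_def\<close>)
      also have "\<dots> = 2 * N * C" using N by (simp add: measure_def)
      finally show ?thesis .
    qed
    have pint: "integrable lborel (\<lambda>x. \<phi> x * p x)"
      by (rule bdd[where C = "C * B"]) (use B C s C0 in \<open>auto simp: abs_mult intro!: mult_mono\<close>)
    have qint: "integrable lborel (\<lambda>x. \<Phi> x * q x)"
      by (rule bdd[where C = "(2 * N * C) * B"]) (use B \<Phi>B \<Phi>0 N C0 in \<open>auto simp: abs_mult intro!: mult_mono\<close>)
    have Qint: "integrable lborel (\<lambda>x. \<phi> x * Q x)"
      by (rule bdd[where C = "C * (2 * N * B)"]) (use QB C s C0 in \<open>auto simp: abs_mult intro!: mult_mono\<close>)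
    have w0: "(LINT x|lborel. \<phi> x * p x - \<Phi> x * q x) = 0"
      by (rule weak[OF c der _ \<Phi>0]) (use s in auto)
    \<comment> \<open>The integrand \<phi>(x) q(t) on the triangle t \<le> x: integrating it in both
      orders amounts to integration by parts with a q that is merely bounded and measurable.\<close>
    define F where "F t x = indicat_real {-N..x} t * indicat_real {-N..N} x * (\<phi> x * q t)" for t x
    have parts: "(LINT t|lborel. \<Phi> t * q t) = - (LINT x|lborel. \<phi> x * Q x)"
    proof -
      have Fm: "(\<lambda>z. F (fst z) (snd z)) \<in> borel_measurable (borel \<Otimes>\<^sub>M borel)"
      proof -
        have [measurable]: "Measurable.pred (borel \<Otimes>\<^sub>M borel) (\<lambda>z::real \<times> real. fst z \<in> {-N..snd z})"
          by simp
        show ?thesis unfolding F_def indicator_def by measurable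
      qed
      have "integrable (lborel \<Otimes>\<^sub>M lborel) (case_prod F)"
      proof (rule integrableI_bounded_set[where A = "{-N..N} \<times> {-N..N}" and B = "C * B"])
        show "emeasure (lborel \<Otimes>\<^sub>M lborel) ({-N..N} \<times> {-N..N}) < \<infinity>"
          by (subst lborel.emeasure_pair_measure_Times) (use N in \<open>auto simp: ennreal_mult_less_top\<close>)
        show "case_prod F \<in> borel_measurable (lborel \<Otimes>\<^sub>M lborel)" using Fm by (simp add: case_prod_beta')
        show "AE x in lborel \<Otimes>\<^sub>M lborel. x \<in> {-N..N} \<times> {-N..N} \<longrightarrow> norm (case_prod F x) \<le> C * B"
          by (rule AE_I2) (use B C C0 B0 in \<open>auto simp: F_def indicator_def abs_mult intro!: mult_mono\<close>)
        show "AE x in lborel \<Otimes>\<^sub>M lborel. x \<notin> {-N..N} \<times> {-N..N} \<longrightarrow> case_prod F x = 0"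
          by (rule AE_I2) (auto simp: F_def indicator_def)
      qed auto
      from lborel_pair.Fubini_integral[OF this]
      have "(LINT x|lborel. LINT t|lborel. F t x) = (LINT t|lborel. LINT x|lborel. F t x)" .
      moreover have "(LINT t|lborel. F t x) = \<phi> x * Q x" for x
      proof -
        have "(LINT t|lborel. F t x) = (LINT t|lborel. (indicat_real {-N..N} x * \<phi> x) * (indicat_real {-N..x} t * q t))"
          by (simp add: F_def mult_ac)
        also have "\<dots> = (indicat_real {-N..N} x * \<phi> x) * Q x"
          by (subst integral_mult_right_zero) (simp add: Q_def set_lebesgue_integral_def)
        also have "\<dots> = \<phi> x * Q x" using s'[of x] by (cases "\<phi> x = 0") (auto simp: indicator_def)
        finally show ?thesis .
      qed
      moreover have "(LINT x|lborel. F t x) = - (\<Phi> t * q t)" for t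
      proof (cases "t \<in> {-N..N}")
        case True
        have "(LINT x|lborel. F t x) = (LINT x|lborel. q t * (indicat_real {t..N} x * \<phi> x))"
          by (rule Bochner_Integration.integral_cong) (use True in \<open>auto simp: F_def indicator_def\<close>)
        also have "\<dots> = q t * (LINT x|lborel. indicat_real {t..N} x * \<phi> x)"
          by (rule integral_mult_right_zero)
        finally show ?thesis using tail[OF True] by simp
      next
        case False
        then have "F t x = 0" for x by (auto simp: F_def indicator_def)
        then show ?thesis using \<Phi>0[OF False] by simp
      qed
      ultimately show ?thesis by simp
    qed
    have "(LINT x|lborel. \<phi> x * g x) = (LINT x|lborel. \<phi> x * p x + \<phi> x * Q x)"
      by (rule Bochner_Integration.integral_cong) (use s in \<open>auto simp: g_def indicator_def algebra_simps\<close>)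
    also have "\<dots> = (LINT x|lborel. \<phi> x * p x) - (LINT x|lborel. \<Phi> x * q x)"
      using pint Qint parts by simp
    also have "\<dots> = 0" using w0 pint qint by simp
    finally show ?thesis .
  qed
  define \<tau> where "\<tau> a b n x = min 1 (real n * max 0 (min (x - a) (b - x)))" for a b x and n :: nat
  have \<tau>c: "continuous_on UNIV (\<tau> a b n)" for a b n
    unfolding \<tau>_def by (intro continuous_intros)
  have \<tau>s: "\<tau> a b n x = 0" if "-N \<le> a" "b \<le> N" "x \<notin> {-N<..<N}" for a b n x
  proof -
    have "max 0 (min (x - a) (b - x)) = 0" using that by (auto simp: max_def min_def)
    then show ?thesis by (simp add: \<tau>_def)
  qed
  have \<tau>B: "\<bar>\<tau> a b n x\<bar> \<le> 1" for a b n x by (auto simp: \<tau>_def)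
  have \<tau>m [measurable]: "\<tau> a b n \<in> borel_measurable borel" for a b n
    using \<tau>c by (rule borel_measurable_continuous_onI)
  have \<tau>int: "integrable lborel (\<tau> a b n)" if "-N \<le> a" "b \<le> N" for a b n
    by (rule bdd[where C = 1]) (use \<tau>s that \<tau>B in auto)
  have \<tau>gint: "integrable lborel (\<lambda>x. \<tau> a b n x * g x)" for a b n
    by (rule Bochner_Integration.integrable_bound[OF gint])
      (use gint \<tau>B in \<open>auto simp: abs_mult intro!: mult_left_le_one_le\<close>)
  \<comment> \<open>A reference trapezoid of positive mass: any other trapezoid minus a suitable
    multiple of it has mean zero, and k below is the mean of g with respect to it.\<close>
  define c where "c = (LINT x|lborel. \<tau> (-N) N 1 x)"
  have "c > 0"
  proof -
    \<comment> \<open>On [-N/2, N/2] the reference trapezoid is at least min 1 (N/2).\<close>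
    have "0 < (LINT x|lborel. indicat_real {-N/2..N/2} x * min 1 (N/2))" using N by (simp add: measure_def)
    also have "\<dots> \<le> c" unfolding c_def
      by (rule integral_mono) (use N \<tau>int in \<open>auto intro!: bdd[where C = 1] simp: indicator_def \<tau>_def\<close>)
    finally show ?thesis .
  qed
  define k where "k = (LINT x|lborel. \<tau> (-N) N 1 x * g x) / c"
  have lin: "(LINT x|lborel. \<tau> a b n x * g x) = k * (LINT x|lborel. \<tau> a b n x)" if "-N \<le> a" "b \<le> N" for a b n
  proof -
    let ?s = "(LINT x|lborel. \<tau> a b n x) / c"
    have "(LINT x|lborel. (\<tau> a b n x - ?s * \<tau> (-N) N 1 x) * g x) = 0"
    proof (rule key)
      show "continuous_on UNIV (\<lambda>x. \<tau> a b n x - ?s * \<tau> (-N) N 1 x)"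
        using \<tau>c by (intro continuous_intros) auto
      show "\<tau> a b n x - ?s * \<tau> (-N) N 1 x = 0" if "x \<notin> {-N<..<N}" for x
        using \<tau>s[OF \<open>-N \<le> a\<close> \<open>b \<le> N\<close> that] \<tau>s[of "-N" N x 1] that by simp
      show "(LINT x|lborel. \<tau> a b n x - ?s * \<tau> (-N) N 1 x) = 0"
        using \<tau>int[OF that, of n] \<tau>int[of "-N" N 1] \<open>c > 0\<close> c_def[symmetric] by (simp del: One_nat_def)
    qed
    moreover have "(LINT x|lborel. (\<tau> a b n x - ?s * \<tau> (-N) N 1 x) * g x) = (LINT x|lborel. \<tau> a b n x * g x) - ?s * (LINT x|lborel. \<tau> (-N) N 1 x * g x)"
    proof -
      have "(\<lambda>x. (\<tau> a b n x - ?s * \<tau> (-N) N 1 x) * g x) = (\<lambda>x. \<tau> a b n x * g x - ?s * (\<tau> (-N) N 1 x * g x))"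
        by (auto simp: algebra_simps)
      then show ?thesis using \<tau>gint by simp
    qed
    ultimately show ?thesis by (simp add: k_def)
  qed
  have int: "(LINT x:{a<..<b}|lborel. g x - k * indicat_real {-N<..<N} x) = 0" if "-N \<le> a" "a < b" "b \<le> N" for a b
  proof -
    have i1: "integrable lborel (\<lambda>x. k * indicat_real {-N<..<N} x)"
      by (rule bdd[where C = "\<bar>k\<bar>"]) (auto simp: indicator_def)
    have "(\<lambda>n. LINT x|lborel. \<tau> a b n x * (g x - k * indicat_real {-N<..<N} x)) \<longlonglongrightarrow> (LINT x:{a<..<b}|lborel. g x - k * indicat_real {-N<..<N} x)"
      unfolding \<tau>_def by (rule integral_trapezoid_tendsto) (use gint i1 in auto)
    moreover have "(LINT x|lborel. \<tau> a b n x * (g x - k * indicat_real {-N<..<N} x)) = 0" for n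
    proof -
      have "(\<lambda>x. \<tau> a b n x * (g x - k * indicat_real {-N<..<N} x)) = (\<lambda>x. \<tau> a b n x * g x - k * \<tau> a b n x)"
        using \<tau>s[OF that(1,3)] by (auto simp: fun_eq_iff indicator_def algebra_simps)
      then show ?thesis using lin[OF that(1,3), of n] \<tau>gint \<tau>int[OF that(1,3)] by simp
    qed
    ultimately show ?thesis by (simp add: LIMSEQ_const_iff)
  qed
  have "AE x in lborel. g x - k * indicat_real {-N<..<N} x = 0"
  proof (rule AE_zero_of_interval_integrals[where N = N])
    show "integrable lborel (\<lambda>x. g x - k * indicat_real {-N<..<N} x)"
    proof (rule Bochner_Integration.integrable_diff[OF gint])
      show "integrable lborel (\<lambda>x. k * indicat_real {-N<..<N} x)"
        by (rule bdd[where C = "\<bar>k\<bar>"]) (auto simp: indicator_def)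
    qed
  qed (use int in \<open>auto simp: g_def\<close>)
  then have "AE x in lborel. x \<in> {-N<..<N} \<longrightarrow> p x + (LINT t:{-N..x}|lborel. q t) = k"
    by eventually_elim (auto simp: g_def Q_def)
  then show ?thesis by (rule that)
qed

text \<open>The functions p and q are replaced by Borel functions that agree with them almost
  everywhere on [-N, N] and are set to 0 where the bound fails, since the argument above runs on
  Borel products with bounds at every point. Writing \<open>\<bar>B\<bar>\<close> makes the value 0
  admissible also for negative B.\<close>

lemma du_Bois_Reymond_lebesgue:
  fixes p q :: "real \<Rightarrow> real"
  assumes pm: "p \<in> borel_measurable lebesgue" and qm: "q \<in> borel_measurable lebesgue" and N: "N > 0"
    and B: "AE x in lebesgue. x \<in> {-N..N} \<longrightarrow> \<bar>p x\<bar> \<le> B" "AE x in lebesgue. x \<in> {-N..N} \<longrightarrow> \<bar>q x\<bar> \<le> B"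
    and weak: "\<And>\<phi> \<Phi>. continuous_on UNIV \<phi> \<Longrightarrow> (\<And>x. (\<Phi> has_vector_derivative \<phi> x) (at x)) \<Longrightarrow>
       (\<And>x. x \<notin> {-N..N} \<Longrightarrow> \<phi> x = 0) \<Longrightarrow> (\<And>x. x \<notin> {-N..N} \<Longrightarrow> \<Phi> x = 0) \<Longrightarrow>
       (LINT x|lebesgue. \<phi> x * p x - \<Phi> x * q x) = 0"
  obtains k where "AE x in lebesgue. x \<in> {-N<..<N} \<longrightarrow> p x + integral {-N..x} q = k"
proof -
  obtain p' where p': "p' \<in> borel_measurable lborel" "AE x in lborel. p x = p' x"
    using completion_ex_borel_measurable_real[OF pm] by blast
  obtain q' where q': "q' \<in> borel_measurable lborel" "AE x in lborel. q x = q' x"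
    using completion_ex_borel_measurable_real[OF qm] by blast
  define p'' where "p'' x = (if x \<in> {-N..N} \<and> \<bar>p' x\<bar> \<le> \<bar>B\<bar> then p' x else 0)" for x
  define q'' where "q'' x = (if x \<in> {-N..N} \<and> \<bar>q' x\<bar> \<le> \<bar>B\<bar> then q' x else 0)" for x
  have [measurable]: "p' \<in> borel_measurable borel" "q' \<in> borel_measurable borel" using p' q' by auto
  have pm'' [measurable]: "p'' \<in> borel_measurable borel" unfolding p''_def by measurable
  have qm'' [measurable]: "q'' \<in> borel_measurable borel" unfolding q''_def by measurable
  have pe: "AE x in lebesgue. x \<in> {-N..N} \<longrightarrow> p'' x = p x"
    using AE_completion[OF p'(2)] B(1) by eventually_elim (auto simp: p''_def)
  have qe: "AE x in lebesgue. x \<in> {-N..N} \<longrightarrow> q'' x = q x"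
    using AE_completion[OF q'(2)] B(2) by eventually_elim (auto simp: q''_def)
  obtain k where k: "AE x in lborel. x \<in> {-N<..<N} \<longrightarrow> p'' x + (LINT t:{-N..x}|lborel. q'' t) = k"
  proof (rule du_Bois_Reymond[OF pm'' qm'' _ _ N, where B = "\<bar>B\<bar>"])
    show "\<bar>p'' x\<bar> \<le> \<bar>B\<bar>" "\<bar>q'' x\<bar> \<le> \<bar>B\<bar>" for x by (auto simp: p''_def q''_def)
    fix \<phi> \<Phi> :: "real \<Rightarrow> real"
    assume \<phi>: "continuous_on UNIV \<phi>" "\<And>x. (\<Phi> has_vector_derivative \<phi> x) (at x)"
       "\<And>x. x \<notin> {-N..N} \<Longrightarrow> \<phi> x = 0" "\<And>x. x \<notin> {-N..N} \<Longrightarrow> \<Phi> x = 0"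
    have [measurable]: "\<phi> \<in> borel_measurable borel" using \<phi>(1) by (rule borel_measurable_continuous_onI)
    have [measurable]: "\<Phi> \<in> borel_measurable borel"
      by (rule borel_measurable_continuous_onI)
        (use \<phi>(2) in \<open>auto intro!: continuous_at_imp_continuous_on has_vector_derivative_continuous\<close>)
    have m: "\<phi> \<in> borel_measurable lebesgue" "\<Phi> \<in> borel_measurable lebesgue" "p'' \<in> borel_measurable lebesgue" "q'' \<in> borel_measurable lebesgue"
      by (auto intro!: measurable_completion)
    have "(LINT x|lborel. \<phi> x * p'' x - \<Phi> x * q'' x) = (LINT x|lebesgue. \<phi> x * p'' x - \<Phi> x * q'' x)"
      by (rule integral_completion[symmetric]) measurable
    also have "\<dots> = (LINT x|lebesgue. \<phi> x * p x - \<Phi> x * q x)"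
    proof (rule integral_cong_AE)
      show "AE x in lebesgue. \<phi> x * p'' x - \<Phi> x * q'' x = \<phi> x * p x - \<Phi> x * q x"
        using pe qe
      proof eventually_elim
        case (elim x)
        then show ?case using \<phi>(3,4)[of x] by (cases "x \<in> {-N..N}") auto
      qed
    qed (use m pm qm in \<open>auto intro!: borel_measurable_diff borel_measurable_times\<close>)
    also have "\<dots> = 0" by (rule weak[OF \<phi>])
    finally show "(LINT x|lborel. \<phi> x * p'' x - \<Phi> x * q'' x) = 0" .
  qed
  obtain S where S: "negligible S" "{x. \<not> (x \<in> {-N..N} \<longrightarrow> q'' x = q x)} \<subseteq> S"
    using qe by (auto simp: eventually_ae_filter_negligible)
  have Qe: "(LINT t:{-N..x}|lborel. q'' t) = integral {-N..x} q" if "x \<in> {-N<..<N}" for x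
  proof -
    have "set_integrable lborel {-N..x} q''"
      unfolding set_integrable_def
      by (rule integrableI_bounded_set[where A = "{-N..N}" and B = "\<bar>B\<bar>"])
        (use that N in \<open>auto simp: indicator_def q''_def\<close>)
    then have "(LINT t:{-N..x}|lborel. q'' t) = integral {-N..x} q''"
      by (rule set_borel_integral_eq_integral)
    also have "\<dots> = integral {-N..x} q"
      by (rule integral_spike[OF S(1)]) (use S(2) that in auto)
    finally show ?thesis .
  qed
  have "AE x in lebesgue. x \<in> {-N<..<N} \<longrightarrow> p x + integral {-N..x} q = k"
    using AE_completion[OF k] pe
    by eventually_elim (auto simp: Qe)
  then show ?thesis by (rule that)
qed

subsection \<open>The integrated form of the equation\<close>

text \<open>This serves to control f: almost all values of v lie in this compact set, on which f is
  continuous, so that \<open>f (v \<xi>)\<close> is essentially bounded and measurable.\<close>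

lemma ess_im_compact:
  fixes v :: "real \<Rightarrow> 'a::euclidean_space"
  assumes v: "Linf v"
  shows "compact (ess_im v)"
proof -
  obtain B where B: "AE \<xi> in lebesgue. norm (v \<xi>) \<le> B" using v by (auto simp: Linf_def)
  have "ess_im v \<subseteq> cball 0 B"
  proof
    fix u assume u: "u \<in> ess_im v"
    show "u \<in> cball 0 B"
    proof (rule ccontr)
      assume "u \<notin> cball 0 B"
      then have "emeasure lebesgue (v -` (- cball 0 B) \<inter> UNIV) > 0"
        using u unfolding ess_im_def ess_im_on_def by (simp add: open_Compl)
      moreover have "AE t in lebesgue. t \<notin> v -` (- cball 0 B)"
        using B by eventually_elim auto
      then have "emeasure lebesgue {t \<in> space lebesgue. t \<in> v -` (- cball 0 B)} = 0"
        by (rule emeasure_eq_0_AE)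
      moreover have "{t \<in> space lebesgue. t \<in> v -` (- cball 0 B)} = v -` (- cball 0 B) \<inter> UNIV"
        by auto
      ultimately show False by simp
    qed
  qed
  moreover have "closed (ess_im v)"
    unfolding closed_def
  proof (subst open_subopen, safe)
    fix u assume "u \<notin> ess_im v"
    then obtain U where U: "open U" "u \<in> U" "\<not> emeasure lebesgue (v -` U \<inter> UNIV) > 0"
      by (auto simp: ess_im_def ess_im_on_def)
    then have "U \<subseteq> - ess_im v" by (auto simp: ess_im_def ess_im_on_def)
    with U show "\<exists>T. open T \<and> u \<in> T \<and> T \<subseteq> - ess_im v" by blast
  qed
  ultimately show ?thesis by (meson bounded_cball bounded_subset compact_eq_bounded_closed)
qed

lemma Linf_integrable_on:
  fixes v :: "real \<Rightarrow> 'a::euclidean_space"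
  assumes v: "Linf v"
  shows "v integrable_on {a..b}"
proof -
  obtain B where B: "AE \<xi> in lebesgue. norm (v \<xi>) \<le> B" and vm: "v \<in> borel_measurable lebesgue"
    using v by (auto simp: Linf_def)
  have "set_integrable lebesgue {a..b} v"
    unfolding set_integrable_def
  proof (rule integrableI_bounded_set[where A = "{a..b}" and B = B])
    show "AE x in lebesgue. x \<in> {a..b} \<longrightarrow> norm (indicat_real {a..b} x *\<^sub>R v x) \<le> B"
      using B by eventually_elim (auto simp: indicator_def)
    show "(\<lambda>x. indicat_real {a..b} x *\<^sub>R v x) \<in> borel_measurable lebesgue"
      using vm by (intro borel_measurable_scaleR borel_measurable_indicator) auto
    show "emeasure lebesgue {a..b} < \<infinity>" by (cases "a \<le> b") auto
  qed auto
  then show ?thesis by (rule set_lebesgue_integral_eq_integral)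
qed

text \<open>Du Bois-Reymond, applied to each component, makes
  \<open>h x + integral {-N..x} v\<close> constant almost everywhere on (-N, N); subtracting at x
  and y removes the constant. One set Z of full measure serves all pairs x, y.\<close>

lemma weak_solution_increment:
  fixes f :: "real^'n \<Rightarrow> real^'n"
  assumes f: "continuous_on \<U> f" and sol: "self_similar_weak_solution f \<U> v"
  obtains Z where "AE \<xi> in lebesgue. \<xi> \<in> Z"
    "\<And>x y. x \<in> Z \<Longrightarrow> y \<in> Z \<Longrightarrow> x \<le> y \<Longrightarrow>
       f (v y) - f (v x) - x *\<^sub>R (v y - v x) = integral {x..y} (\<lambda>t. v y - v t)"
proof -
  have v: "Linf v" and K: "ess_im v \<subseteq> strictly_hyperbolic_set f \<U>"
    and weak: "\<And>\<psi> :: real \<Rightarrow> real^'n. \<psi> C1_differentiable_on UNIV \<Longrightarrow> compact (closure (support_on UNIV \<psi>)) \<Longrightarrow>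
        (LINT \<xi>|lebesgue. vector_derivative \<psi> (at \<xi>) \<bullet> (- \<xi> *\<^sub>R v \<xi> + f (v \<xi>)) - \<psi> \<xi> \<bullet> v \<xi>) = 0"
    using sol by (auto simp: self_similar_weak_solution_def)
  have vm: "v \<in> borel_measurable lebesgue" using v by (auto simp: Linf_def)
  have KU: "ess_im v \<subseteq> \<U>" using K by (auto simp: strictly_hyperbolic_set_def)
  have cK: "compact (ess_im v)" by (rule ess_im_compact[OF v])
  have AEK: "AE \<xi> in lebesgue. v \<xi> \<in> ess_im v"
    using AE_in_ess_im_on[OF vm, of UNIV] by (simp add: ess_im_def)
  obtain B where B: "\<And>u. u \<in> ess_im v \<Longrightarrow> norm u \<le> B"
    using compact_imp_bounded[OF cK] by (auto simp: bounded_iff)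
  have "compact (f ` ess_im v)" using f KU cK by (meson compact_continuous_image continuous_on_subset)
  then obtain C where C: "\<And>u. u \<in> ess_im v \<Longrightarrow> norm (f u) \<le> C"
    using compact_imp_bounded[of "f ` ess_im v"] by (auto simp: bounded_iff)
  \<comment> \<open>Outside \<open>\<U>\<close> nothing is known about f. Multiplying by the
    indicator of the compact essential image gives a Borel function of the state and changes
    \<open>f (v \<xi>)\<close> only on a null set.\<close>
  have fvm: "(\<lambda>\<xi>. f (v \<xi>)) \<in> borel_measurable lebesgue"
  proof -
    have "(\<lambda>u. indicat_real (ess_im v) u *\<^sub>R f u) \<in> borel_measurable borel"
      by (rule borel_measurable_continuous_on_indicator)
        (use cK f KU in \<open>auto intro: continuous_on_subset borel_closed compact_imp_closed\<close>)
    then have m: "(\<lambda>\<xi>. indicat_real (ess_im v) (v \<xi>) *\<^sub>R f (v \<xi>)) \<in> borel_measurable lebesgue"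
      using measurable_compose[OF vm] by blast
    have "AE \<xi> in lebesgue. indicat_real (ess_im v) (v \<xi>) *\<^sub>R f (v \<xi>) = f (v \<xi>)"
      using AEK by eventually_elim auto
    with m show ?thesis by (rule borel_measurable_AE)
  qed
  define h where "h \<xi> = - \<xi> *\<^sub>R v \<xi> + f (v \<xi>)" for \<xi>
  have hm: "h \<in> borel_measurable lebesgue"
    unfolding h_def using vm fvm
    by (intro borel_measurable_add borel_measurable_scaleR) (auto intro!: measurable_completion)
  have ex: "\<exists>k. AE x in lebesgue. x \<in> {-N<..<N} \<longrightarrow> h x \<bullet> b + integral {-N..x} (\<lambda>t. v t \<bullet> b) = k" if N: "N > 0" for N b
  proof -
    have "\<And>thesis. (\<And>k. AE x in lebesgue. x \<in> {-N<..<N} \<longrightarrow> h x \<bullet> b + integral {-N..x} (\<lambda>t. v t \<bullet> b) = k \<Longrightarrow> thesis) \<Longrightarrow> thesis"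
    proof (rule du_Bois_Reymond_lebesgue[where p = "\<lambda>x. h x \<bullet> b" and q = "\<lambda>x. v x \<bullet> b" and N = N and B = "(N * \<bar>B\<bar> + \<bar>C\<bar> + \<bar>B\<bar>) * norm b"])
      show "(\<lambda>x. h x \<bullet> b) \<in> borel_measurable lebesgue" "(\<lambda>x. v x \<bullet> b) \<in> borel_measurable lebesgue"
        using hm vm by (auto intro!: borel_measurable_inner)
      show "AE x in lebesgue. x \<in> {-N..N} \<longrightarrow> \<bar>h x \<bullet> b\<bar> \<le> (N * \<bar>B\<bar> + \<bar>C\<bar> + \<bar>B\<bar>) * norm b"
        using AEK
      proof eventually_elim
        case (elim x)
        show ?case
        proof
          assume x: "x \<in> {-N..N}"
          have "norm (h x) \<le> \<bar>x\<bar> * norm (v x) + norm (f (v x))"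
            unfolding h_def by (rule order_trans[OF norm_triangle_ineq]) simp
          also have "\<dots> \<le> N * \<bar>B\<bar> + \<bar>C\<bar>"
          proof (rule add_mono)
            show "\<bar>x\<bar> * norm (v x) \<le> N * \<bar>B\<bar>"
              by (rule mult_mono) (use x B[OF elim] N in auto)
          qed (use C[OF elim] in linarith)
          finally have "norm (h x) \<le> N * \<bar>B\<bar> + \<bar>C\<bar> + \<bar>B\<bar>" by linarith
          then have "norm (h x) * norm b \<le> (N * \<bar>B\<bar> + \<bar>C\<bar> + \<bar>B\<bar>) * norm b"
            by (rule mult_right_mono) simp
          with Cauchy_Schwarz_ineq2[of "h x" b]
          show "\<bar>h x \<bullet> b\<bar> \<le> (N * \<bar>B\<bar> + \<bar>C\<bar> + \<bar>B\<bar>) * norm b"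
            by linarith
        qed
      qed
      show "AE x in lebesgue. x \<in> {-N..N} \<longrightarrow> \<bar>v x \<bullet> b\<bar> \<le> (N * \<bar>B\<bar> + \<bar>C\<bar> + \<bar>B\<bar>) * norm b"
        using AEK
      proof eventually_elim
        case (elim x)
        have "\<bar>v x \<bullet> b\<bar> \<le> norm (v x) * norm b" by (rule Cauchy_Schwarz_ineq2)
        also have "\<dots> \<le> (N * \<bar>B\<bar> + \<bar>C\<bar> + \<bar>B\<bar>) * norm b"
        proof (rule mult_right_mono)
          have "0 \<le> N * \<bar>B\<bar>" using N by simp
          then show "norm (v x) \<le> N * \<bar>B\<bar> + \<bar>C\<bar> + \<bar>B\<bar>" using B[OF elim] by linarith
        qed simp
        finally show ?case by simp
      qed
      fix \<phi> \<Phi> :: "real \<Rightarrow> real"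
      assume \<phi>: "continuous_on UNIV \<phi>" "\<And>x. (\<Phi> has_vector_derivative \<phi> x) (at x)"
         "\<And>x. x \<notin> {-N..N} \<Longrightarrow> \<phi> x = 0" "\<And>x. x \<notin> {-N..N} \<Longrightarrow> \<Phi> x = 0"
      have d: "((\<lambda>x. \<Phi> x *\<^sub>R b) has_vector_derivative \<phi> x *\<^sub>R b) (at x)" for x
        using bounded_linear.has_vector_derivative[OF bounded_linear_scaleR_left \<phi>(2)] by blast
      have "(LINT \<xi>|lebesgue. vector_derivative (\<lambda>x. \<Phi> x *\<^sub>R b) (at \<xi>) \<bullet> (- \<xi> *\<^sub>R v \<xi> + f (v \<xi>)) - (\<Phi> \<xi> *\<^sub>R b) \<bullet> v \<xi>) = 0"
      proof (rule weak)
        show "(\<lambda>x. \<Phi> x *\<^sub>R b) C1_differentiable_on UNIV"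
          unfolding C1_differentiable_on_def
          by (rule exI[of _ "\<lambda>x. \<phi> x *\<^sub>R b"]) (use d \<phi>(1) in \<open>auto intro!: continuous_intros\<close>)
        have "support_on UNIV (\<lambda>x. \<Phi> x *\<^sub>R b) \<subseteq> {-N..N}"
        proof
          fix x assume "x \<in> support_on UNIV (\<lambda>x. \<Phi> x *\<^sub>R b)"
          then show "x \<in> {-N..N}" using \<phi>(4)[of x] by (auto simp: support_on_def)
        qed
        then show "compact (closure (support_on UNIV (\<lambda>x. \<Phi> x *\<^sub>R b)))"
          by (meson bounded_closed_interval bounded_subset compact_closure)
      qed
      then show "(LINT x|lebesgue. \<phi> x * (h x \<bullet> b) - \<Phi> x * (v x \<bullet> b)) = 0"
        by (simp add: vector_derivative_at[OF d] h_def inner_commute)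
    qed (use N in auto)
    then show ?thesis by blast
  qed
  \<comment> \<open>Each window has its own constant, since the lower limit of the integral moves;
    \<open>Suc n\<close> keeps the half-width positive.\<close>
  define k where "k n b = (SOME k. AE x in lebesgue. x \<in> {-real (Suc n)<..<real (Suc n)} \<longrightarrow>
     h x \<bullet> b + integral {-real (Suc n)..x} (\<lambda>t. v t \<bullet> b) = k)" for n b
  have k: "AE x in lebesgue. x \<in> {-real (Suc n)<..<real (Suc n)} \<longrightarrow>
     h x \<bullet> b + integral {-real (Suc n)..x} (\<lambda>t. v t \<bullet> b) = k n b" for n b
    unfolding k_def by (rule someI_ex, rule ex) simp
  define Z where "Z = {x. \<forall>n. \<forall>b\<in>(Basis::(real^'n) set). x \<in> {-real (Suc n)<..<real (Suc n)} \<longrightarrow> h x \<bullet> b + integral {-real (Suc n)..x} (\<lambda>t. v t \<bullet> b) = k n b}"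
  have Z: "AE x in lebesgue. x \<in> Z"
    unfolding Z_def mem_Collect_eq AE_all_countable AE_finite_all[OF finite_Basis] using k by blast
  moreover have "f (v y) - f (v x) - x *\<^sub>R (v y - v x) = integral {x..y} (\<lambda>t. v y - v t)"
    if xy: "x \<in> Z" "y \<in> Z" "x \<le> y" for x y
  proof -
    obtain n where n: "max \<bar>x\<bar> \<bar>y\<bar> < real n" using reals_Archimedean2 by blast
    let ?N = "real (Suc n)"
    have xN: "x \<in> {-?N<..<?N}" "y \<in> {-?N<..<?N}" using n by auto
    have E1: "h y - h x = - integral {x..y} v"
    proof (rule euclidean_eqI)
      fix b :: "real^'n" assume b: "b \<in> Basis"
      have int: "(\<lambda>t. v t \<bullet> b) integrable_on {c..d}" for c d
        using Linf_integrable_on[OF v] by (rule integrable_component)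
      have "h x \<bullet> b + integral {-?N..x} (\<lambda>t. v t \<bullet> b) = k n b" "h y \<bullet> b + integral {-?N..y} (\<lambda>t. v t \<bullet> b) = k n b"
        using xy xN b unfolding Z_def by blast+
      moreover have "integral {-?N..x} (\<lambda>t. v t \<bullet> b) + integral {x..y} (\<lambda>t. v t \<bullet> b) = integral {-?N..y} (\<lambda>t. v t \<bullet> b)"
        by (rule Henstock_Kurzweil_Integration.integral_combine) (use xN xy int in auto)
      moreover have "integral {x..y} (\<lambda>t. v t \<bullet> b) = integral {x..y} v \<bullet> b"
        by (rule integral_component_eq[OF Linf_integrable_on[OF v]])
      ultimately show "(h y - h x) \<bullet> b = (- integral {x..y} v) \<bullet> b"
        by (simp add: inner_diff_left)
    qed
    have E2: "integral {x..y} (\<lambda>t. v y - v t) = (y - x) *\<^sub>R v y - integral {x..y} v"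
      by (subst Henstock_Kurzweil_Integration.integral_diff) (use Linf_integrable_on[OF v] xy in auto)
    \<comment> \<open>The terms regroup: y v(y) - x v(x) - x (v(y) - v(x)) equals (y - x)
      v(y).\<close>
    have "f (v y) - f (v x) = y *\<^sub>R v y - x *\<^sub>R v x - integral {x..y} v"
      using E1 by (simp add: h_def algebra_simps)
    then show ?thesis unfolding E2 by (simp add: algebra_simps)
  qed
  ultimately show ?thesis by (rule that)
qed

text \<open>The integrand is set to 0 on the exceptional null set; \<open>D \<ge> 0\<close> makes
  this value admissible.\<close>

lemma norm_integral_le_AE:
  fixes g :: "real \<Rightarrow> 'a::euclidean_space"
  assumes g: "g integrable_on {x..y}" and xy: "x \<le> y" and D: "D \<ge> 0"
    and AE: "AE t in lebesgue. t \<in> {x..y} \<longrightarrow> norm (g t) \<le> D"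
  shows "norm (integral {x..y} g) \<le> D * (y - x)"
proof -
  obtain S where S: "negligible S" "{t. \<not> (t \<in> {x..y} \<longrightarrow> norm (g t) \<le> D)} \<subseteq> S"
    using AE by (auto simp: eventually_ae_filter_negligible)
  define g' where "g' t = (if t \<in> S then 0 else g t)" for t
  have "(g' has_integral integral {x..y} g) {x..y}"
    by (rule has_integral_spike[OF S(1) _ integrable_integral[OF g]]) (auto simp: g'_def)
  then have "norm (integral {x..y} g) \<le> D * measure lborel (cbox x y)"
    by (intro has_integral_bound[OF D, of g']) (use S(2) D in \<open>auto simp: g'_def\<close>)
  then show ?thesis using xy by simp
qed

subsection \<open>Continuously differentiable maps\<close>

text \<open>Mean value inequality for f minus its linearization at u, whose derivative
  \<open>f' z - f' u\<close> is small on a ball. The estimate is uniform in both points, as is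
  needed for chords that do not start at u.\<close>

lemma strongly_differentiable:
  fixes f :: "'a::euclidean_space \<Rightarrow> 'b::euclidean_space"
  assumes U: "open U" "u \<in> U" and d: "\<And>x. x \<in> U \<Longrightarrow> (f has_derivative blinfun_apply (f' x)) (at x)"
    and c: "continuous_on U f'" and e: "e > 0"
  obtains d where "d > 0" "ball u d \<subseteq> U"
    "\<forall>x\<in>ball u d. \<forall>y\<in>ball u d. norm (f y - f x - f' u (y - x)) \<le> e * norm (y - x)"
proof -
  have "isCont f' u" using c U by (simp add: continuous_on_eq_continuous_at)
  then obtain d1 where d1: "d1 > 0" "\<And>x. dist x u < d1 \<Longrightarrow> dist (f' x) (f' u) < e"
    using e unfolding continuous_at_eps_delta by blast
  obtain d2 where d2: "d2 > 0" "ball u d2 \<subseteq> U" using U openE by blast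
  let ?d = "min d1 d2"
  show ?thesis
  proof (rule that[of ?d], safe)
    fix x y assume xy: "x \<in> ball u ?d" "y \<in> ball u ?d"
    have "norm ((f y - f' u y) - (f x - f' u x)) \<le> e * norm (y - x)"
    proof (rule differentiable_bound[where S = "ball u ?d" and f' = "\<lambda>z h. f' z h - f' u h"])
      fix z assume z: "z \<in> ball u ?d"
      then have "z \<in> U" using d2 by auto
      have "((\<lambda>a. f a - f' u a) has_derivative (\<lambda>h. f' z h - f' u h)) (at z)"
        by (rule has_derivative_diff[OF d[OF \<open>z \<in> U\<close>] bounded_linear_imp_has_derivative[OF blinfun.bounded_linear_right]])
      then show "((\<lambda>a. f a - f' u a) has_derivative (\<lambda>h. f' z h - f' u h)) (at z within ball u ?d)"
        by (rule has_derivative_at_withinI)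
      have "onorm (\<lambda>h. f' z h - f' u h) = norm (f' z - f' u)"
        by (simp add: norm_blinfun.rep_eq minus_blinfun.rep_eq fun_diff_def)
      also have "\<dots> \<le> e" using d1(2)[of z] z by (simp add: dist_norm dist_commute less_imp_le norm_minus_commute)
      finally show "onorm (\<lambda>h. f' z h - f' u h) \<le> e" .
    qed (use xy in auto)
    then show "norm (f y - f x - f' u (y - x)) \<le> e * norm (y - x)"
      by (simp add: blinfun.diff_right algebra_simps)
  qed (use d1 d2 in auto)
qed

text \<open>This gives continuity of the derivative of a local inverse. The identity
  \<open>B y (C y x - C y0 x) = - (B y - B y0) (C y0 x)\<close> bounds the difference once
  \<open>B y\<close> is bounded below, a property it inherits from \<open>B y0\<close> near y0 with
  half the constant.\<close>

lemma continuous_on_blinfun_inv: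
  fixes B C :: "'x::topological_space \<Rightarrow> 'a::euclidean_space \<Rightarrow>\<^sub>L 'a"
  assumes B: "continuous_on S B" and bij: "\<And>y. y \<in> S \<Longrightarrow> bij (blinfun_apply (B y))"
    and C: "\<And>y. y \<in> S \<Longrightarrow> blinfun_apply (C y) = inv (blinfun_apply (B y))"
  shows "continuous_on S C"
  unfolding continuous_on_def
proof
  fix y0 assume y0: "y0 \<in> S"
  have lin: "linear (blinfun_apply (B y0))" by (rule bounded_linear.linear[OF blinfun.bounded_linear_right])
  obtain \<kappa> where \<kappa>: "\<kappa> > 0" "\<And>x. \<kappa> * norm x \<le> norm (B y0 x)"
    using linear_inj_bounded_below_pos[OF lin] bij[OF y0] by (auto simp: bij_def)
  have t: "(B \<longlongrightarrow> B y0) (at y0 within S)" using B y0 by (auto simp: continuous_on_def)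
  then have "eventually (\<lambda>y. dist (B y) (B y0) < \<kappa> / 2) (at y0 within S)"
    using \<kappa>(1) by (intro tendstoD) auto
  moreover have "eventually (\<lambda>y. y \<in> S) (at y0 within S)" by (simp add: eventually_at_filter)
  ultimately have bd: "eventually (\<lambda>y. norm (C y - C y0) \<le> (2 / \<kappa> * norm (C y0)) * norm (B y - B y0)) (at y0 within S)"
  proof eventually_elim
    case (elim y)
    show ?case
    proof (rule norm_blinfun_bound)
      fix x
      let ?z = "C y x - C y0 x"
      have BC: "B y (C y x) = x" "B y0 (C y0 x) = x"
        using bij elim y0 by (simp_all add: C bij_is_surj surj_f_inv_f)
      have "B y ?z = - (B y - B y0) (C y0 x)" using BC by (simp add: blinfun.diff_right blinfun.diff_left blinfun.minus_left)
      then have "norm (B y ?z) = norm ((B y - B y0) (C y0 x))" by simp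
      also have "\<dots> \<le> norm (B y - B y0) * norm (C y0 x)" by (rule norm_blinfun)
      also have "\<dots> \<le> norm (B y - B y0) * (norm (C y0) * norm x)"
        by (intro mult_left_mono norm_blinfun norm_ge_zero)
      finally have "norm (B y ?z) \<le> norm (B y - B y0) * (norm (C y0) * norm x)" .
      moreover have "\<kappa> / 2 * norm ?z \<le> norm (B y ?z)"
      proof -
        have "norm ((B y - B y0) ?z) \<le> norm (B y - B y0) * norm ?z" by (rule norm_blinfun)
        also have "\<dots> \<le> \<kappa> / 2 * norm ?z" using elim by (intro mult_right_mono) (auto simp: dist_norm)
        finally have "norm ((B y - B y0) ?z) \<le> \<kappa> / 2 * norm ?z" .
        moreover have "norm (B y0 ?z) \<le> norm (B y ?z) + norm ((B y - B y0) ?z)"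
        proof -
          have "B y0 ?z = B y ?z - (B y - B y0) ?z" by (simp add: blinfun.diff_left)
          then show ?thesis by (simp only: norm_triangle_ineq4)
        qed
        ultimately show ?thesis using \<kappa>(2)[of ?z] by (simp add: field_simps)
      qed
      ultimately have "\<kappa> / 2 * norm ?z \<le> norm (B y - B y0) * (norm (C y0) * norm x)" by linarith
      then have "norm ?z \<le> (2 / \<kappa>) * (norm (B y - B y0) * (norm (C y0) * norm x))"
        using \<kappa>(1) by (simp add: field_simps)
      then show "norm ((C y - C y0) x) \<le> 2 / \<kappa> * norm (C y0) * norm (B y - B y0) * norm x"
        by (simp add: blinfun.diff_left mult_ac)
    qed (use \<kappa>(1) in auto)
  qed
  have "((\<lambda>y. (2 / \<kappa> * norm (C y0)) * norm (B y - B y0)) \<longlongrightarrow> (2 / \<kappa> * norm (C y0)) * norm (B y0 - B y0)) (at y0 within S)"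
    by (intro tendsto_intros t)
  then have "((\<lambda>y. C y - C y0) \<longlongrightarrow> 0) (at y0 within S)"
    by (intro Lim_null_comparison[OF bd]) simp
  then show "(C \<longlongrightarrow> C y0) (at y0 within S)" by (simp add: Lim_null[symmetric])
qed

lemma C1_on_imp_continuous_on:
  assumes "C1_on S f"
  shows "continuous_on S f"
proof -
  obtain f' where "\<And>x. x \<in> S \<Longrightarrow> (f has_derivative blinfun_apply (f' x)) (at x)"
    using assms by (auto simp: C1_on_def)
  then show ?thesis by (meson continuous_at_imp_continuous_on has_derivative_continuous)
qed

lemma C1_on_subset: "C1_on S f \<Longrightarrow> T \<subseteq> S \<Longrightarrow> C1_on T f"
  unfolding C1_on_def by (meson continuous_on_subset subsetD)

lemma C1_on_cong_open:
  assumes f: "C1_on S f" and S: "open S" and eq: "\<And>x. x \<in> S \<Longrightarrow> f x = g x"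
  shows "C1_on S g"
proof -
  obtain f' where f': "\<forall>x\<in>S. (f has_derivative blinfun_apply (f' x)) (at x)" "continuous_on S f'"
    using f by (auto simp: C1_on_def)
  have "(g has_derivative blinfun_apply (f' x)) (at x)" if "x \<in> S" for x
    using f'(1)[rule_format, OF that] S that eq by (rule has_derivative_transform_within_open)
  with f'(2) show ?thesis by (auto simp: C1_on_def)
qed

text \<open>In finite dimension a family of linear maps is continuous in operator norm as soon as
  its values at each fixed h are continuous.\<close>

lemma C1_onI:
  fixes f :: "'a::euclidean_space \<Rightarrow> 'b::real_normed_vector"
  assumes d: "\<And>x. x \<in> S \<Longrightarrow> (f has_derivative D x) (at x)" and c: "\<And>h. continuous_on S (\<lambda>x. D x h)"
  shows "C1_on S f"
proof -
  have D: "blinfun_apply (Blinfun (D x)) = D x" if "x \<in> S" for x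
    using d[OF that] by (intro bounded_linear_Blinfun_apply has_derivative_bounded_linear)
  have "continuous_on S (\<lambda>x. Blinfun (D x))"
    by (rule continuous_on_blinfun_componentwise) (rule continuous_on_eq[OF c], simp add: D)
  then show ?thesis unfolding C1_on_def using d D by (intro exI[of _ "\<lambda>x. Blinfun (D x)"]) auto
qed

text \<open>The derivatives supplied by different neighbourhoods agree by uniqueness, so
  \<open>frechet_derivative\<close> is a common choice for all of them.\<close>

lemma C1_on_cover:
  fixes f :: "'a::euclidean_space \<Rightarrow> 'b::real_normed_vector"
  assumes "\<And>x. x \<in> S \<Longrightarrow> \<exists>V. open V \<and> x \<in> V \<and> C1_on V f"
  shows "C1_on S f"
proof (rule C1_onI)
  have loc: "f differentiable (at x) \<and> isCont (\<lambda>y. frechet_derivative f (at y) h) x" if x: "x \<in> S" for x h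
  proof -
    obtain V where V: "open V" "x \<in> V" "C1_on V f" using assms[OF x] by blast
    obtain f' where f': "\<And>y. y \<in> V \<Longrightarrow> (f has_derivative blinfun_apply (f' y)) (at y)" "continuous_on V f'"
      using V(3) by (auto simp: C1_on_def)
    have "continuous_on V (\<lambda>y. f' y h)" using f'(2) by (intro continuous_intros)
    then have "continuous_on V (\<lambda>y. frechet_derivative f (at y) h)"
      by (rule continuous_on_eq) (simp add: frechet_derivative_at[OF f'(1), symmetric])
    then show ?thesis
      using V f'(1)[OF V(2)] by (auto simp: continuous_on_eq_continuous_at differentiable_def)
  qed
  show "(f has_derivative frechet_derivative f (at x)) (at x)" if "x \<in> S" for x
    using loc[OF that] frechet_derivative_works by blast
  show "continuous_on S (\<lambda>x. frechet_derivative f (at x) h)" for h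
    using loc by (intro continuous_at_imp_continuous_on) blast
qed

lemma C1_on_normalize:
  fixes r :: "'a::euclidean_space \<Rightarrow> 'b::real_inner"
  assumes r: "C1_on V r" and nz: "\<And>x. x \<in> V \<Longrightarrow> r x \<noteq> 0"
  shows "C1_on V (\<lambda>x. r x /\<^sub>R norm (r x))"
proof -
  obtain r' where r': "\<And>x. x \<in> V \<Longrightarrow> (r has_derivative blinfun_apply (r' x)) (at x)" "continuous_on V r'"
    using r by (auto simp: C1_on_def)
  have cr: "continuous_on V r" using r by (rule C1_on_imp_continuous_on)
  \<comment> \<open>Quotient rule, where the derivative of the norm at \<open>r x\<close> in
    direction \<open>r' x h\<close> is the inner product with the unit vector.\<close>
  define D where "D x h = r' x h /\<^sub>R norm (r x) - ((r' x h \<bullet> (r x /\<^sub>R norm (r x))) / (norm (r x))^2) *\<^sub>R r x" for x h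
  show ?thesis
  proof (rule C1_onI)
    fix x assume x: "x \<in> V"
    have n: "((\<lambda>x. norm (r x)) has_derivative (\<lambda>h. r' x h \<bullet> (r x /\<^sub>R norm (r x)))) (at x)"
      using has_derivative_compose[OF r'(1)[OF x] has_derivative_norm[OF nz[OF x]]] by (simp add: sgn_div_norm)
    show "((\<lambda>x. r x /\<^sub>R norm (r x)) has_derivative D x) (at x)"
      unfolding D_def using nz[OF x]
      by (auto intro!: derivative_eq_intros r'(1)[OF x] n simp: fun_eq_iff power2_eq_square field_simps)
  next
    show "continuous_on V (\<lambda>x. D x h)" for h
      unfolding D_def by (intro continuous_intros cr r'(2)) (use nz in auto)
  qed
qed

lemma C1_on_uminus: "C1_on V r \<Longrightarrow> C1_on V (\<lambda>x. - r x)"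
  unfolding C1_on_def
  by (elim exE, rule_tac x = "\<lambda>x. - f' x" in exI)
    (auto intro!: continuous_intros has_derivative_minus simp: uminus_blinfun.rep_eq fun_Compl_def)

subsection \<open>Smooth dependence of simple eigenvalues\<close>

text \<open>Trades the Jacobian matrix for the derivative as an element of a normed space of linear
  maps, where C^1 dependence on the state can be expressed.\<close>

lemma C2_on_flux:
  fixes f :: "real^'n \<Rightarrow> real^'n"
  assumes "C2_on \<U> f"
  obtains f' where "\<And>x. x \<in> \<U> \<Longrightarrow> (f has_derivative blinfun_apply (f' x)) (at x)" "C1_on \<U> f'"
    "\<And>u r. u \<in> \<U> \<Longrightarrow> flux_matrix f u *v r = blinfun_apply (f' u) r"
proof -
  obtain f' where f': "\<And>x. x \<in> \<U> \<Longrightarrow> (f has_derivative blinfun_apply (f' x)) (at x)" "C1_on \<U> f'"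
    using assms by (auto simp: C2_on_def)
  show ?thesis
  proof (rule that[OF f'])
    fix u r assume u: "u \<in> \<U>"
    have "frechet_derivative f (at u) = blinfun_apply (f' u)"
      using frechet_derivative_at[OF f'(1)[OF u]] by simp
    then show "flux_matrix f u *v r = blinfun_apply (f' u) r"
      by (simp add: flux_matrix_def jacobian_def matrix_works bounded_linear.linear[OF blinfun.bounded_linear_right])
  qed
qed

lemma shift_matrix_mult: "(A - mat \<xi>) *v r = A *v r - \<xi> *\<^sub>R (r :: real^'n)" for A :: "real^'n^'n"
proof -
  have "mat \<xi> *v r = \<xi> *\<^sub>R r"
    by (simp add: matrix_vector_mult_def mat_def vec_eq_iff if_distrib[of "\<lambda>x. x * _"] sum.delta' cong: if_cong)
  then show ?thesis
    by (simp add: matrix_vector_mult_diff_rdistrib)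
qed

lemma det_shift_eq_0_iff: "det (A - mat \<xi>) = 0 \<longleftrightarrow> \<xi> \<in> real_eigenvalues A" for A :: "real^'n^'n"
proof -
  have "det (A - mat \<xi>) \<noteq> 0 \<longleftrightarrow> (\<forall>r. (A - mat \<xi>) *v r = 0 \<longrightarrow> r = 0)"
    by (simp only: invertible_det_nz[symmetric] invertible_left_inverse matrix_left_invertible_ker)
  then show ?thesis
    by (auto simp: real_eigenvalues_def right_eigenvector_def shift_matrix_mult)
qed

text \<open>The inverse function theorem is applied to \<open>(u, r, m) \<mapsto> (u, A(u)r - mr, r\<^sub>0 \<bullet> r)\<close>.\<close>

lemma eigenvector_implicit:
  fixes A :: "'a::euclidean_space \<Rightarrow> 'b::euclidean_space \<Rightarrow>\<^sub>L 'b"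
  assumes U: "open U" "u0 \<in> U" and A: "C1_on U A" and r0: "r0 \<noteq> 0" "A u0 r0 = l0 *\<^sub>R r0"
    and simple: "\<And>x m. A u0 x - l0 *\<^sub>R x = m *\<^sub>R r0 \<Longrightarrow> m = 0 \<and> (\<exists>c. x = c *\<^sub>R r0)"
  obtains V r \<mu> where "open V" "u0 \<in> V" "V \<subseteq> U" "C1_on V r" "C1_on V \<mu>" "\<mu> u0 = l0"
    "\<And>u. u \<in> V \<Longrightarrow> r u \<noteq> 0 \<and> A u (r u) = \<mu> u *\<^sub>R r u"
proof -
  obtain A' where A': "\<And>x. x \<in> U \<Longrightarrow> (A has_derivative blinfun_apply (A' x)) (at x)" "continuous_on U A'"
    using A by (auto simp: C1_on_def)
  define G :: "'a \<times> 'b \<times> real \<Rightarrow> 'a \<times> 'b \<times> real" where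
    "G = (\<lambda>p. (fst p, A (fst p) (fst (snd p)) - snd (snd p) *\<^sub>R fst (snd p), r0 \<bullet> fst (snd p)))"
  define DG where "DG p h = (fst h, (A' (fst p) (fst h)) (fst (snd p)) + A (fst p) (fst (snd h))
      - (snd (snd p) *\<^sub>R fst (snd h) + snd (snd h) *\<^sub>R fst (snd p)), r0 \<bullet> fst (snd h))" for p h :: "'a \<times> 'b \<times> real"
  let ?U = "U \<times> (UNIV :: ('b \<times> real) set)"
  have oU: "open ?U" using U by (intro open_Times) auto
  have dG: "(G has_derivative DG p) (at p)" if "p \<in> ?U" for p
  proof -
    have "fst p \<in> U" using that by auto
    have 1: "((\<lambda>p. A (fst p)) has_derivative (\<lambda>h. A' (fst p) (fst h))) (at p)"
      by (rule has_derivative_compose[OF has_derivative_fst[OF has_derivative_ident] A'(1)[OF \<open>fst p \<in> U\<close>]])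
    have 2: "((\<lambda>p. A (fst p) (fst (snd p))) has_derivative (\<lambda>h. A (fst p) (fst (snd h)) + (A' (fst p) (fst h)) (fst (snd p)))) (at p)"
      by (rule blinfun.FDERIV[OF 1]) (auto intro!: derivative_intros)
    show ?thesis unfolding G_def DG_def
      by (rule derivative_eq_intros 2 refl | simp add: fun_eq_iff algebra_simps)+
  qed
  have bl: "bounded_linear (DG p)" if "p \<in> ?U" for p
    using dG[OF that] by (rule has_derivative_bounded_linear)
  define G' where "G' p = Blinfun (DG p)" for p
  have G': "blinfun_apply (G' p) = DG p" if "p \<in> ?U" for p
    unfolding G'_def by (rule bounded_linear_Blinfun_apply[OF bl[OF that]])
  have cA: "continuous_on U A" using A by (rule C1_on_imp_continuous_on)
  have cG': "continuous_on ?U G'"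
  proof (rule continuous_on_blinfun_componentwise)
    fix i :: "'a \<times> 'b \<times> real" assume "i \<in> Basis"
    have c1: "continuous_on ?U (\<lambda>p. A (fst p))" "continuous_on ?U (\<lambda>p. A' (fst p))"
      by (rule continuous_on_compose2[OF cA] continuous_on_compose2[OF A'(2)]; auto intro!: continuous_intros)+
    have "continuous_on ?U (\<lambda>p. DG p i)"
      unfolding DG_def by (intro continuous_intros c1)
    then show "continuous_on ?U (\<lambda>p. G' p i)"
      by (rule continuous_on_eq) (simp add: G')
  qed
  define p0 where "p0 = (u0, r0, l0)"
  have p0: "p0 \<in> ?U" using U by (simp add: p0_def)
  have lin: "linear (DG p0)" using bl[OF p0] by (rule bounded_linear.linear)
  \<comment> \<open>On the kernel, a = 0 and (A - l0) b = c r0. Simplicity forces c = 0 and b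
    parallel to r0, and the normalization r0 \<bullet> b = 0 then gives b = 0.\<close>
  have "inj (DG p0)"
  proof (subst linear_injective_0[OF lin], safe)
    fix a b c assume "DG p0 (a, b, c) = 0"
    then have a: "a = 0" and b: "A u0 b - l0 *\<^sub>R b = c *\<^sub>R r0" and rb: "r0 \<bullet> b = 0"
      by (auto simp: DG_def p0_def zero_prod_def blinfun.zero_right blinfun.zero_left algebra_simps)
    from simple[OF b] obtain d where "c = 0" "b = d *\<^sub>R r0" by blast
    with rb r0 a show "(a, b, c) = 0" by (auto simp: zero_prod_def)
  qed
  then obtain L where L: "linear L" "L \<circ> DG p0 = id"
    using linear_injective_left_inverse[OF lin] by blast
  have invf: "Blinfun L o\<^sub>L G' p0 = id_blinfun"
    by (rule blinfun_eqI) (use L in \<open>simp add: G'[OF p0] bounded_linear_Blinfun_apply linear_conv_bounded_linear pointfree_idE\<close>)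
  obtain U' V g g' where UV: "open U'" "U' \<subseteq> ?U" "p0 \<in> U'" "open V" "G p0 \<in> V" "homeomorphism U' V G g"
    and g': "\<And>y. y \<in> V \<Longrightarrow> (g has_derivative (g' y)) (at y)"
    "\<And>y. y \<in> V \<Longrightarrow> g' y = inv (blinfun_apply (G' (g y)))"
    "\<And>y. y \<in> V \<Longrightarrow> bij (blinfun_apply (G' (g y)))"
    using inverse_function_theorem[OF oU _ cG' p0 invf, of G] dG G' by metis
  have gV: "g y \<in> U'" "G (g y) = y" if "y \<in> V" for y
    using UV(6) that by (auto simp: homeomorphism_def)
  have gG: "g (G p0) = p0" using UV(3,6) by (auto simp: homeomorphism_def)
  define C where "C y = Blinfun (g' y)" for y
  have C: "blinfun_apply (C y) = g' y" if "y \<in> V" for y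
    unfolding C_def by (rule bounded_linear_Blinfun_apply[OF has_derivative_bounded_linear[OF g'(1)[OF that]]])
  have cg: "continuous_on V g" using UV(6) by (auto simp: homeomorphism_def)
  have cC: "continuous_on V C"
  proof (rule continuous_on_blinfun_inv[where B = "\<lambda>y. G' (g y)"])
    show "continuous_on V (\<lambda>y. G' (g y))"
      by (rule continuous_on_compose2[OF cG' cg]) (use gV UV(2) in blast)
  qed (use g' C in auto)
  \<comment> \<open>The entry 0 prescribes the eigenvalue equation, and the last entry the
    normalization r0 \<bullet> r = r0 \<bullet> r0, which keeps r away from 0. The inverse map then
    returns the eigenvector and the eigenvalue.\<close>
  define \<iota> :: "'a \<Rightarrow> 'a \<times> 'b \<times> real" where "\<iota> u = (u, 0, r0 \<bullet> r0)" for u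
  define W where "W = \<iota> -` V"
  have ci: "continuous_on UNIV \<iota>" unfolding \<iota>_def by (intro continuous_intros)
  have W: "open W" unfolding W_def using ci UV(4) by (simp add: continuous_on_open_vimage)
  have G0: "G p0 = \<iota> u0" using r0 by (simp add: G_def p0_def \<iota>_def)
  have u0W: "u0 \<in> W" using UV(5) by (simp add: W_def G0)
  define r where "r u = fst (snd (g (\<iota> u)))" for u
  define \<mu> where "\<mu> u = snd (snd (g (\<iota> u)))" for u
  have di: "(\<iota> has_derivative (\<lambda>h. (h, 0, 0))) (at u)" for u
    unfolding \<iota>_def by (auto intro!: derivative_eq_intros simp: zero_prod_def)
  have dgi: "((\<lambda>u. g (\<iota> u)) has_derivative (\<lambda>h. C (\<iota> u) (h, 0, 0))) (at u)" if "u \<in> W" for u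
    using has_derivative_compose[OF di g'(1)[of "\<iota> u"]] that C by (simp add: W_def)
  have cCi: "continuous_on W (\<lambda>u. C (\<iota> u) x)" for x
    by (intro continuous_intros continuous_on_compose2[OF cC continuous_on_subset[OF ci]]) (auto simp: W_def)
  have C1: "C1_on W (\<lambda>u. P (g (\<iota> u)))" if P: "bounded_linear P" for P :: "'a \<times> 'b \<times> real \<Rightarrow> 'c::real_normed_vector"
  proof -
    have d: "((\<lambda>u. P (g (\<iota> u))) has_derivative (\<lambda>h. P (C (\<iota> u) (h, 0, 0)))) (at u)" if "u \<in> W" for u
      by (rule bounded_linear.has_derivative[OF P dgi[OF that]])
    show ?thesis
      by (rule C1_onI[OF d]) (use bounded_linear.continuous_on[OF P cCi] in auto)
  qed
  have eq: "u \<in> U \<and> r u \<noteq> 0 \<and> A u (r u) = \<mu> u *\<^sub>R r u" if "u \<in> W" for u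
  proof -
    have V: "\<iota> u \<in> V" using that by (simp add: W_def)
    have "g (\<iota> u) \<in> ?U" using gV(1)[OF V] UV(2) by blast
    moreover have "G (g (\<iota> u)) = (u, 0, r0 \<bullet> r0)" using gV(2)[OF V] by (simp add: \<iota>_def)
    ultimately show ?thesis using r0 unfolding G_def r_def \<mu>_def by (auto simp: mem_Times_iff)
  qed
  show ?thesis
  proof (rule that[OF W u0W])
    show "C1_on W r" unfolding r_def by (rule C1) (intro bounded_linear_intros)
    show "C1_on W \<mu>" unfolding \<mu>_def by (rule C1) (intro bounded_linear_intros)
    show "\<mu> u0 = l0" using gG unfolding G0 by (simp add: \<mu>_def p0_def)
  qed (use eq in auto)
qed

section \<open>Independence of eigenvectors and simple real spectra\<close>

lemma eigenvectors_independent: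
  assumes "finite S" "linear L" "\<And>\<mu>. \<mu> \<in> S \<Longrightarrow> R \<mu> \<noteq> 0 \<and> L (R \<mu>) = \<mu> *\<^sub>R R \<mu>"
    and "(\<Sum>\<mu>\<in>S. c \<mu> *\<^sub>R R \<mu>) = 0" "\<mu> \<in> S"
  shows "c \<mu> = 0"
  using assms(1,3-)
proof (induction S arbitrary: c \<mu> rule: finite_induct)
  case (insert \<nu> S)
  have s: "(\<Sum>\<mu>\<in>S. c \<mu> *\<^sub>R R \<mu>) = - (c \<nu> *\<^sub>R R \<nu>)" using insert by (simp add: eq_neg_iff_add_eq_0 add.commute)
  \<comment> \<open>Applying L and subtracting \<nu> times the relation removes the term of \<nu>
    and multiplies each other one by the nonzero number \<mu> - \<nu>.\<close>
  have "L (\<Sum>\<mu>\<in>S. c \<mu> *\<^sub>R R \<mu>) = (\<Sum>\<mu>\<in>S. (c \<mu> * \<mu>) *\<^sub>R R \<mu>)"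
    using insert.prems(1) by (simp add: linear_sum[OF assms(2)] linear_cmul[OF assms(2)])
  moreover have "L (- (c \<nu> *\<^sub>R R \<nu>)) = \<nu> *\<^sub>R (- (c \<nu> *\<^sub>R R \<nu>))"
    using insert.prems(1)[of \<nu>] by (simp add: linear_neg[OF assms(2)] linear_cmul[OF assms(2)])
  ultimately have "(\<Sum>\<mu>\<in>S. (c \<mu> * \<mu>) *\<^sub>R R \<mu>) = \<nu> *\<^sub>R (\<Sum>\<mu>\<in>S. c \<mu> *\<^sub>R R \<mu>)" using s by simp
  then have "(\<Sum>\<mu>\<in>S. (c \<mu> * (\<mu> - \<nu>)) *\<^sub>R R \<mu>) = 0"
    by (simp add: scaleR_sum_right algebra_simps sum_subtractf)
  then have z: "c \<mu> * (\<mu> - \<nu>) = 0" if "\<mu> \<in> S" for \<mu>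
    using insert.IH[of "\<lambda>\<mu>. c \<mu> * (\<mu> - \<nu>)"] insert.prems(1) that by blast
  then have zS: "c \<mu> = 0" if "\<mu> \<in> S" for \<mu> using that insert.hyps by fastforce
  then have "c \<nu> *\<^sub>R R \<nu> = 0" using s by simp
  then have "c \<nu> = 0" using insert.prems(1)[of \<nu>] by simp
  then show ?case using zS insert.prems(3) by blast
qed simp

lemma eigenvectors_independent_set:
  fixes L :: "'a::euclidean_space \<Rightarrow> 'a"
  assumes S: "finite S" and L: "linear L" and R: "\<And>\<mu>. \<mu> \<in> S \<Longrightarrow> R \<mu> \<noteq> 0 \<and> L (R \<mu>) = \<mu> *\<^sub>R R \<mu>"
  shows "inj_on R S" "independent (R ` S)"
proof -
  show inj: "inj_on R S"
  proof (rule inj_onI)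
    fix \<mu> \<nu> assume "\<mu> \<in> S" "\<nu> \<in> S" "R \<mu> = R \<nu>"
    then show "\<mu> = \<nu>" using R by (metis scaleR_right_imp_eq)
  qed
  show "independent (R ` S)"
  proof (rule independent_if_scalars_zero)
    fix c x assume "(\<Sum>x\<in>R ` S. c x *\<^sub>R x) = 0" and x: "x \<in> R ` S"
    then have "(\<Sum>\<mu>\<in>S. c (R \<mu>) *\<^sub>R R \<mu>) = 0" by (simp add: sum.reindex[OF inj])
    then show "c x = 0" using eigenvectors_independent[OF S L R, of "\<lambda>\<mu>. c (R \<mu>)"] x by blast
  qed (use S in auto)
qed

lemma real_eigenvalues_eigenvectors:
  obtains R where "\<And>\<mu>. \<mu> \<in> real_eigenvalues A \<Longrightarrow> R \<mu> \<noteq> 0 \<and> A *v R \<mu> = \<mu> *\<^sub>R R \<mu>"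
proof (rule that[of "\<lambda>\<mu>. SOME r. right_eigenvector A \<mu> r"])
  fix \<mu> assume "\<mu> \<in> real_eigenvalues A"
  then have "right_eigenvector A \<mu> (SOME r. right_eigenvector A \<mu> r)"
    unfolding real_eigenvalues_def mem_Collect_eq by (rule someI_ex)
  then show "(SOME r. right_eigenvector A \<mu> r) \<noteq> 0 \<and> A *v (SOME r. right_eigenvector A \<mu> r) = \<mu> *\<^sub>R (SOME r. right_eigenvector A \<mu> r)"
    by (simp add: right_eigenvector_def)
qed

lemma finite_real_eigenvalues:
  fixes A :: "real^'n^'n"
  shows "finite (real_eigenvalues A)" "card (real_eigenvalues A) \<le> CARD('n)"
proof -
  obtain R where R: "\<And>\<mu>. \<mu> \<in> real_eigenvalues A \<Longrightarrow> R \<mu> \<noteq> 0 \<and> A *v R \<mu> = \<mu> *\<^sub>R R \<mu>"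
    by (rule real_eigenvalues_eigenvectors) blast
  have le: "card S \<le> CARD('n)" if "finite S" "S \<subseteq> real_eigenvalues A" for S
  proof -
    have R': "\<And>\<mu>. \<mu> \<in> S \<Longrightarrow> R \<mu> \<noteq> 0 \<and> A *v R \<mu> = \<mu> *\<^sub>R R \<mu>" using R that by blast
    have "inj_on R S" "independent (R ` S)"
      using eigenvectors_independent_set[OF that(1) matrix_vector_mul_linear R'] by blast+
    then show ?thesis using independent_bound[of "R ` S"] by (simp add: card_image)
  qed
  show "finite (real_eigenvalues A)"
  proof (rule ccontr)
    assume "infinite (real_eigenvalues A)"
    then obtain S where "S \<subseteq> real_eigenvalues A" "finite S" "card S = Suc CARD('n)"
      using infinite_arbitrarily_large by blast
    then show False using le[of S] by simp
  qed
  then show "card (real_eigenvalues A) \<le> CARD('n)" using le by blast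
qed

text \<open>With n distinct eigenvalues the eigenvectors form a basis, in which A - l0 multiplies
  the r0-coordinate by 0 and the others by nonzero numbers. So r0 is not in its range, and its
  kernel is spanned by r0: algebraic simplicity in the form that \<open>eigenvector_implicit\<close>
  uses.\<close>

lemma simple_eigenvalue:
  fixes A :: "real^'n^'n"
  assumes c: "card (real_eigenvalues A) = CARD('n)" and r0: "right_eigenvector A l0 r0"
    and x: "A *v x - l0 *\<^sub>R x = m *\<^sub>R r0"
  shows "m = 0 \<and> (\<exists>c. x = c *\<^sub>R r0)"
proof -
  let ?S = "real_eigenvalues A"
  have fin: "finite ?S" by (rule finite_real_eigenvalues)
  have l0: "l0 \<in> ?S" using r0 by (auto simp: real_eigenvalues_def)
  obtain R' where "\<And>\<mu>. \<mu> \<in> ?S \<Longrightarrow> R' \<mu> \<noteq> 0 \<and> A *v R' \<mu> = \<mu> *\<^sub>R R' \<mu>"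
    by (rule real_eigenvalues_eigenvectors) blast
  \<comment> \<open>The given r0 itself is taken as the basis vector for l0.\<close>
  define R where "R = R'(l0 := r0)"
  have R: "\<And>\<mu>. \<mu> \<in> ?S \<Longrightarrow> R \<mu> \<noteq> 0 \<and> A *v R \<mu> = \<mu> *\<^sub>R R \<mu>"
    using \<open>\<And>\<mu>. \<mu> \<in> ?S \<Longrightarrow> _ \<mu>\<close> r0 by (auto simp: R_def right_eigenvector_def)
  have inj: "inj_on R ?S" and ind: "independent (R ` ?S)"
    using eigenvectors_independent_set[OF fin matrix_vector_mul_linear R] by blast+
  have "UNIV \<subseteq> span (R ` ?S)"
    by (rule card_ge_dim_independent) (use ind c in \<open>auto simp: card_image[OF inj] dim_UNIV\<close>)
  then obtain a where "x = (\<Sum>y\<in>R ` ?S. a y *\<^sub>R y)"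
    using span_finite[of "R ` ?S"] fin by auto
  then have xs: "x = (\<Sum>\<mu>\<in>?S. a (R \<mu>) *\<^sub>R R \<mu>)" by (simp add: sum.reindex[OF inj])
  have "A *v x = (\<Sum>\<mu>\<in>?S. (a (R \<mu>) * \<mu>) *\<^sub>R R \<mu>)"
    unfolding xs using R by (simp add: linear_sum[OF matrix_vector_mul_linear] linear_cmul[OF matrix_vector_mul_linear])
  moreover have "m *\<^sub>R r0 = (\<Sum>\<mu>\<in>?S. (if \<mu> = l0 then m else 0) *\<^sub>R R \<mu>)"
    using fin l0 by (simp add: if_distrib[of "\<lambda>t. t *\<^sub>R _"] R_def cong: if_cong)
  ultimately have "(\<Sum>\<mu>\<in>?S. (a (R \<mu>) * (\<mu> - l0) - (if \<mu> = l0 then m else 0)) *\<^sub>R R \<mu>) = 0"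
    using x by (subst (asm) (2) xs) (simp add: scaleR_sum_right algebra_simps sum_subtractf sum.distrib)
  then have z: "a (R \<mu>) * (\<mu> - l0) - (if \<mu> = l0 then m else 0) = 0" if "\<mu> \<in> ?S" for \<mu>
    using eigenvectors_independent[OF fin matrix_vector_mul_linear R _ that, of "\<lambda>\<mu>. a (R \<mu>) * (\<mu> - l0) - (if \<mu> = l0 then m else 0)"] by blast
  have "m = 0" using z[OF l0] by simp
  moreover have "x = a r0 *\<^sub>R r0"
  proof -
    have "x = (\<Sum>\<mu>\<in>?S. if \<mu> = l0 then a r0 *\<^sub>R r0 else 0)"
      unfolding xs
    proof (rule sum.cong[OF refl])
      fix \<mu> assume "\<mu> \<in> ?S"
      from z[OF this] show "a (R \<mu>) *\<^sub>R R \<mu> = (if \<mu> = l0 then a r0 *\<^sub>R r0 else 0)"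
        by (cases "\<mu> = l0") (auto simp: R_def)
    qed
    then show ?thesis using fin l0 by simp
  qed
  ultimately show ?thesis by blast
qed

lemma char_speed_eigenvalues:
  fixes f :: "real^'n \<Rightarrow> real^'n"
  assumes u: "u \<in> strictly_hyperbolic_set f \<U>"
  shows "real_eigenvalues (flux_matrix f u) = (\<lambda>i. char_speed f i u) ` {..<CARD('n)}"
    and "i < j \<Longrightarrow> j < CARD('n) \<Longrightarrow> char_speed f i u < char_speed f j u"
proof -
  let ?E = "real_eigenvalues (flux_matrix f u)"
  have fin: "finite ?E" by (rule finite_real_eigenvalues)
  have len: "length (sorted_list_of_set ?E) = CARD('n)" using u by (simp add: strictly_hyperbolic_set_def)
  have "?E = set (sorted_list_of_set ?E)" using fin by simp
  also have "\<dots> = (\<lambda>i. char_speed f i u) ` {..<CARD('n)}"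
    using len by (auto simp: set_conv_nth char_speed_def)
  finally show "?E = (\<lambda>i. char_speed f i u) ` {..<CARD('n)}" .
  show "char_speed f i u < char_speed f j u" if "i < j" "j < CARD('n)"
    using that len strict_sorted_list_of_set[of ?E] by (auto simp: char_speed_def sorted_wrt_nth_less)
qed

text \<open>Each eigenvalue at u0 continues as a C^1 function with a C^1 eigenvector. Near u0 the n
  continuations keep their order, so they are distinct, exhaust the spectrum by cardinality, and as
  an increasing list coincide with \<open>char_speed\<close>.\<close>

lemma strictly_hyperbolic_nhd:
  fixes f :: "real^'n \<Rightarrow> real^'n"
  assumes U: "open \<U>" and f: "C2_on \<U> f" and u0: "u0 \<in> strictly_hyperbolic_set f \<U>"
  obtains V where "open V" "u0 \<in> V" "V \<subseteq> strictly_hyperbolic_set f \<U>"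
    "\<forall>i<CARD('n). C1_on V (char_speed f i) \<and>
      (\<exists>r. C1_on V r \<and> (\<forall>u\<in>V. right_eigenvector (flux_matrix f u) (char_speed f i u) (r u)))"
proof -
  let ?n = "CARD('n)"
  obtain f' where f': "\<And>x. x \<in> \<U> \<Longrightarrow> (f has_derivative blinfun_apply (f' x)) (at x)" "C1_on \<U> f'"
    "\<And>u r. u \<in> \<U> \<Longrightarrow> flux_matrix f u *v r = blinfun_apply (f' u) r"
    using C2_on_flux[OF f] by blast
  have uU: "u0 \<in> \<U>" and card: "card (real_eigenvalues (flux_matrix f u0)) = ?n"
    using u0 by (auto simp: strictly_hyperbolic_set_def)
  have "\<exists>V r \<mu>. open V \<and> u0 \<in> V \<and> V \<subseteq> \<U> \<and> C1_on V r \<and> C1_on V \<mu> \<and> \<mu> u0 = char_speed f i u0 \<and>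
     (\<forall>u\<in>V. right_eigenvector (flux_matrix f u) (\<mu> u) (r u))" if i: "i < ?n" for i
  proof -
    have "char_speed f i u0 \<in> real_eigenvalues (flux_matrix f u0)"
      using char_speed_eigenvalues(1)[OF u0] i by blast
    then obtain r0 where r0: "right_eigenvector (flux_matrix f u0) (char_speed f i u0) r0"
      by (auto simp: real_eigenvalues_def)
    obtain V r \<mu> where "open V" "u0 \<in> V" "V \<subseteq> \<U>" "C1_on V r" "C1_on V \<mu>" "\<mu> u0 = char_speed f i u0"
      and e: "\<And>u. u \<in> V \<Longrightarrow> r u \<noteq> 0 \<and> f' u (r u) = \<mu> u *\<^sub>R r u"
    proof (rule eigenvector_implicit[OF U uU f'(2)])
      show "r0 \<noteq> 0" "f' u0 r0 = char_speed f i u0 *\<^sub>R r0"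
        using r0 f'(3)[OF uU] by (auto simp: right_eigenvector_def)
      show "m = 0 \<and> (\<exists>c. x = c *\<^sub>R r0)" if "f' u0 x - char_speed f i u0 *\<^sub>R x = m *\<^sub>R r0" for x m
        by (rule simple_eigenvalue[OF card r0]) (use that f'(3)[OF uU] in simp)
    qed blast
    then show ?thesis
      by (intro exI[of _ V] exI[of _ r] exI[of _ \<mu>]) (auto simp: right_eigenvector_def f'(3) subset_iff)
  qed
  then obtain V r \<mu> where V: "\<And>i. i < ?n \<Longrightarrow> open (V i) \<and> u0 \<in> V i \<and> V i \<subseteq> \<U> \<and> C1_on (V i) (r i) \<and> C1_on (V i) (\<mu> i)
     \<and> \<mu> i u0 = char_speed f i u0 \<and> (\<forall>u\<in>V i. right_eigenvector (flux_matrix f u) (\<mu> i u) (r i u))"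
    by metis
  have "eventually (\<lambda>u. \<forall>i\<in>{..<?n}. u \<in> V i) (nhds u0)"
    using V by (auto intro!: eventually_ball_finite eventually_nhds_in_open)
  moreover have "eventually (\<lambda>u. \<forall>j\<in>{..<?n}. \<forall>i\<in>{..<j}. \<mu> i u < \<mu> j u) (nhds u0)"
  proof (intro eventually_ball_finite ballI finite_lessThan)
    fix i j assume ij: "j \<in> {..<?n}" "i \<in> {..<j}"
    have c: "(\<mu> k \<longlongrightarrow> char_speed f k u0) (nhds u0)" if "k < ?n" for k
    proof -
      have "continuous_on (V k) (\<mu> k)" using V[OF that] C1_on_imp_continuous_on by blast
      then have "isCont (\<mu> k) u0" using V[OF that] continuous_on_eq_continuous_at by blast
      then have "(\<mu> k \<longlongrightarrow> \<mu> k u0) (nhds u0)"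
        by (simp add: isCont_def tendsto_at_iff_tendsto_nhds)
      then show ?thesis using V[OF that] by simp
    qed
    show "eventually (\<lambda>u. \<mu> i u < \<mu> j u) (nhds u0)"
    proof -
      have "((\<lambda>u. \<mu> j u - \<mu> i u) \<longlongrightarrow> char_speed f j u0 - char_speed f i u0) (nhds u0)"
        using ij by (intro tendsto_diff c) auto
      moreover have "0 < char_speed f j u0 - char_speed f i u0"
        using ij char_speed_eigenvalues(2)[OF u0] by auto
      ultimately have "eventually (\<lambda>u. 0 < \<mu> j u - \<mu> i u) (nhds u0)" by (rule order_tendstoD)
      then show ?thesis by simp
    qed
  qed
  ultimately have "eventually (\<lambda>u. (\<forall>i\<in>{..<?n}. u \<in> V i) \<and> (\<forall>j\<in>{..<?n}. \<forall>i\<in>{..<j}. \<mu> i u < \<mu> j u)) (nhds u0)"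
    by (rule eventually_conj)
  then obtain W where W12: "open W" "u0 \<in> W"
    and W': "\<forall>u\<in>W. (\<forall>i\<in>{..<?n}. u \<in> V i) \<and> (\<forall>j\<in>{..<?n}. \<forall>i\<in>{..<j}. \<mu> i u < \<mu> j u)"
    unfolding eventually_nhds by blast
  have W3: "u \<in> V i" if "u \<in> W" "i < ?n" for u i using W' that by simp
  have W4: "\<mu> i u < \<mu> j u" if "u \<in> W" "j < ?n" "i < j" for u i j using W' that by simp
  note W = W12 W3 W4
  have eig: "real_eigenvalues (flux_matrix f u) = set (map (\<lambda>i. \<mu> i u) [0..<?n])"
    and sorted: "sorted_wrt (<) (map (\<lambda>i. \<mu> i u) [0..<?n])" if u: "u \<in> W" for u
  proof -
    show s: "sorted_wrt (<) (map (\<lambda>i. \<mu> i u) [0..<?n])"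
      using W(4)[OF u] by (auto simp: sorted_wrt_iff_nth_less)
    have sub: "set (map (\<lambda>i. \<mu> i u) [0..<?n]) \<subseteq> real_eigenvalues (flux_matrix f u)"
    proof
      fix x assume "x \<in> set (map (\<lambda>i. \<mu> i u) [0..<?n])"
      then obtain i where i: "i < ?n" "x = \<mu> i u" by auto
      then have "right_eigenvector (flux_matrix f u) x (r i u)" using V[OF i(1)] W(3)[OF u i(1)] by blast
      then show "x \<in> real_eigenvalues (flux_matrix f u)" by (auto simp: real_eigenvalues_def)
    qed
    have "distinct (map (\<lambda>i. \<mu> i u) [0..<?n])" using s unfolding strict_sorted_iff by (rule conjunct2)
    from distinct_card[OF this] have "card (set (map (\<lambda>i. \<mu> i u) [0..<?n])) = ?n" by simp
    then show "real_eigenvalues (flux_matrix f u) = set (map (\<lambda>i. \<mu> i u) [0..<?n])"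
      using card_seteq[OF finite_real_eigenvalues(1) sub] finite_real_eigenvalues(2)[of "flux_matrix f u"] by simp
  qed
  have sh: "W \<subseteq> strictly_hyperbolic_set f \<U>"
  proof
    fix u assume u: "u \<in> W"
    have "0 < ?n" by simp
    then have "u \<in> \<U>" using V W(3)[OF u] by blast
    moreover have "card (real_eigenvalues (flux_matrix f u)) = ?n"
    proof -
      have "distinct (map (\<lambda>i. \<mu> i u) [0..<?n])" using sorted[OF u] unfolding strict_sorted_iff by (rule conjunct2)
      from distinct_card[OF this] show ?thesis unfolding eig[OF u] by simp
    qed
    ultimately show "u \<in> strictly_hyperbolic_set f \<U>" by (simp add: strictly_hyperbolic_set_def)
  qed
  have cs: "\<mu> i u = char_speed f i u" if "u \<in> W" "i < ?n" for u i
  proof -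
    have "sorted_list_of_set (real_eigenvalues (flux_matrix f u)) = map (\<lambda>i. \<mu> i u) [0..<?n]"
      unfolding eig[OF that(1)] using sorted[OF that(1)]
      by (metis sorted_list_of_set.idem_if_sorted_distinct strict_sorted_iff)
    then show ?thesis using that(2) by (simp add: char_speed_def)
  qed
  show ?thesis
  proof (rule that[OF W(1,2) sh], intro allI impI conjI)
    fix i assume i: "i < ?n"
    have WV: "W \<subseteq> V i" using W(3) i by blast
    have "C1_on W (\<mu> i)" using V[OF i] WV C1_on_subset by blast
    then show "C1_on W (char_speed f i)" by (rule C1_on_cong_open[OF _ W(1)]) (use cs i in auto)
    show "\<exists>r. C1_on W r \<and> (\<forall>u\<in>W. right_eigenvector (flux_matrix f u) (char_speed f i u) (r u))"
    proof (intro exI[of _ "r i"] conjI ballI)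
      show "C1_on W (r i)" using V[OF i] WV C1_on_subset by blast
      fix u assume u: "u \<in> W"
      then have "right_eigenvector (flux_matrix f u) (\<mu> i u) (r i u)" using V[OF i] WV by blast
      then show "right_eigenvector (flux_matrix f u) (char_speed f i u) (r i u)" using cs[OF u i] by simp
    qed
  qed
qed

lemma open_strictly_hyperbolic:
  fixes f :: "real^'n \<Rightarrow> real^'n"
  assumes "open \<U>" "C2_on \<U> f"
  shows "open (strictly_hyperbolic_set f \<U>)"
  by (subst open_subopen) (metis strictly_hyperbolic_nhd[OF assms])

lemma continuous_on_char_speed:
  fixes f :: "real^'n \<Rightarrow> real^'n"
  assumes "open \<U>" "C2_on \<U> f" "i < CARD('n)"
  shows "continuous_on (strictly_hyperbolic_set f \<U>) (char_speed f i)"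
proof (rule continuous_at_imp_continuous_on, rule ballI)
  fix u assume "u \<in> strictly_hyperbolic_set f \<U>"
  then obtain V where "open V" "u \<in> V" "C1_on V (char_speed f i)"
    using strictly_hyperbolic_nhd[OF assms(1,2)] assms(3) by metis
  then show "isCont (char_speed f i) u"
    using C1_on_imp_continuous_on continuous_on_eq_continuous_at by blast
qed

subsection \<open>Constant states and isolated points\<close>

lemma weak_solution_constant_near:
  fixes f :: "real^'n \<Rightarrow> real^'n"
  assumes U: "open \<U>" and f: "C2_on \<U> f" and sol: "self_similar_weak_solution f \<U> v"
    and \<xi>: "\<xi> \<in> set_C f v"
  obtains r where "r > 0" "AE \<eta> in lebesgue. \<eta> \<in> ball \<xi> r \<longrightarrow> v \<eta> = ess_im_value v \<xi>"
proof -
  have v: "Linf v" and K: "ess_im v \<subseteq> \<U>"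
    using sol by (auto simp: self_similar_weak_solution_def strictly_hyperbolic_set_def)
  have vm: "v \<in> borel_measurable lebesgue" using v by (auto simp: Linf_def)
  obtain f' where f': "\<And>x. x \<in> \<U> \<Longrightarrow> (f has_derivative blinfun_apply (f' x)) (at x)" "C1_on \<U> f'"
    "\<And>u r. u \<in> \<U> \<Longrightarrow> flux_matrix f u *v r = blinfun_apply (f' u) r"
    using C2_on_flux[OF f] by blast
  have cf: "continuous_on \<U> f"
    using f'(1) by (auto intro!: continuous_at_imp_continuous_on has_derivative_continuous)
  define u where "u = ess_im_value v \<xi>"
  have cp: "ess_im_continuity_point v \<xi>" and ev: "\<xi> \<notin> real_eigenvalues (flux_matrix f u)"
    using \<xi> by (auto simp: set_C_def u_def det_shift_eq_0_iff)
  have uU: "u \<in> \<U>"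
    using ess_im_at_subset_ess_im[OF vm, of \<xi>] ess_im_at_eq_value[OF cp] K by (auto simp: u_def)
  define M where "M x = f' u x - \<xi> *\<^sub>R x" for x
  have "linear M" unfolding M_def
    by (intro linear_compose_sub bounded_linear.linear[OF blinfun.bounded_linear_right] linear_scale_self)
  moreover have "inj M"
  proof (subst linear_injective_0[OF \<open>linear M\<close>], safe)
    fix r assume "M r = 0"
    then show "r = 0"
      using ev f'(3)[OF uU] by (auto simp: M_def real_eigenvalues_def right_eigenvector_def)
  qed
  ultimately obtain \<kappa> where \<kappa>: "\<kappa> > 0" "\<And>x. \<kappa> * norm x \<le> norm (M x)"
    using linear_inj_bounded_below_pos by blast
  have e: "\<kappa> / 4 > 0" using \<kappa> by simp
  obtain d where d: "d > 0" "ball u d \<subseteq> \<U>"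
    "\<forall>x\<in>ball u d. \<forall>y\<in>ball u d. norm (f y - f x - f' u (y - x)) \<le> \<kappa> / 4 * norm (y - x)"
    by (rule strongly_differentiable[OF U uU f'(1) C1_on_imp_continuous_on[OF f'(2)] e]) blast
  obtain r1 where r1: "r1 > 0" "AE \<eta> in lebesgue. \<eta> \<in> ball \<xi> r1 \<longrightarrow> dist u (v \<eta>) < d"
    by (rule AE_near_ess_im_value[OF v cp d(1)]) (simp add: u_def)
  obtain Z where Z: "AE \<eta> in lebesgue. \<eta> \<in> Z"
    "\<And>x y. x \<in> Z \<Longrightarrow> y \<in> Z \<Longrightarrow> x \<le> y \<Longrightarrow>
       f (v y) - f (v x) - x *\<^sub>R (v y - v x) = integral {x..y} (\<lambda>t. v y - v t)"
    using weak_solution_increment[OF cf sol] by blast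
  \<comment> \<open>Error budget, with M bounded below by \<kappa>: the nonlinearity of f costs
    \<kappa>/4 and the shift from \<xi> to x costs \<kappa>/8, each times the increment, and the
    integral costs D (y - x) \<le> D \<kappa>/4. So 5/8 of the increment is at most D/4.\<close>
  define r where "r = min r1 (\<kappa> / 8)"
  have r: "r > 0" using r1 \<kappa> by (simp add: r_def)
  define Z' where "Z' = {\<eta> \<in> Z. \<eta> \<in> ball \<xi> r \<and> v \<eta> \<in> ball u d}"
  have Z'AE: "AE \<eta> in lebesgue. \<eta> \<in> ball \<xi> r \<longrightarrow> \<eta> \<in> Z'"
    using Z(1) r1(2) by eventually_elim (auto simp: Z'_def r_def)
  obtain \<eta>0 where \<eta>0: "\<eta>0 \<in> Z'" using ball_AE_nonempty[OF Z'AE r] by blast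
  \<comment> \<open>The increment identity bounds the oscillation \<open>D\<close> of \<open>v\<close> on \<open>Z'\<close> by \<open>D / 2\<close>.\<close>
  define X where "X = (\<lambda>(x, y). norm (v y - v x)) ` (Z' \<times> Z')"
  define D where "D = Sup X"
  have Xbdd: "bdd_above X"
  proof (rule bdd_aboveI)
    fix s assume "s \<in> X"
    then obtain x y where "s = norm (v y - v x)" "v x \<in> ball u d" "v y \<in> ball u d"
      by (auto simp: X_def Z'_def)
    then show "s \<le> d + d" using norm_triangle_ineq4[of "v y - u" "v x - u"]
      by (simp add: dist_norm norm_minus_commute)
  qed
  have XD: "norm (v y - v x) \<le> D" if "x \<in> Z'" "y \<in> Z'" for x y
    unfolding D_def by (rule cSup_upper[OF _ Xbdd]) (use that in \<open>force simp: X_def\<close>)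
  have D0: "D \<ge> 0" using XD[OF \<eta>0 \<eta>0] by simp
  have half: "norm (v y - v x) \<le> D / 2" if xy: "x \<in> Z'" "y \<in> Z'" "x \<le> y" for x y
  proof -
    let ?\<Delta> = "v y - v x" and ?L = "f (v y) - f (v x) - x *\<^sub>R (v y - v x)"
    have xr: "\<bar>x - \<xi>\<bar> < r" "\<bar>y - \<xi>\<bar> < r" using xy by (auto simp: Z'_def dist_real_def)
    have "norm ?L \<le> D * (y - x)"
    proof -
      have "?L = integral {x..y} (\<lambda>t. v y - v t)" using Z(2) xy by (auto simp: Z'_def)
      also have "norm \<dots> \<le> D * (y - x)"
      proof (rule norm_integral_le_AE[OF _ xy(3) D0])
        show "(\<lambda>t. v y - v t) integrable_on {x..y}"
          by (intro integrable_diff Linf_integrable_on[OF v] integrable_const_ivl)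
        show "AE t in lebesgue. t \<in> {x..y} \<longrightarrow> norm (v y - v t) \<le> D"
          using Z'AE
        proof eventually_elim
          case (elim t)
          then show ?case using xr XD[of t y] xy by (auto simp: dist_real_def)
        qed
      qed
      finally show ?thesis .
    qed
    moreover have "D * (y - x) \<le> D * (\<kappa> / 4)"
    proof (intro mult_left_mono D0)
      have "r \<le> \<kappa> / 8" by (simp add: r_def)
      then show "y - x \<le> \<kappa> / 4" using xr by linarith
    qed
    moreover have "norm (M ?\<Delta>) \<le> norm ?L + \<kappa> / 4 * norm ?\<Delta> + \<kappa> / 8 * norm ?\<Delta>"
    proof -
      have "M ?\<Delta> = ?L - (f (v y) - f (v x) - f' u ?\<Delta>) + (x - \<xi>) *\<^sub>R ?\<Delta>"
        by (simp add: M_def algebra_simps)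
      also have "norm \<dots> \<le> norm ?L + norm (f (v y) - f (v x) - f' u ?\<Delta>) + norm ((x - \<xi>) *\<^sub>R ?\<Delta>)"
        by (meson add_right_mono norm_triangle_ineq norm_triangle_ineq4 order_trans)
      also have "\<dots> \<le> norm ?L + \<kappa> / 4 * norm ?\<Delta> + \<kappa> / 8 * norm ?\<Delta>"
      proof (intro add_mono order_refl)
        show "norm (f (v y) - f (v x) - f' u ?\<Delta>) \<le> \<kappa> / 4 * norm ?\<Delta>"
          by (rule d(3)[rule_format]) (use xy in \<open>auto simp: Z'_def\<close>)
        show "norm ((x - \<xi>) *\<^sub>R ?\<Delta>) \<le> \<kappa> / 8 * norm ?\<Delta>"
        proof -
          have "\<bar>x - \<xi>\<bar> \<le> \<kappa> / 8" using xr by (simp add: r_def)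
          from mult_right_mono[OF this norm_ge_zero[of ?\<Delta>]] show ?thesis by simp
        qed
      qed
      finally show ?thesis .
    qed
    moreover have "\<kappa> * norm ?\<Delta> \<le> norm (M ?\<Delta>)" by (rule \<kappa>)
    ultimately have "\<kappa> * norm ?\<Delta> \<le> D * (\<kappa> / 4) + \<kappa> / 4 * norm ?\<Delta> + \<kappa> / 8 * norm ?\<Delta>" by linarith
    then have "\<kappa> * (5 / 8 * norm ?\<Delta>) \<le> \<kappa> * (D / 4)" by (simp add: algebra_simps)
    then have "5 / 8 * norm ?\<Delta> \<le> D / 4" using \<kappa>(1) by (simp only: mult_le_cancel_left_pos)
    then show ?thesis using norm_ge_zero[of ?\<Delta>] by linarith
  qed
  have "D \<le> D / 2"
    unfolding D_def X_def
  proof (rule cSup_least)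
    show "(\<lambda>(x, y). norm (v y - v x)) ` (Z' \<times> Z') \<noteq> {}" using \<eta>0 by auto
    fix s assume "s \<in> (\<lambda>(x, y). norm (v y - v x)) ` (Z' \<times> Z')"
    then obtain x y where "x \<in> Z'" "y \<in> Z'" "s = norm (v y - v x)" by auto
    then have "s \<le> D / 2" using half[of x y] half[of y x] by (cases "x \<le> y") (auto simp: norm_minus_commute)
    then show "s \<le> Sup ((\<lambda>(x, y). norm (v y - v x)) ` (Z' \<times> Z')) / 2" by (simp add: D_def X_def)
  qed
  then have "D = 0" using D0 by linarith
  then have eq: "v \<eta> = v \<eta>0" if "\<eta> \<in> Z'" for \<eta> using XD[OF \<eta>0 that] by simp
  have AE: "AE \<eta> in lebesgue. \<eta> \<in> ball \<xi> r \<longrightarrow> v \<eta> = v \<eta>0"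
    using Z'AE by eventually_elim (use eq in blast)
  have "ess_im_at v \<xi> = {v \<eta>0}"
    by (rule AE_const_ess_im[OF v AE]) (use r in auto)
  then have "u = v \<eta>0" by (simp add: u_def ess_im_value_def)
  then show ?thesis using that[OF r] AE by (simp add: u_def)
qed

text \<open>The state is locally constant, hence so is its finite spectrum, and \<xi> stays off a
  finite set when it is moved a little.\<close>

lemma set_C_nbhd:
  fixes f :: "real^'n \<Rightarrow> real^'n"
  assumes U: "open \<U>" and f: "C2_on \<U> f" and sol: "self_similar_weak_solution f \<U> v"
    and \<xi>: "\<xi> \<in> set_C f v"
  shows "\<exists>r>0. ball \<xi> r \<subseteq> set_C f v \<and> (\<forall>\<eta>\<in>ball \<xi> r. ess_im_value v \<eta> = ess_im_value v \<xi>)"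
proof -
  have v: "Linf v" using sol by (auto simp: self_similar_weak_solution_def)
  define u where "u = ess_im_value v \<xi>"
  obtain r where r: "r > 0" "AE \<eta> in lebesgue. \<eta> \<in> ball \<xi> r \<longrightarrow> v \<eta> = u"
    using weak_solution_constant_near[OF assms] by (auto simp: u_def)
  have "finite (real_eigenvalues (flux_matrix f u))" by (rule finite_real_eigenvalues)
  then have "open (- real_eigenvalues (flux_matrix f u))" by (simp add: finite_imp_closed open_Compl)
  moreover have "\<xi> \<in> - real_eigenvalues (flux_matrix f u)"
    using \<xi> by (auto simp: set_C_def u_def det_shift_eq_0_iff)
  ultimately obtain s where s: "s > 0" "ball \<xi> s \<subseteq> - real_eigenvalues (flux_matrix f u)"
    using openE by blast
  have e: "ess_im_at v \<eta> = {u}" if "\<eta> \<in> ball \<xi> r" for \<eta>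
    by (rule AE_const_ess_im[OF v r(2) that])
  show ?thesis
  proof (intro exI[of _ "min r s"] conjI)
    show "ball \<xi> (min r s) \<subseteq> set_C f v"
      using s ess_im_continuity_pointI[OF e] by (auto simp: set_C_def det_shift_eq_0_iff)
    show "\<forall>\<eta>\<in>ball \<xi> (min r s). ess_im_value v \<eta> = ess_im_value v \<xi>"
      using ess_im_continuity_pointI[OF e] by (simp add: u_def)
  qed (use r s in auto)
qed

text \<open>Open sets meeting S in a single point cover S; a countable subfamily still covers, and
  each of its members accounts for one point.\<close>

lemma countable_isolated:
  fixes S :: "'a::second_countable_topology set"
  assumes "\<And>x. x \<in> S \<Longrightarrow> x isolated_in S"
  shows "countable S"
proof -
  define \<F> where "\<F> = {T. open T \<and> (\<exists>x. T \<inter> S = {x})}"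
  obtain \<F>' where \<F>': "\<F>' \<subseteq> \<F>" "countable \<F>'" "\<Union>\<F>' = \<Union>\<F>"
    by (rule Lindelof[of \<F>]) (auto simp: \<F>_def)
  have "S \<subseteq> (\<lambda>T. the_elem (T \<inter> S)) ` \<F>'"
  proof
    fix x assume x: "x \<in> S"
    then obtain T where "open T" "T \<inter> S = {x}" using assms by (auto simp: isolated_in_def)
    then have "T \<in> \<F>" "x \<in> T" by (auto simp: \<F>_def)
    then obtain T' where T': "T' \<in> \<F>'" "x \<in> T'" using \<F>'(3) by blast
    then obtain y where "T' \<inter> S = {y}" using \<F>'(1) by (auto simp: \<F>_def)
    moreover from this have "x = y" using T' x by (metis IntI singletonD)
    ultimately have "T' \<inter> S = {x}" by simp
    then show "x \<in> (\<lambda>T. the_elem (T \<inter> S)) ` \<F>'" using T' by (intro image_eqI[of _ _ T']) auto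
  qed
  then show ?thesis using \<F>'(2) by (meson countable_image countable_subset)
qed

lemma open_real_components:
  fixes S :: "real set"
  assumes "open S"
  shows "countable (components S)" "J \<in> components S \<Longrightarrow> open_interval J"
proof -
  show "countable (components S)"
  proof (rule countable_disjoint_open_subsets)
    show "pairwise disjnt (components S)"
      unfolding pairwise_def disjnt_def using components_nonoverlap by blast
  qed (rule open_components[OF assms])
  show "open_interval J" if "J \<in> components S"
    using that assms in_components_connected in_components_nonempty open_components
    by (auto simp: open_interval_def is_interval_connected_1)
qed

text \<open>By continuity all gaps between eigenvalues near u0 exceed half of the corresponding gaps
  at u0, and \<delta> is at most half of the smallest of those.\<close>

lemma eigenvalue_gap:
  fixes f :: "real^'n \<Rightarrow> real^'n"
  assumes U: "open \<U>" and f: "C2_on \<U> f" and u0: "u0 \<in> strictly_hyperbolic_set f \<U>"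
  obtains \<delta> d where "\<delta> > 0" "d > 0"
    "\<And>u a b. dist u0 u < d \<Longrightarrow> a \<in> real_eigenvalues (flux_matrix f u) \<Longrightarrow> b \<in> real_eigenvalues (flux_matrix f u)
       \<Longrightarrow> \<bar>a - b\<bar> < \<delta> \<Longrightarrow> a = b"
proof -
  let ?n = "CARD('n)" and ?c = "char_speed f"
  define P where "P = {(i, j). i < j \<and> j < ?n}"
  have "finite P" by (rule finite_subset[of _ "{..<?n} \<times> {..<?n}"]) (auto simp: P_def)
  \<comment> \<open>The 1 covers the case n = 1, where there are no pairs.\<close>
  define \<delta> where "\<delta> = Min (insert 1 ((\<lambda>(i, j). (?c j u0 - ?c i u0) / 2) ` P))"
  have pos: "?c i u0 < ?c j u0" if "(i, j) \<in> P" for i j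
    using char_speed_eigenvalues(2)[OF u0] that by (auto simp: P_def)
  have "\<delta> > 0" using \<open>finite P\<close> pos by (force simp: \<delta>_def)
  moreover have "\<delta> \<le> (?c j u0 - ?c i u0) / 2" if "(i, j) \<in> P" for i j
    unfolding \<delta>_def
  proof (rule Min_le)
    show "(?c j u0 - ?c i u0) / 2 \<in> insert 1 ((\<lambda>(i, j). (?c j u0 - ?c i u0) / 2) ` P)"
      using that by (intro insertI2 image_eqI[of _ _ "(i, j)"]) auto
  qed (use \<open>finite P\<close> in simp)
  ultimately have \<delta>: "\<delta> > 0" "\<And>i j. (i, j) \<in> P \<Longrightarrow> \<delta> \<le> (?c j u0 - ?c i u0) / 2" by blast+
  have SH: "open (strictly_hyperbolic_set f \<U>)" by (rule open_strictly_hyperbolic[OF U f])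
  have t: "(?c i \<longlongrightarrow> ?c i u0) (nhds u0)" if "i < ?n" for i
    using continuous_on_char_speed[OF U f that] SH u0
    by (auto simp: continuous_on_eq_continuous_at isCont_def tendsto_at_iff_tendsto_nhds)
  have "eventually (\<lambda>u. \<forall>p\<in>P. (case p of (i, j) \<Rightarrow> (?c j u0 - ?c i u0) / 2 < ?c j u - ?c i u)) (nhds u0)"
  proof (intro eventually_ball_finite ballI \<open>finite P\<close>)
    fix p assume p: "p \<in> P"
    obtain i j where ij: "p = (i, j)" by fastforce
    have "((\<lambda>u. ?c j u - ?c i u) \<longlongrightarrow> ?c j u0 - ?c i u0) (nhds u0)"
      using p ij by (intro tendsto_diff t) (auto simp: P_def)
    then have "eventually (\<lambda>u. (?c j u0 - ?c i u0) / 2 < ?c j u - ?c i u) (nhds u0)"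
      using pos p ij by (intro order_tendstoD) auto
    then show "eventually (\<lambda>u. case p of (i, j) \<Rightarrow> (?c j u0 - ?c i u0) / 2 < ?c j u - ?c i u) (nhds u0)"
      by (simp add: ij)
  qed
  moreover have "eventually (\<lambda>u. u \<in> strictly_hyperbolic_set f \<U>) (nhds u0)"
    using SH u0 by (rule eventually_nhds_in_open)
  ultimately have "eventually (\<lambda>u. u \<in> strictly_hyperbolic_set f \<U> \<and> (\<forall>(i, j)\<in>P. \<delta> < ?c j u - ?c i u)) (nhds u0)"
    by eventually_elim (use \<delta>(2) in \<open>fastforce\<close>)
  then obtain d where d: "d > 0" "\<And>u. dist u u0 < d \<Longrightarrow> u \<in> strictly_hyperbolic_set f \<U> \<and> (\<forall>(i, j)\<in>P. \<delta> < ?c j u - ?c i u)"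
    unfolding eventually_nhds_metric by blast
  show ?thesis
  proof (rule that[OF \<delta>(1) d(1)])
    fix u a b assume u: "dist u0 u < d" and ab: "a \<in> real_eigenvalues (flux_matrix f u)" "b \<in> real_eigenvalues (flux_matrix f u)"
      and lt: "\<bar>a - b\<bar> < \<delta>"
    have SHu: "u \<in> strictly_hyperbolic_set f \<U>" and gap: "\<And>i j. i < j \<Longrightarrow> j < ?n \<Longrightarrow> \<delta> < ?c j u - ?c i u"
      using d(2)[of u] u by (auto simp: dist_commute P_def)
    obtain i j where "i < ?n" "j < ?n" "a = ?c i u" "b = ?c j u"
      using ab unfolding char_speed_eigenvalues(1)[OF SHu] by auto
    then show "a = b" using gap[of i j] gap[of j i] lt by (cases i j rule: linorder_cases) auto
  qed
qed

section \<open>Topology of the sets C, W and E of a fixed solution\<close>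

locale weak_solution =
  fixes f :: "real^'n \<Rightarrow> real^'n" and \<U> :: "(real^'n) set" and v :: "real \<Rightarrow> real^'n"
  assumes open_U: "open \<U>" and C2: "C2_on \<U> f" and sol: "self_similar_weak_solution f \<U> v"
begin

abbreviation "SH \<equiv> strictly_hyperbolic_set f \<U>"

lemma Linf: "Linf v" and measurable: "v \<in> borel_measurable lebesgue"
  using sol by (auto simp: self_similar_weak_solution_def Linf_def)

lemma ess_im_value_SH: "ess_im_continuity_point v \<xi> \<Longrightarrow> ess_im_value v \<xi> \<in> SH"
  using ess_im_at_subset_ess_im[OF measurable, of \<xi>] ess_im_at_eq_value[of v \<xi>] sol
  by (auto simp: self_similar_weak_solution_def)

lemma set_W_iff: "\<xi> \<in> set_W f v \<longleftrightarrow> ess_im_continuity_point v \<xi> \<and> \<xi> \<in> real_eigenvalues (flux_matrix f (ess_im_value v \<xi>))"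
  and set_C_iff: "\<xi> \<in> set_C f v \<longleftrightarrow> ess_im_continuity_point v \<xi> \<and> \<xi> \<notin> real_eigenvalues (flux_matrix f (ess_im_value v \<xi>))"
  by (auto simp: set_W_def set_C_def det_shift_eq_0_iff)

lemma open_set_C: "open (set_C f v)"
proof (subst open_subopen, rule ballI)
  fix \<xi> assume "\<xi> \<in> set_C f v"
  then obtain r where "r > 0" "ball \<xi> r \<subseteq> set_C f v"
    using set_C_nbhd[OF open_U C2 sol] by blast
  then show "\<exists>T. open T \<and> \<xi> \<in> T \<and> T \<subseteq> set_C f v" by (intro exI[of _ "ball \<xi> r"]) auto
qed

lemma set_C_constant:
  assumes J: "connected J" "J \<subseteq> set_C f v" and "a \<in> J" "b \<in> J"
  shows "ess_im_value v a = ess_im_value v b"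
proof (rule connected_local_const[OF J(1) assms(3,4)], rule ballI)
  fix \<xi> assume "\<xi> \<in> J"
  then have "\<xi> \<in> set_C f v" using J by blast
  then obtain r where r: "r > 0" "\<forall>\<eta>\<in>ball \<xi> r. ess_im_value v \<eta> = ess_im_value v \<xi>"
    using set_C_nbhd[OF open_U C2 sol] by blast
  show "\<forall>\<^sub>F \<eta> in at \<xi> within J. ess_im_value v \<xi> = ess_im_value v \<eta>"
    unfolding eventually_at
  proof (intro exI[of _ r] conjI r(1) ballI impI)
    fix \<eta> assume "\<eta> \<noteq> \<xi> \<and> dist \<eta> \<xi> < r"
    then have "\<eta> \<in> ball \<xi> r" by (simp add: dist_commute)
    then show "ess_im_value v \<xi> = ess_im_value v \<eta>" using r(2) by metis
  qed
qed

text \<open>On a component \<open>(a', b')\<close> of \<open>\<C>\<close> between two points of \<open>\<W>\<close>, \<open>v\<close> is a constant whose flux matrix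
  would have both \<open>a'\<close> and \<open>b'\<close> as eigenvalues.\<close>

lemma set_W_convex_near:
  assumes N: "\<And>\<eta>. \<eta> \<in> {a..b} \<Longrightarrow> ess_im_continuity_point v \<eta>"
    and gap: "\<And>\<eta> x y. \<eta> \<in> {a..b} \<Longrightarrow> x \<in> {a..b} \<Longrightarrow> y \<in> {a..b} \<Longrightarrow> x \<in> real_eigenvalues (flux_matrix f (ess_im_value v \<eta>)) \<Longrightarrow>
       y \<in> real_eigenvalues (flux_matrix f (ess_im_value v \<eta>)) \<Longrightarrow> x = y"
    and ab: "a \<in> set_W f v" "b \<in> set_W f v" and c: "c \<in> {a..b}"
  shows "c \<in> set_W f v"
proof (rule ccontr)
  assume nW: "c \<notin> set_W f v"
  then have cC: "c \<in> set_C f v" using N[OF c] by (auto simp: set_W_iff set_C_iff)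
  have part: "\<eta> \<in> set_W f v \<longleftrightarrow> \<eta> \<notin> set_C f v" if "\<eta> \<in> {a..b}" for \<eta>
    using N[OF that] by (auto simp: set_W_iff set_C_iff)
  \<comment> \<open>Since C is open these sets are compact; the largest point a' of the first and
    the smallest point b' of the second are the ends of the component of C around c.\<close>
  let ?A = "{a..c} - set_C f v" and ?B = "{c..b} - set_C f v"
  have cA: "compact ?A" "compact ?B" using open_set_C by (auto intro: compact_diff)
  have ne: "?A \<noteq> {}" "?B \<noteq> {}" using ab c part[of a] part[of b] by auto
  obtain a' where a': "a' \<in> ?A" "\<And>x. x \<in> ?A \<Longrightarrow> x \<le> a'" using compact_attains_sup[OF cA(1) ne(1)] by blast
  obtain b' where b': "b' \<in> ?B" "\<And>x. x \<in> ?B \<Longrightarrow> b' \<le> x" using compact_attains_inf[OF cA(2) ne(2)] by blast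
  have lt: "a' < c" "c < b'" using a' b' cC by (auto simp: less_le)
  have sub: "{a'<..<b'} \<subseteq> set_C f v"
  proof
    fix x assume x: "x \<in> {a'<..<b'}"
    show "x \<in> set_C f v"
      using a'(2)[of x] b'(2)[of x] a'(1) b'(1) x by (cases "x \<le> c") force+
  qed
  have cont: "continuous_on {a'..b'} (ess_im_value v)"
    by (rule continuous_on_ess_im_value[OF Linf N]) (use a' b' c in auto)
  \<comment> \<open>Continuity carries the constant value from the open interval to its
    endpoints.\<close>
  have const: "ess_im_value v x = ess_im_value v c" if "x \<in> {a'..b'}" for x
  proof -
    have cl: "closure {a'<..<b'} = {a'..b'}" using lt by simp
    show ?thesis
    proof (rule continuous_constant_on_closure[of "{a'<..<b'}"])
      show "ess_im_value v y = ess_im_value v c" if "y \<in> {a'<..<b'}" for y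
        by (rule set_C_constant[OF _ sub that]) (use lt in auto)
    qed (use cont that cl in auto)
  qed
  have "a' \<in> set_W f v" "b' \<in> set_W f v" using a' b' c part[of a'] part[of b'] by auto
  then have "a' \<in> real_eigenvalues (flux_matrix f (ess_im_value v c))" "b' \<in> real_eigenvalues (flux_matrix f (ess_im_value v c))"
    using const[of a'] const[of b'] lt by (auto simp: set_W_iff)
  then have "a' = b'" using gap[OF c, of a' b'] a' b' c by auto
  then show False using lt by simp
qed

text \<open>A point of E is a continuity point and no limit point of S, so a whole ball around it
  consists of continuity points. Shrinking the ball brings \<open>eigenvalue_gap\<close> into force,
  and \<open>set_W_convex_near\<close> applies to any two points of W in it.\<close>

lemma set_E_nbhd:
  assumes \<xi>: "\<xi> \<in> set_E f v"
  obtains r where "r > 0" "\<And>\<eta>. \<eta> \<in> ball \<xi> r \<Longrightarrow> ess_im_continuity_point v \<eta>"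
    "\<And>a b c. a \<in> ball \<xi> r \<Longrightarrow> b \<in> ball \<xi> r \<Longrightarrow> a \<in> set_W f v \<Longrightarrow> b \<in> set_W f v \<Longrightarrow> c \<in> {a..b} \<Longrightarrow> c \<in> set_W f v"
proof -
  have W: "\<xi> \<in> set_W f v" and "\<not> \<xi> islimpt set_S v" using \<xi> by (auto simp: set_E_def set_S'_def)
  then obtain T where T: "open T" "\<xi> \<in> T" "\<And>\<eta>. \<eta> \<in> T \<Longrightarrow> \<eta> \<noteq> \<xi> \<Longrightarrow> \<eta> \<notin> set_S v"
    unfolding islimpt_def by blast
  obtain r1 where r1: "r1 > 0" "ball \<xi> r1 \<subseteq> T" using T(1,2) openE by blast
  have cp: "ess_im_continuity_point v \<eta>" if "\<eta> \<in> ball \<xi> r1" for \<eta>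
    using that r1 T(3)[of \<eta>] W by (cases "\<eta> = \<xi>") (auto simp: set_S_def set_W_iff)
  have cp\<xi>: "ess_im_continuity_point v \<xi>" using cp r1 by simp
  obtain \<delta> d where gap: "\<delta> > 0" "d > 0"
    "\<And>u a b. dist (ess_im_value v \<xi>) u < d \<Longrightarrow> a \<in> real_eigenvalues (flux_matrix f u) \<Longrightarrow> b \<in> real_eigenvalues (flux_matrix f u)
       \<Longrightarrow> \<bar>a - b\<bar> < \<delta> \<Longrightarrow> a = b"
    using eigenvalue_gap[OF open_U C2 ess_im_value_SH[OF cp\<xi>]] by blast
  obtain r2 where r2: "r2 > 0" "\<And>\<eta>. \<eta> \<in> ball \<xi> r2 \<Longrightarrow> ess_im_continuity_point v \<eta> \<Longrightarrow> dist (ess_im_value v \<xi>) (ess_im_value v \<eta>) < d"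
    by (rule AE_near_ess_im_value[OF Linf cp\<xi> gap(2)]) blast
  \<comment> \<open>The radius r2 keeps the states within d of the state at \<xi>, and \<delta>/2
    makes any two speeds in the ball differ by less than \<delta>.\<close>
  define r where "r = min (min r1 r2) (\<delta> / 2)"
  show ?thesis
  proof (rule that[of r])
    show "r > 0" using r1 r2 gap by (simp add: r_def)
    show cp': "ess_im_continuity_point v \<eta>" if "\<eta> \<in> ball \<xi> r" for \<eta> using cp[of \<eta>] that by (simp add: r_def)
    fix a b c assume ab: "a \<in> ball \<xi> r" "b \<in> ball \<xi> r" and W: "a \<in> set_W f v" "b \<in> set_W f v" "c \<in> {a..b}"
    have sub: "\<eta> \<in> ball \<xi> r" if "\<eta> \<in> {a..b}" for \<eta> using that ab by (auto simp: dist_real_def)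
    show "c \<in> set_W f v"
    proof (rule set_W_convex_near[OF cp'[OF sub] _ W])
      fix \<eta> x y
      assume \<eta>: "\<eta> \<in> {a..b}" "x \<in> {a..b}" "y \<in> {a..b}" "x \<in> real_eigenvalues (flux_matrix f (ess_im_value v \<eta>))"
       "y \<in> real_eigenvalues (flux_matrix f (ess_im_value v \<eta>))"
      have r: "r \<le> r2" "r \<le> \<delta> / 2" by (auto simp: r_def)
      show "x = y"
      proof (rule gap(3)[OF _ \<eta>(4,5)])
        show "dist (ess_im_value v \<xi>) (ess_im_value v \<eta>) < d"
          by (rule r2(2)[OF _ cp'[OF sub[OF \<eta>(1)]]]) (use sub[OF \<eta>(1)] r in auto)
        show "\<bar>x - y\<bar> < \<delta>" using sub[OF \<eta>(2)] sub[OF \<eta>(3)] r by (auto simp: dist_real_def)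
      qed
    qed
  qed
qed

text \<open>Near \<xi> the set W is an interval that contains \<xi> but not in its interior, so
  \<xi> is an end of it and one side belongs to C. The other side is either free of W or begins with
  interior points of W; in both cases E has no further point nearby.\<close>

lemma set_E_one_sided:
  assumes \<xi>: "\<xi> \<in> set_E f v"
  obtains r where "r > 0" "{\<xi><..<\<xi> + r} \<subseteq> set_C f v \<or> {\<xi> - r<..<\<xi>} \<subseteq> set_C f v" "ball \<xi> r \<inter> set_E f v = {\<xi>}"
proof -
  obtain r where r: "r > 0" and cp: "\<And>\<eta>. \<eta> \<in> ball \<xi> r \<Longrightarrow> ess_im_continuity_point v \<eta>"
    and conv: "\<And>a b c. a \<in> ball \<xi> r \<Longrightarrow> b \<in> ball \<xi> r \<Longrightarrow> a \<in> set_W f v \<Longrightarrow> b \<in> set_W f v \<Longrightarrow> c \<in> {a..b} \<Longrightarrow> c \<in> set_W f v"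
    using set_E_nbhd[OF \<xi>] by blast
  have W: "\<xi> \<in> set_W f v" and nR: "\<xi> \<notin> interior (set_W f v)" using \<xi> by (auto simp: set_E_def set_R_def)
  have intW: "c \<in> interior (set_W f v)" if "a \<in> ball \<xi> r" "b \<in> ball \<xi> r" "a \<in> set_W f v" "b \<in> set_W f v" "c \<in> {a<..<b}" for a b c
  proof (rule interiorI[of "{a<..<b}"])
    show "{a<..<b} \<subseteq> set_W f v" using conv[OF that(1-4)] by auto
  qed (use that in auto)
  have CW: "\<eta> \<in> set_C f v" if "\<eta> \<in> ball \<xi> r" "\<eta> \<notin> set_W f v" for \<eta>
    using cp[OF that(1)] that(2) by (auto simp: set_W_iff set_C_iff)
  have EW: "set_E f v \<subseteq> set_W f v" "set_E f v \<inter> interior (set_W f v) = {}" by (auto simp: set_E_def set_R_def)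
  have \<xi>b: "\<xi> \<in> ball \<xi> r" using r by simp
  have no_both: False if "a \<in> ball \<xi> r" "b \<in> ball \<xi> r" "a \<in> set_W f v" "b \<in> set_W f v" "a < \<xi>" "\<xi> < b" for a b
    using intW[OF that(1-4), of \<xi>] that nR by auto
  have one: "{\<xi><..<\<xi> + r} \<subseteq> set_C f v \<or> {\<xi> - r<..<\<xi>} \<subseteq> set_C f v"
  proof (rule ccontr)
    assume "\<not> ?thesis"
    then obtain a b where ab: "b \<in> {\<xi><..<\<xi> + r}" "b \<notin> set_C f v" "a \<in> {\<xi> - r<..<\<xi>}" "a \<notin> set_C f v" by blast
    then have in_ball: "a \<in> ball \<xi> r" "b \<in> ball \<xi> r" by (auto simp: dist_real_def)
    then show False using no_both[of a b] CW ab by auto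
  qed
  have iso: "\<exists>s>0. s \<le> r \<and> ball \<xi> s \<inter> set_E f v = {\<xi>}"
  proof (cases "\<exists>a. a \<in> ball \<xi> r \<and> a \<in> set_W f v \<and> a \<noteq> \<xi>")
    case False
    then have "ball \<xi> r \<inter> set_E f v = {\<xi>}" using EW \<xi> \<xi>b by blast
    then show ?thesis using r by blast
  next
    case True
    then obtain a where a: "a \<in> ball \<xi> r" "a \<in> set_W f v" "a \<noteq> \<xi>" by blast
    \<comment> \<open>Points strictly between \<xi> and a are interior to W, and a point of W on the
      opposite side would make \<xi> interior as well. So no other point of E is closer to \<xi>
      than a.\<close>
    let ?s = "\<bar>a - \<xi>\<bar>"
    have "\<eta> = \<xi>" if \<eta>: "\<eta> \<in> ball \<xi> ?s" "\<eta> \<in> set_E f v" for \<eta>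
    proof (rule ccontr)
      assume ne: "\<eta> \<noteq> \<xi>"
      have \<eta>W: "\<eta> \<in> set_W f v" "\<eta> \<notin> interior (set_W f v)" using \<eta> EW by auto
      have \<eta>r: "\<eta> \<in> ball \<xi> r" using \<eta> a by (auto simp: dist_real_def)
      show False
      proof (cases "a < \<xi>")
        case True
        then show ?thesis
          using no_both[of a \<eta>] intW[of a \<xi> \<eta>] a \<eta>r \<eta>W \<eta>(1) ne \<xi>b W by (cases "\<eta> < \<xi>") (auto simp: dist_real_def)
      next
        case False
        then show ?thesis
          using no_both[of \<eta> a] intW[of \<xi> a \<eta>] a \<eta>r \<eta>W \<eta>(1) ne \<xi>b W by (cases "\<eta> < \<xi>") (auto simp: dist_real_def)
      qed
    qed
    then have "ball \<xi> ?s \<inter> set_E f v = {\<xi>}" using \<xi> a by auto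
    then show ?thesis using a by (intro exI[of _ ?s]) (auto simp: dist_real_def)
  qed
  then obtain s where s: "s > 0" "s \<le> r" "ball \<xi> s \<inter> set_E f v = {\<xi>}" by blast
  show ?thesis
  proof (rule that[OF s(1) _ s(3)])
    have "{\<xi><..<\<xi> + s} \<subseteq> {\<xi><..<\<xi> + r}" "{\<xi> - s<..<\<xi>} \<subseteq> {\<xi> - r<..<\<xi>}" using s by auto
    then show "{\<xi><..<\<xi> + s} \<subseteq> set_C f v \<or> {\<xi> - s<..<\<xi>} \<subseteq> set_C f v" using one by blast
  qed
qed

lemma set_E_endpoint:
  assumes \<xi>: "\<xi> \<in> set_E f v"
  shows "\<exists>J\<in>components (set_C f v). \<xi> \<in> frontier J"
proof -
  have \<xi>C: "\<xi> \<notin> set_C f v" using \<xi> by (auto simp: set_E_def set_W_iff set_C_iff)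
  obtain r where r: "r > 0" "{\<xi><..<\<xi> + r} \<subseteq> set_C f v \<or> {\<xi> - r<..<\<xi>} \<subseteq> set_C f v"
    and "ball \<xi> r \<inter> set_E f v = {\<xi>}"
    by (rule set_E_one_sided[OF \<xi>])
  have cl: "\<xi> \<in> closure {\<xi><..<\<xi> + r}" "\<xi> \<in> closure {\<xi> - r<..<\<xi>}" using r(1) by simp_all
  have "\<exists>I. I \<subseteq> set_C f v \<and> connected I \<and> I \<noteq> {} \<and> \<xi> \<in> closure I"
    using r(2)
  proof
    assume "{\<xi><..<\<xi> + r} \<subseteq> set_C f v"
    then show ?thesis using r(1) cl(1) by (intro exI[of _ "{\<xi><..<\<xi> + r}"]) auto
  next
    assume "{\<xi> - r<..<\<xi>} \<subseteq> set_C f v"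
    then show ?thesis using r(1) cl(2) by (intro exI[of _ "{\<xi> - r<..<\<xi>}"]) auto
  qed
  then obtain I where I: "I \<subseteq> set_C f v" "connected I" "I \<noteq> {}" "\<xi> \<in> closure I" by blast
  obtain J where J: "J \<in> components (set_C f v)" "I \<subseteq> J"
    using exists_component_superset[OF I(1) _ I(2)] I(1,3) by blast
  have "\<xi> \<in> closure J" using I(4) J(2) closure_mono by blast
  moreover have "\<xi> \<notin> interior J" using J(1) \<xi>C in_components_subset interior_subset by blast
  ultimately show ?thesis using J(1) by (auto simp: frontier_def)
qed

lemma set_E_isolated:
  assumes "\<xi> \<in> set_E f v"
  shows "\<xi> isolated_in set_E f v"
proof -
  obtain r where "r > 0" "{\<xi><..<\<xi> + r} \<subseteq> set_C f v \<or> {\<xi> - r<..<\<xi>} \<subseteq> set_C f v"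
    "ball \<xi> r \<inter> set_E f v = {\<xi>}"
    by (rule set_E_one_sided[OF assms])
  then show ?thesis using assms open_ball unfolding isolated_in_def by blast
qed

lemma set_isoS_isolated: "\<xi> \<in> set_isoS v \<Longrightarrow> \<xi> isolated_in set_S v"
  by (auto simp: set_isoS_def set_S'_def isolated_in_islimpt_iff)

lemma countable_set_isoS: "countable (set_isoS v)"
proof (rule countable_isolated)
  fix \<xi> assume "\<xi> \<in> set_isoS v"
  then show "\<xi> isolated_in set_isoS v"
    using set_isoS_isolated[of \<xi>] islimpt_subset[of \<xi> "set_isoS v" "set_S v"]
    by (auto simp: isolated_in_islimpt_iff set_isoS_def)
qed

lemma open_disjoint_set_S':
  assumes "open T" "\<And>\<xi>. \<xi> \<in> T \<Longrightarrow> ess_im_continuity_point v \<xi>"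
  shows "T \<inter> set_S' v = {}"
  using assms by (auto simp: set_S'_def set_S_def islimpt_def)

lemma set_R_subset: "set_R f v \<subseteq> set_W f v"
  by (auto simp: set_R_def interior_subset)

lemma open_set_R: "open (set_R f v)"
  by (simp add: set_R_def)

text \<open>Limit points of S cannot lie in C or R, which are open and consist of continuity points;
  the other relations are set algebra.\<close>

lemma partition:
  "UNIV = set_isoS v \<union> set_R f v \<union> (set_C f v \<union> set_E f v) \<union> set_S' v"
  "set_isoS v \<inter> set_R f v = {}"
  "set_C f v \<inter> set_E f v = {}"
  "(set_isoS v \<union> set_R f v) \<inter> (set_C f v \<union> set_E f v) = {}"
  "(set_isoS v \<union> set_R f v \<union> (set_C f v \<union> set_E f v)) \<inter> set_S' v = {}"
proof -
  have CS: "set_C f v \<inter> set_S' v = {}" by (rule open_disjoint_set_S'[OF open_set_C]) (simp add: set_C_iff)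
  have RS: "set_R f v \<inter> set_S' v = {}"
    by (rule open_disjoint_set_S'[OF open_set_R]) (use set_R_subset in \<open>auto simp: set_W_iff\<close>)
  show "UNIV = set_isoS v \<union> set_R f v \<union> (set_C f v \<union> set_E f v) \<union> set_S' v"
    by (auto simp: set_isoS_def set_E_def set_S_def set_W_iff set_C_iff)
  show "set_isoS v \<inter> set_R f v = {}" using set_R_subset by (auto simp: set_isoS_def set_S_def set_W_iff)
  show "set_C f v \<inter> set_E f v = {}" by (auto simp: set_E_def set_W_iff set_C_iff)
  show "(set_isoS v \<union> set_R f v) \<inter> (set_C f v \<union> set_E f v) = {}"
    using set_R_subset by (auto simp: set_isoS_def set_S_def set_E_def set_W_iff set_C_iff)
  show "(set_isoS v \<union> set_R f v \<union> (set_C f v \<union> set_E f v)) \<inter> set_S' v = {}"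
    using CS RS by (auto simp: set_isoS_def set_E_def)
qed

lemma set_C_component_constant:
  assumes "J \<in> components (set_C f v)"
  shows "\<exists>u. AE \<xi> in lebesgue. \<xi> \<in> J \<longrightarrow> v \<xi> = u"
proof -
  have J: "open J" "connected J" "J \<subseteq> set_C f v" "J \<noteq> {}"
    using open_components[OF open_set_C assms] in_components_connected[OF assms] in_components_subset[OF assms]
      in_components_nonempty[OF assms] by auto
  obtain a where a: "a \<in> J" using J by blast
  have "AE \<xi> in lebesgue. \<xi> \<in> J \<longrightarrow> v \<xi> = ess_im_value v \<xi>"
    by (rule AE_eq_ess_im_value[OF Linf J(1)]) (use J in \<open>auto simp: set_C_iff\<close>)
  then have "AE \<xi> in lebesgue. \<xi> \<in> J \<longrightarrow> v \<xi> = ess_im_value v a"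
    by eventually_elim (use set_C_constant[OF J(2,3) _ a] in auto)
  then show ?thesis by blast
qed

end

subsection \<open>Arclength parametrization\<close>

fun plen :: "(real \<Rightarrow> 'a::real_normed_vector) \<Rightarrow> real list \<Rightarrow> real" where
  "plen g [] = 0"
| "plen g [x] = 0"
| "plen g (x # y # zs) = norm (g y - g x) + plen g (y # zs)"

text \<open>Only weakly sorted: points may repeat, at no cost in \<open>plen\<close>, so that b can
  be inserted whether or not it already occurs.\<close>

definition partitions :: "real \<Rightarrow> real \<Rightarrow> real list set" where
  "partitions a b = {xs. sorted xs \<and> xs \<noteq> [] \<and> hd xs = a \<and> last xs = b}"

definition rectifiable :: "(real \<Rightarrow> 'a::real_normed_vector) \<Rightarrow> real \<Rightarrow> real \<Rightarrow> bool" where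
  "rectifiable g a b \<longleftrightarrow> bdd_above (plen g ` partitions a b)"

definition arclength :: "(real \<Rightarrow> 'a::real_normed_vector) \<Rightarrow> real \<Rightarrow> real \<Rightarrow> real" where
  "arclength g a b = Sup (plen g ` partitions a b)"

lemma plen_append: "plen g (xs @ b # ys) = plen g (xs @ [b]) + plen g (b # ys)"
  by (induction g xs rule: plen.induct) auto

text \<open>By the triangle inequality, passing through b does not shorten the polygon. The bound
  comes already split at b into two pieces.\<close>

lemma plen_insert: "plen g (xs @ ys) \<le> plen g (xs @ [b]) + plen g (b # ys)"
proof (induction g xs rule: plen.induct)
  case (1 g)
  show ?case by (cases ys) auto
next
  case (2 g x)
  show ?case
  proof (cases ys)
    case (Cons y zs)
    have "norm (g y - g x) \<le> norm (g b - g x) + norm (g y - g b)"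
      using norm_triangle_ineq[of "g b - g x" "g y - g b"] by simp
    then show ?thesis using Cons by simp
  qed simp
qed auto

lemma partitions_bounds:
  assumes "xs \<in> partitions a b" "x \<in> set xs"
  shows "a \<le> x" "x \<le> b"
proof -
  have s: "sorted xs" "hd xs = a" "last xs = b" "xs \<noteq> []" using assms by (auto simp: partitions_def)
  show "a \<le> x" using s assms(2) by (cases xs) auto
  have "sorted (butlast xs @ [last xs])" unfolding append_butlast_last_id[OF s(4)] by (rule s(1))
  then have "\<forall>y\<in>set (butlast xs). y \<le> b" unfolding sorted_append using s by simp
  moreover have "set xs = insert b (set (butlast xs))" using s by (metis append_butlast_last_id list.simps(15) rotate1.simps(2) set_rotate1)
  ultimately show "x \<le> b" using assms(2) by auto
qed

lemma partitions_append:
  assumes xs: "xs \<in> partitions a b" and ys: "ys \<in> partitions b c"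
  shows "butlast xs @ ys \<in> partitions a c" "plen g (butlast xs @ ys) = plen g xs + plen g ys"
proof -
  have s: "sorted xs" "hd xs = a" "last xs = b" "xs \<noteq> []" "sorted ys" "hd ys = b" "last ys = c" "ys \<noteq> []"
    using assms by (auto simp: partitions_def)
  have xe: "xs = butlast xs @ [b]" using s by (metis append_butlast_last_id)
  obtain zs where ye: "ys = b # zs" using s by (cases ys) auto
  have "sorted (butlast xs @ ys)"
    unfolding sorted_append
    using s partitions_bounds[OF xs] partitions_bounds[OF ys] xe by (metis in_set_butlastD order_trans sorted_append)
  moreover have "hd (butlast xs @ ys) = a" using s xe by (metis hd_append2 list.sel(1) append_Nil ye)
  ultimately show "butlast xs @ ys \<in> partitions a c" using s by (simp add: partitions_def)
  show "plen g (butlast xs @ ys) = plen g xs + plen g ys"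
    using plen_append[of g "butlast xs" b zs] xe ye by simp
qed

lemma partitions_split:
  assumes xs: "xs \<in> partitions a c" and b: "a \<le> b" "b \<le> c"
  obtains ls rs where "ls \<in> partitions a b" "rs \<in> partitions b c" "plen g xs \<le> plen g ls + plen g rs"
proof -
  have s: "sorted xs" "hd xs = a" "last xs = c" "xs \<noteq> []" using xs by (auto simp: partitions_def)
  \<comment> \<open>Entries equal to b go to the left part; b is then added to both parts.\<close>
  define l r where "l = takeWhile (\<lambda>x. x \<le> b) xs" and "r = dropWhile (\<lambda>x. x \<le> b) xs"
  have lr: "l @ r = xs" by (simp add: l_def r_def)
  have l: "l \<noteq> []" "hd l = a" using s b by (cases xs; simp add: l_def)+
  have sl: "sorted l" "sorted r" using s(1) unfolding lr[symmetric] sorted_append by auto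
  have "\<forall>x\<in>set l. x \<le> b" by (auto simp: l_def dest: set_takeWhileD)
  then have p1: "l @ [b] \<in> partitions a b" using l sl by (simp add: partitions_def sorted_append)
  have "sorted (b # r)"
  proof (cases r)
    case (Cons y ys)
    then have "\<not> hd r \<le> b" using hd_dropWhile[of "\<lambda>x. x \<le> b" xs] by (simp add: r_def)
    then show ?thesis using sl(2) Cons by auto
  qed simp
  moreover have "last (b # r) = c"
  proof (cases "r = []")
    case True
    then have "c \<in> set l" using lr s by (metis append_Nil2 last_in_set)
    then show ?thesis using True b \<open>\<forall>x\<in>set l. x \<le> b\<close> by force
  next
    case False
    then show ?thesis using lr s by (metis last_append last_ConsR)
  qed
  ultimately have p2: "b # r \<in> partitions b c" by (simp add: partitions_def)
  show ?thesis using that[OF p1 p2] plen_insert[of g l r b] lr by simp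
qed

lemma plen_le_arclength:
  assumes "rectifiable g a b" "xs \<in> partitions a b"
  shows "plen g xs \<le> arclength g a b"
  unfolding arclength_def by (rule cSup_upper) (use assms in \<open>auto simp: rectifiable_def\<close>)

lemma partitions_nonempty: "a \<le> b \<Longrightarrow> [a, b] \<in> partitions a b"
  by (simp add: partitions_def)

lemma arclength_le:
  assumes "a \<le> b" "\<And>xs. xs \<in> partitions a b \<Longrightarrow> plen g xs \<le> B"
  shows "rectifiable g a b" "arclength g a b \<le> B"
proof -
  show "rectifiable g a b" unfolding rectifiable_def by (rule bdd_aboveI[of _ B]) (use assms(2) in auto)
  show "arclength g a b \<le> B"
    unfolding arclength_def by (rule cSup_least) (use assms partitions_nonempty in auto)
qed

lemma norm_le_arclength:
  assumes "rectifiable g a b" "a \<le> b"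
  shows "norm (g b - g a) \<le> arclength g a b"
  using plen_le_arclength[OF assms(1) partitions_nonempty[OF assms(2)]] by simp

text \<open>Splitting a partition at b gives one inequality, concatenating two partitions the other;
  in the latter the two suprema are taken one after the other.\<close>

lemma rectifiable_trans:
  assumes "rectifiable g a b" "rectifiable g b c" "a \<le> b" "b \<le> c"
  shows "rectifiable g a c" "arclength g a c = arclength g a b + arclength g b c"
proof -
  have u: "plen g xs \<le> arclength g a b + arclength g b c" if "xs \<in> partitions a c" for xs
  proof -
    obtain ls rs where "ls \<in> partitions a b" "rs \<in> partitions b c" "plen g xs \<le> plen g ls + plen g rs"
      by (rule partitions_split[OF \<open>xs \<in> partitions a c\<close> assms(3,4)])
    then show ?thesis using plen_le_arclength[OF assms(1)] plen_le_arclength[OF assms(2)] by (meson add_mono order_trans)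
  qed
  have ac: "a \<le> c" using assms by simp
  show rc: "rectifiable g a c" using arclength_le(1)[OF ac u] by blast
  have "plen g xs + plen g ys \<le> arclength g a c" if "xs \<in> partitions a b" "ys \<in> partitions b c" for xs ys
    using plen_le_arclength[OF rc partitions_append(1)[OF that]] partitions_append(2)[OF that, of g] by simp
  then have "plen g xs \<le> arclength g a c - plen g ys" if "xs \<in> partitions a b" "ys \<in> partitions b c" for xs ys
    using that by (simp add: le_diff_eq)
  then have "arclength g a b \<le> arclength g a c - plen g ys" if "ys \<in> partitions b c" for ys
    using arclength_le(2)[OF assms(3)] that by blast
  then have "plen g ys \<le> arclength g a c - arclength g a b" if "ys \<in> partitions b c" for ys
    using that by (simp add: le_diff_eq add.commute)
  then have "arclength g b c \<le> arclength g a c - arclength g a b" using arclength_le(2)[OF assms(4)] by blast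
  moreover have "arclength g a c \<le> arclength g a b + arclength g b c" using arclength_le(2)[OF ac u] by blast
  ultimately show "arclength g a c = arclength g a b + arclength g b c" by simp
qed

text \<open>The chord inequalities add up and their right-hand sides telescope. With c close to 1
  and a unit vector \<rho>, this bounds a polygon by little more than the chord between its
  ends.\<close>

lemma plen_le_inner:
  fixes g :: "real \<Rightarrow> 'a::real_inner"
  assumes "sorted xs" "xs \<noteq> []" "\<And>x y. x \<in> set xs \<Longrightarrow> y \<in> set xs \<Longrightarrow> x \<le> y \<Longrightarrow> c * norm (g y - g x) \<le> \<rho> \<bullet> (g y - g x)"
  shows "c * plen g xs \<le> \<rho> \<bullet> (g (last xs) - g (hd xs))"
  using assms
proof (induction g xs rule: plen.induct)
  case (3 g x y zs)
  have "c * plen g (y # zs) \<le> \<rho> \<bullet> (g (last (y # zs)) - g (hd (y # zs)))"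
    by (rule "3.IH") (use "3.prems" in auto)
  moreover have "c * norm (g y - g x) \<le> \<rho> \<bullet> (g y - g x)" by (rule "3.prems"(3)) (use "3.prems"(1) in auto)
  ultimately show ?case by (simp add: distrib_left inner_diff_right)
qed auto

text \<open>A chord that deviates from direction \<rho> by a fraction e of its length has
  \<rho>-component at least 1 - e times that length. This bounds all polygons at once by the chord
  from a to b.\<close>

lemma rectifiable_arclength_bound:
  fixes g :: "real \<Rightarrow> 'a::real_inner"
  assumes ab: "a \<le> b" and e: "e < 1" and \<rho>: "norm \<rho> = 1"
    and t: "\<And>x y. x \<in> {a..b} \<Longrightarrow> y \<in> {a..b} \<Longrightarrow> x \<le> y \<Longrightarrow> norm (g y - g x - norm (g y - g x) *\<^sub>R \<rho>) \<le> e * norm (g y - g x)"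
  shows "rectifiable g a b" "(1 - e) * arclength g a b \<le> norm (g b - g a)"
proof -
  have in1: "(1 - e) * norm (g y - g x) \<le> \<rho> \<bullet> (g y - g x)" if "x \<in> {a..b}" "y \<in> {a..b}" "x \<le> y" for x y
  proof -
    let ?\<Delta> = "g y - g x"
    have "\<rho> \<bullet> \<rho> = 1" using \<rho> by (simp add: norm_eq_1)
    then have "\<rho> \<bullet> ?\<Delta> = \<rho> \<bullet> (?\<Delta> - norm ?\<Delta> *\<^sub>R \<rho>) + norm ?\<Delta>" by (simp add: inner_diff_right)
    moreover have "\<bar>\<rho> \<bullet> (?\<Delta> - norm ?\<Delta> *\<^sub>R \<rho>)\<bar> \<le> e * norm ?\<Delta>"
      using Cauchy_Schwarz_ineq2[of \<rho> "?\<Delta> - norm ?\<Delta> *\<^sub>R \<rho>"] t[OF that] \<rho> by simp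
    ultimately have "norm ?\<Delta> - e * norm ?\<Delta> \<le> \<rho> \<bullet> ?\<Delta>" by linarith
    then show ?thesis by (simp only: left_diff_distrib mult_1)
  qed
  have p: "plen g xs \<le> norm (g b - g a) / (1 - e)" if xs: "xs \<in> partitions a b" for xs
  proof -
    have "(1 - e) * plen g xs \<le> \<rho> \<bullet> (g (last xs) - g (hd xs))"
      by (rule plen_le_inner) (use xs partitions_bounds[OF xs] in1 in \<open>auto simp: partitions_def\<close>)
    also have "\<dots> = \<rho> \<bullet> (g b - g a)" using xs by (simp add: partitions_def)
    also have "\<dots> \<le> norm (g b - g a)" using norm_cauchy_schwarz[of \<rho> "g b - g a"] \<rho> by simp
    finally show ?thesis using e by (simp add: pos_le_divide_eq mult.commute)
  qed
  show "rectifiable g a b" using arclength_le(1)[OF ab p] by blast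
  have "arclength g a b \<le> norm (g b - g a) / (1 - e)" using arclength_le(2)[OF ab p] by blast
  then show "(1 - e) * arclength g a b \<le> norm (g b - g a)" using e by (simp add: pos_le_divide_eq mult.commute)
qed

text \<open>Unlike differentiability of \<open>g\<close>, this survives at points where \<open>g\<close>, parametrized by the wave
  speed, has infinite velocity, that is, where genuine nonlinearity fails.\<close>

definition strong_tangent :: "(real \<Rightarrow> 'a::real_normed_vector) \<Rightarrow> real set \<Rightarrow> real \<Rightarrow> 'a \<Rightarrow> bool" where
  "strong_tangent g J \<xi> \<rho> \<longleftrightarrow> norm \<rho> = 1 \<and> (\<forall>e>0. \<exists>d>0. ball \<xi> d \<subseteq> J \<and>
     (\<forall>x\<in>ball \<xi> d. \<forall>y\<in>ball \<xi> d. x \<le> y \<longrightarrow> norm (g y - g x - norm (g y - g x) *\<^sub>R \<rho>) \<le> e * norm (g y - g x)))"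

text \<open>Locally arclength and chord agree up to a factor close to 1. So the signed arclength w
  from a base point is continuous, strictly increasing by injectivity of g, and chords divided by
  increments of w tend to \<rho>.\<close>

proposition arclength_parametrization:
  fixes g \<rho> :: "real \<Rightarrow> 'a::real_inner"
  assumes J: "open_interval J" and inj: "inj_on g J" and cont: "continuous_on J g"
    and str: "\<And>\<xi>. \<xi> \<in> J \<Longrightarrow> strong_tangent g J \<xi> (\<rho> \<xi>)"
  obtains I w w' where "open_interval I" "homeomorphism J I w w'"
    "\<And>\<eta>. \<eta> \<in> I \<Longrightarrow> ((\<lambda>\<eta>. g (w' \<eta>)) has_vector_derivative \<rho> (w' \<eta>)) (at \<eta>)" "continuous_on J \<rho>"
proof -
  have oJ: "open J" and iJ: "is_interval J" and neJ: "J \<noteq> {}" using J by (auto simp: open_interval_def)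
  have \<rho>: "norm (\<rho> \<xi>) = 1" if "\<xi> \<in> J" for \<xi> using str[OF that] by (simp add: strong_tangent_def)
  have tangent: "\<exists>d>0. ball \<xi> d \<subseteq> J \<and>
      (\<forall>x\<in>ball \<xi> d. \<forall>y\<in>ball \<xi> d. x \<le> y \<longrightarrow> norm (g y - g x - norm (g y - g x) *\<^sub>R \<rho> \<xi>) \<le> e * norm (g y - g x))"
    if "\<xi> \<in> J" "e > 0" for \<xi> e using str[OF that(1)] that(2) unfolding strong_tangent_def by blast
  have sub: "{a..b} \<subseteq> J" if "a \<in> J" "b \<in> J" for a b
  proof
    fix x assume "x \<in> {a..b}"
    then show "x \<in> J" by (intro mem_is_interval_1_I[OF iJ that]) auto
  qed
  have loc: "\<exists>d>0. ball \<xi> d \<subseteq> J \<and> (\<forall>x\<in>ball \<xi> d. \<forall>y\<in>ball \<xi> d. x \<le> y \<longrightarrow>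
      norm (g y - g x - norm (g y - g x) *\<^sub>R \<rho> \<xi>) \<le> e * norm (g y - g x) \<and>
      rectifiable g x y \<and> (1 - e) * arclength g x y \<le> norm (g y - g x))" if \<xi>: "\<xi> \<in> J" and e: "0 < e" "e < 1" for \<xi> e
  proof -
    obtain d where d: "d > 0" "ball \<xi> d \<subseteq> J" and
      t: "\<forall>x\<in>ball \<xi> d. \<forall>y\<in>ball \<xi> d. x \<le> y \<longrightarrow> norm (g y - g x - norm (g y - g x) *\<^sub>R \<rho> \<xi>) \<le> e * norm (g y - g x)"
      using tangent[OF \<xi> e(1)] by blast
    have "rectifiable g x y \<and> (1 - e) * arclength g x y \<le> norm (g y - g x)"
      if xy: "x \<in> ball \<xi> d" "y \<in> ball \<xi> d" "x \<le> y" for x y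
    proof -
      have "{x..y} \<subseteq> ball \<xi> d" using xy by (auto simp: dist_real_def)
      then have "\<forall>u\<in>{x..y}. \<forall>z\<in>{x..y}. u \<le> z \<longrightarrow> norm (g z - g u - norm (g z - g u) *\<^sub>R \<rho> \<xi>) \<le> e * norm (g z - g u)"
        using t by blast
      with rectifiable_arclength_bound[OF xy(3) e(2) \<rho>[OF \<xi>]] show ?thesis by blast
    qed
    with d t show ?thesis by blast
  qed
  \<comment> \<open>Bisection: rectifiability is additive and holds on short intervals around every
    point of [a, b].\<close>
  have rect: "rectifiable g a b" if ab: "a \<in> J" "b \<in> J" "a \<le> b" for a b
  proof (rule Bolzano[OF ab(3)])
    show "rectifiable g x z" if "rectifiable g x y" "rectifiable g y z" "x \<le> y" "y \<le> z" for x y z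
      using rectifiable_trans(1)[OF that] .
    fix x assume "a \<le> x" "x \<le> b"
    then have "x \<in> J" using sub[OF ab(1,2)] by auto
    then obtain d where d: "d > 0" "\<forall>u\<in>ball x d. \<forall>y\<in>ball x d. u \<le> y \<longrightarrow> rectifiable g u y"
      using loc[of x "1/2"] by auto
    show "\<exists>d>0. \<forall>a b. a \<le> x \<and> x \<le> b \<and> b - a < d \<longrightarrow> rectifiable g a b"
    proof (intro exI[of _ d] conjI d(1) allI impI)
      fix a b assume "a \<le> x \<and> x \<le> b \<and> b - a < d"
      then show "rectifiable g a b" using d(2) by (auto simp: dist_real_def)
    qed
  qed
  obtain c where c: "c \<in> J" using neJ by blast
  define w where "w t = (if c \<le> t then arclength g c t else - arclength g t c)" for t
  have wd: "w y - w x = arclength g x y" if xy: "x \<in> J" "y \<in> J" "x \<le> y" for x y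
  proof -
    have add: "arclength g p r = arclength g p q + arclength g q r" if "p \<in> J" "q \<in> J" "r \<in> J" "p \<le> q" "q \<le> r" for p q r
      using rectifiable_trans(2)[of g p q r] rect that by auto
    show ?thesis
      using add[of c x y] add[of x c y] add[of x y c] xy c by (auto simp: w_def)
  qed
  have wge: "norm (g y - g x) \<le> w y - w x" if xy: "x \<in> J" "y \<in> J" "x \<le> y" for x y
    unfolding wd[OF xy] using norm_le_arclength[OF rect[OF xy] xy(3)] .
  have mono: "w x < w y" if "x \<in> J" "y \<in> J" "x < y" for x y
  proof -
    have "g x \<noteq> g y" using inj that by (auto dest: inj_onD)
    then show ?thesis using wge[of x y] that by (smt (verit) zero_less_norm_iff right_minus_eq)
  qed
  have injw: "inj_on w J" by (rule inj_onI) (metis mono linorder_neqE_linordered_idom less_irrefl)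
  have loc2: "\<exists>d>0. ball \<xi> d \<subseteq> J \<and> (\<forall>x\<in>ball \<xi> d. norm (g x - g \<xi> - (w x - w \<xi>) *\<^sub>R \<rho> \<xi>) \<le> e * \<bar>w x - w \<xi>\<bar>
      \<and> \<bar>w x - w \<xi>\<bar> \<le> 2 * norm (g x - g \<xi>))" if \<xi>: "\<xi> \<in> J" and e: "0 < e" for \<xi> e
  proof -
    \<comment> \<open>Two errors of e' each add up to at most e: the direction of the chord and the
      excess of arclength over it. The bound 1/2 makes arclength at most twice the chord, which
      yields continuity of w.\<close>
    define e' where "e' = min (e / 2) (1 / 2)"
    have e': "0 < e'" "e' < 1" "e' \<le> 1 / 2" "2 * e' \<le> e" using e by (auto simp: e'_def)
    obtain d where d: "d > 0" "ball \<xi> d \<subseteq> J" and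
      t: "\<forall>x\<in>ball \<xi> d. \<forall>y\<in>ball \<xi> d. x \<le> y \<longrightarrow>
      norm (g y - g x - norm (g y - g x) *\<^sub>R \<rho> \<xi>) \<le> e' * norm (g y - g x) \<and>
      rectifiable g x y \<and> (1 - e') * arclength g x y \<le> norm (g y - g x)" using loc[OF \<xi> e'(1,2)] by blast
    have key: "norm (g y - g x - (w y - w x) *\<^sub>R \<rho> \<xi>) \<le> e * (w y - w x) \<and> w y - w x \<le> 2 * norm (g y - g x)"
      if xy: "x \<in> ball \<xi> d" "y \<in> ball \<xi> d" "x \<le> y" for x y
    proof -
      let ?\<Delta> = "g y - g x" and ?L = "w y - w x"
      have xyJ: "x \<in> J" "y \<in> J" using xy d by auto
      have 1: "norm (?\<Delta> - norm ?\<Delta> *\<^sub>R \<rho> \<xi>) \<le> e' * norm ?\<Delta>" "(1 - e') * ?L \<le> norm ?\<Delta>"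
        using t xy unfolding wd[OF xyJ xy(3)] by blast+
      have 2: "norm ?\<Delta> \<le> ?L" by (rule wge[OF xyJ xy(3)])
      have L0: "0 \<le> ?L" using 2 norm_ge_zero order_trans by blast
      have "?\<Delta> - ?L *\<^sub>R \<rho> \<xi> = (?\<Delta> - norm ?\<Delta> *\<^sub>R \<rho> \<xi>) + (norm ?\<Delta> - ?L) *\<^sub>R \<rho> \<xi>" by (simp add: algebra_simps)
      then have "norm (?\<Delta> - ?L *\<^sub>R \<rho> \<xi>) \<le> norm (?\<Delta> - norm ?\<Delta> *\<^sub>R \<rho> \<xi>) + norm ((norm ?\<Delta> - ?L) *\<^sub>R \<rho> \<xi>)"
        using norm_triangle_ineq by metis
      also have "norm ((norm ?\<Delta> - ?L) *\<^sub>R \<rho> \<xi>) = ?L - norm ?\<Delta>" using 2 \<rho>[OF \<xi>] by simp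
      also have "norm (?\<Delta> - norm ?\<Delta> *\<^sub>R \<rho> \<xi>) + (?L - norm ?\<Delta>) \<le> e' * ?L + e' * ?L"
      proof (rule add_mono)
        show "norm (?\<Delta> - norm ?\<Delta> *\<^sub>R \<rho> \<xi>) \<le> e' * ?L"
          using 1(1) mult_left_mono[OF 2, of e'] e' by linarith
        show "?L - norm ?\<Delta> \<le> e' * ?L" using 1(2) by (simp add: algebra_simps)
      qed
      also have "\<dots> \<le> e * ?L" using mult_right_mono[OF e'(4) L0] by (simp add: algebra_simps)
      finally have A: "norm (?\<Delta> - ?L *\<^sub>R \<rho> \<xi>) \<le> e * ?L" .
      have "1 / 2 * ?L \<le> (1 - e') * ?L" using e' L0 by (intro mult_right_mono) auto
      also have "\<dots> \<le> norm ?\<Delta>" by (rule 1(2))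
      finally have "?L \<le> 2 * norm ?\<Delta>" by simp
      with A show ?thesis by blast
    qed
    have "norm (g x - g \<xi> - (w x - w \<xi>) *\<^sub>R \<rho> \<xi>) \<le> e * \<bar>w x - w \<xi>\<bar> \<and> \<bar>w x - w \<xi>\<bar> \<le> 2 * norm (g x - g \<xi>)" if x: "x \<in> ball \<xi> d" for x
    proof (cases "x \<le> \<xi>")
      case True
      have \<xi>b: "\<xi> \<in> ball \<xi> d" using d by simp
      have "w x \<le> w \<xi>" using wge[of x \<xi>] True x d \<xi> norm_ge_zero[of "g \<xi> - g x"] by (meson diff_ge_0_iff_ge order_trans subsetD)
      moreover have "norm (g x - g \<xi> - (w x - w \<xi>) *\<^sub>R \<rho> \<xi>) = norm (g \<xi> - g x - (w \<xi> - w x) *\<^sub>R \<rho> \<xi>)"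
        by (subst norm_minus_cancel[symmetric]) (simp add: algebra_simps)
      ultimately show ?thesis using key[OF x \<xi>b True] by (simp add: norm_minus_commute)
    next
      case False
      have \<xi>b: "\<xi> \<in> ball \<xi> d" using d by simp
      have "w \<xi> \<le> w x" using mono[of \<xi> x] False x d \<xi> by fastforce
      then show ?thesis using key[OF \<xi>b x] False by simp
    qed
    with d show ?thesis by blast
  qed
  have contw: "continuous_on J w"
  proof (rule continuous_at_imp_continuous_on, rule ballI)
    fix \<xi> assume \<xi>: "\<xi> \<in> J"
    obtain d where d: "d > 0" "\<forall>x\<in>ball \<xi> d. \<bar>w x - w \<xi>\<bar> \<le> 2 * norm (g x - g \<xi>)" using loc2[OF \<xi>, of 1] by auto
    have "isCont g \<xi>" using cont oJ \<xi> by (simp add: continuous_on_eq_continuous_at)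
    then have "((\<lambda>x. 2 * norm (g x - g \<xi>)) \<longlongrightarrow> 2 * norm (g \<xi> - g \<xi>)) (at \<xi>)"
      unfolding isCont_def by (intro tendsto_intros)
    then have l: "((\<lambda>x. 2 * norm (g x - g \<xi>)) \<longlongrightarrow> 0) (at \<xi>)" by simp
    have "eventually (\<lambda>x. norm (w x - w \<xi>) \<le> 2 * norm (g x - g \<xi>)) (at \<xi>)"
      unfolding eventually_at using d by (intro exI[of _ d]) (auto simp: dist_commute)
    from Lim_null_comparison[OF this l] show "isCont w \<xi>" unfolding isCont_def by (simp add: Lim_null[symmetric])
  qed
  obtain w' where hom: "homeomorphism J (w ` J) w w'"
    using invariance_of_domain_homeomorphism[OF oJ contw _ injw] by auto
  have oI: "open (w ` J)" using invariance_of_domain[OF contw oJ injw] .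
  have I: "open_interval (w ` J)"
  proof -
    have "connected (w ` J)" using contw iJ is_interval_connected_1 connected_continuous_image by blast
    then show ?thesis using oI neJ by (auto simp: open_interval_def is_interval_connected_1)
  qed
  have der: "((\<lambda>\<eta>. g (w' \<eta>)) has_vector_derivative \<rho> (w' \<eta>0)) (at \<eta>0)" if \<eta>0: "\<eta>0 \<in> w ` J" for \<eta>0
    unfolding has_vector_derivative_def has_derivative_at_alt
  proof (intro conjI allI impI)
    show "bounded_linear (\<lambda>x. x *\<^sub>R \<rho> (w' \<eta>0))" by (rule bounded_linear_scaleR_left)
    fix e :: real assume e: "e > 0"
    let ?\<xi> = "w' \<eta>0"
    have \<xi>: "?\<xi> \<in> J" "w ?\<xi> = \<eta>0" using hom \<eta>0 by (auto simp: homeomorphism_def)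
    obtain d where d: "d > 0" "\<forall>x\<in>ball ?\<xi> d. norm (g x - g ?\<xi> - (w x - w ?\<xi>) *\<^sub>R \<rho> ?\<xi>) \<le> e * \<bar>w x - w ?\<xi>\<bar>"
      using loc2[OF \<xi>(1) e] by blast
    have "isCont w' \<eta>0" using hom oI \<eta>0 by (auto simp: homeomorphism_def continuous_on_eq_continuous_at)
    then obtain s where s: "s > 0" "\<And>\<eta>. dist \<eta> \<eta>0 < s \<Longrightarrow> dist (w' \<eta>) ?\<xi> < d"
      using d(1) unfolding continuous_at_eps_delta by blast
    obtain s' where s': "s' > 0" "ball \<eta>0 s' \<subseteq> w ` J" using oI \<eta>0 openE by blast
    show "\<exists>d>0. \<forall>y. norm (y - \<eta>0) < d \<longrightarrow> norm (g (w' y) - g (w' \<eta>0) - (y - \<eta>0) *\<^sub>R \<rho> (w' \<eta>0)) \<le> e * norm (y - \<eta>0)"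
    proof (intro exI[of _ "min s s'"] conjI allI impI)
      fix y assume y: "norm (y - \<eta>0) < min s s'"
      then have "y \<in> w ` J" using s' by (auto simp: dist_norm norm_minus_commute)
      then have wy: "w (w' y) = y" using hom by (auto simp: homeomorphism_def)
      have "w' y \<in> ball ?\<xi> d" using s(2)[of y] y by (simp add: dist_norm norm_minus_commute)
      then show "norm (g (w' y) - g (w' \<eta>0) - (y - \<eta>0) *\<^sub>R \<rho> (w' \<eta>0)) \<le> e * norm (y - \<eta>0)"
        using d(2) wy \<xi>(2) by fastforce
    qed (use s s' in auto)
  qed
  \<comment> \<open>A short chord starting at \<eta> is nearly parallel to \<rho> \<eta> and, for
    \<eta> near \<xi>, also to \<rho> \<xi>. Here it matters that the tangent condition is uniform
    in both endpoints.\<close>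
  have c\<rho>: "continuous_on J \<rho>"
    unfolding continuous_on_iff
  proof (intro ballI allI impI)
    fix \<xi> and e :: real assume \<xi>: "\<xi> \<in> J" and e: "e > 0"
    have e4: "e / 4 > 0" using e by simp
    obtain d where d: "d > 0" "ball \<xi> d \<subseteq> J" and t: "\<forall>x\<in>ball \<xi> d. \<forall>y\<in>ball \<xi> d. x \<le> y \<longrightarrow> norm (g y - g x - norm (g y - g x) *\<^sub>R \<rho> \<xi>) \<le> e / 4 * norm (g y - g x)"
      using tangent[OF \<xi> e4] by blast
    show "\<exists>d>0. \<forall>\<eta>\<in>J. dist \<eta> \<xi> < d \<longrightarrow> dist (\<rho> \<eta>) (\<rho> \<xi>) < e"
    proof (intro exI[of _ d] conjI d(1) ballI impI)
      fix \<eta> assume \<eta>: "\<eta> \<in> J" "dist \<eta> \<xi> < d"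
      obtain d' where d': "d' > 0" and t': "\<forall>x\<in>ball \<eta> d'. \<forall>y\<in>ball \<eta> d'. x \<le> y \<longrightarrow> norm (g y - g x - norm (g y - g x) *\<^sub>R \<rho> \<eta>) \<le> e / 4 * norm (g y - g x)"
        using tangent[OF \<eta>(1) e4] by blast
      obtain s where s: "s > 0" "ball \<eta> s \<subseteq> ball \<xi> d"
        using openE[of "ball \<xi> d" \<eta>] \<eta> by (auto simp: dist_commute)
      \<comment> \<open>A point to the right of \<eta> inside both neighbourhoods; injectivity makes
        the chord nonzero, so that its length can be cancelled.\<close>
      define y where "y = \<eta> + min d' s / 2"
      have "y \<in> ball \<eta> s" using d' s(1) by (auto simp: y_def dist_real_def)
      then have y: "\<eta> < y" "y \<in> ball \<eta> d'" "y \<in> ball \<xi> d" "\<eta> \<in> ball \<eta> d'" "\<eta> \<in> ball \<xi> d"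
        using subsetD[OF s(2)] d' s(1) \<eta>(2) by (simp_all add: y_def dist_real_def)
      let ?\<Delta> = "g y - g \<eta>"
      have "y \<in> J" using y d by auto
      then have "?\<Delta> \<noteq> 0" using inj \<eta> y by (auto dest: inj_onD)
      have "norm (?\<Delta> - norm ?\<Delta> *\<^sub>R \<rho> \<xi>) \<le> e / 4 * norm ?\<Delta>" "norm (?\<Delta> - norm ?\<Delta> *\<^sub>R \<rho> \<eta>) \<le> e / 4 * norm ?\<Delta>"
        using t t' y by auto
      moreover have "norm (norm ?\<Delta> *\<^sub>R (\<rho> \<eta> - \<rho> \<xi>)) \<le> norm (?\<Delta> - norm ?\<Delta> *\<^sub>R \<rho> \<xi>) + norm (?\<Delta> - norm ?\<Delta> *\<^sub>R \<rho> \<eta>)"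
        using norm_triangle_ineq4[of "?\<Delta> - norm ?\<Delta> *\<^sub>R \<rho> \<xi>" "?\<Delta> - norm ?\<Delta> *\<^sub>R \<rho> \<eta>"] by (simp add: algebra_simps)
      ultimately have "norm (norm ?\<Delta> *\<^sub>R (\<rho> \<eta> - \<rho> \<xi>)) \<le> e / 4 * norm ?\<Delta> + e / 4 * norm ?\<Delta>" by linarith
      also have "\<dots> = norm ?\<Delta> * (e / 2)" by (simp add: field_simps)
      finally have "norm ?\<Delta> * norm (\<rho> \<eta> - \<rho> \<xi>) \<le> norm ?\<Delta> * (e / 2)" by (simp only: norm_scaleR abs_norm_cancel)
      then have "norm (\<rho> \<eta> - \<rho> \<xi>) \<le> e / 2" using \<open>?\<Delta> \<noteq> 0\<close> by simp
      then show "dist (\<rho> \<eta>) (\<rho> \<xi>) < e" using e by (simp add: dist_norm)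
    qed
  qed
  show ?thesis by (rule that[OF I hom der c\<rho>])
qed

subsection \<open>Rarefaction waves\<close>

context weak_solution
begin

text \<open>Passes from almost all pairs to all pairs. The identity between x and y says
  \<open>K x = K y\<close>; formed with the continuous representative, K is continuous, and a set of
  full measure in [a, b] is dense there.\<close>

lemma ess_im_value_increment:
  assumes J: "open J" "\<And>\<xi>. \<xi> \<in> J \<Longrightarrow> ess_im_continuity_point v \<xi>" and ab: "a \<le> b" "{a..b} \<subseteq> J"
  defines "u \<equiv> ess_im_value v"
  shows "f (u b) - f (u a) - a *\<^sub>R (u b - u a) = integral {a..b} (\<lambda>t. u b - u t)"
proof (cases "a = b")
  case False
  with ab have lt: "a < b" by simp
  obtain f' where f': "\<And>x. x \<in> \<U> \<Longrightarrow> (f has_derivative blinfun_apply (f' x)) (at x)"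
    and "C1_on \<U> f'" "\<And>u r. u \<in> \<U> \<Longrightarrow> flux_matrix f u *v r = blinfun_apply (f' u) r"
    using C2_on_flux[OF C2] by blast
  have cf: "continuous_on \<U> f"
    using f' by (meson continuous_at_imp_continuous_on has_derivative_continuous)
  obtain Z where Z: "AE \<xi> in lebesgue. \<xi> \<in> Z"
    "\<And>x y. x \<in> Z \<Longrightarrow> y \<in> Z \<Longrightarrow> x \<le> y \<Longrightarrow>
       f (v y) - f (v x) - x *\<^sub>R (v y - v x) = integral {x..y} (\<lambda>t. v y - v t)"
    using weak_solution_increment[OF cf sol] by blast
  have vu: "AE t in lebesgue. t \<in> J \<longrightarrow> v t = u t"
    unfolding u_def by (rule AE_eq_ess_im_value[OF Linf J])
  then obtain N where N: "negligible N" "{t. \<not> (t \<in> J \<longrightarrow> v t = u t)} \<subseteq> N"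
    by (auto simp: eventually_ae_filter_negligible)
  define T where "T = {t \<in> Z. t \<in> {a..b} \<and> v t = u t}"
  have "continuous_on J u" unfolding u_def by (rule continuous_on_ess_im_value[OF Linf J(2)])
  then have cu: "continuous_on {a..b} u" using ab(2) continuous_on_subset by blast
  have uint: "u integrable_on {x..y}" if "a \<le> x" "y \<le> b" for x y
    by (rule integrable_continuous_interval) (use that continuous_on_subset[OF cu] in auto)
  define K where "K t = f (u t) - t *\<^sub>R u t + integral {a..t} u" for t
  have uU: "u t \<in> \<U>" if "t \<in> {a..b}" for t
    using ess_im_value_SH[OF J(2)] that ab(2) by (auto simp: u_def strictly_hyperbolic_set_def)
  have cK: "continuous_on {a..b} K"
    unfolding K_def
    by (intro continuous_intros cu continuous_on_compose2[OF cf cu] indefinite_integral_continuous_1 uint)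
      (use uU in auto)
  have KT: "K x = K y" if xy: "x \<in> T" "y \<in> T" "x \<le> y" for x y
  proof -
    have xyab: "a \<le> x" "y \<le> b" using xy by (auto simp: T_def)
    have "f (v y) - f (v x) - x *\<^sub>R (v y - v x) = integral {x..y} (\<lambda>t. v y - v t)"
      by (rule Z(2)) (use xy in \<open>auto simp: T_def\<close>)
    also have "\<dots> = (y - x) *\<^sub>R v y - integral {x..y} v"
      by (subst Henstock_Kurzweil_Integration.integral_diff) (use Linf_integrable_on[OF Linf] xy in auto)
    also have "integral {x..y} v = integral {x..y} u"
    proof (rule integral_spike[OF N(1)])
      fix t assume t: "t \<in> {x..y} - N"
      then have "t \<in> J" using ab(2) xyab by auto
      then show "u t = v t" using N(2) t by auto
    qed
    finally have E: "f (u y) - f (u x) - x *\<^sub>R (u y - u x) = (y - x) *\<^sub>R u y - integral {x..y} u"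
      using xy by (simp add: T_def)
    have "integral {a..x} u + integral {x..y} u = integral {a..y} u"
      by (rule Henstock_Kurzweil_Integration.integral_combine) (use xyab xy uint in auto)
    then have "integral {a..y} u = integral {a..x} u + integral {x..y} u" by simp
    then have "K y - K x = (f (u y) - f (u x) - x *\<^sub>R (u y - u x)) - ((y - x) *\<^sub>R u y - integral {x..y} u)"
      unfolding K_def by (simp add: algebra_simps)
    then show ?thesis using E by simp
  qed
  have dense: "{a..b} \<subseteq> closure T"
  proof
    fix x assume x: "x \<in> {a..b}"
    show "x \<in> closure T" unfolding closure_approachable
    proof (intro allI impI)
      fix e :: real assume e: "e > 0"
      \<comment> \<open>The window around x is cut off at a and b, so that it stays inside [a, b]
        and has positive length even when x is an endpoint.\<close>
      define l r where "l = max a (x - e)" and "r = min b (x + e)"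
      have lr: "l < r" "a \<le> l" "r \<le> b" "x - e \<le> l" "r \<le> x + e" using x lt e by (auto simp: l_def r_def)
      define m s where "m = (l + r) / 2" and "s = (r - l) / 2"
      have ms: "s > 0" "ball m s = {l<..<r}" using lr by (auto simp: m_def s_def ball_eq_greaterThanLessThan field_simps)
      have "AE t in lebesgue. t \<in> ball m s \<longrightarrow> t \<in> T"
        using Z(1) vu
      proof eventually_elim
        case (elim t)
        show ?case
        proof
          assume "t \<in> ball m s"
          then have t: "t \<in> {a..b}" unfolding ms(2) using lr by auto
          then have "t \<in> J" using ab(2) by blast
          then show "t \<in> T" using elim t by (simp add: T_def)
        qed
      qed
      then obtain y where "y \<in> ball m s" "y \<in> T" using ms(1) by (rule ball_AE_nonempty)
      then show "\<exists>y\<in>T. dist y x < e"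
        unfolding ms(2) using lr by (intro bexI[of _ y]) (auto simp: dist_real_def)
    qed
  qed
  have cT: "closure T = {a..b}"
  proof (rule antisym[OF closure_minimal dense])
    show "T \<subseteq> {a..b}" by (auto simp: T_def)
  qed simp
  have "a \<in> closure T" using cT lt by simp
  then have "T \<noteq> {}" by (metis closure_empty empty_iff)
  then obtain t0 where t0: "t0 \<in> T" by blast
  have const: "K x = K t0" if "x \<in> {a..b}" for x
  proof (rule continuous_constant_on_closure[of T])
    show "K y = K t0" if "y \<in> T" for y
    proof (cases "y \<le> t0")
      case True
      then show ?thesis by (rule KT[OF that t0])
    next
      case False
      then have "K t0 = K y" by (intro KT[OF t0 that]) simp
      then show ?thesis by simp
    qed
    show "continuous_on (closure T) K" "x \<in> closure T" unfolding cT by (rule cK, rule that)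
  qed
  have "K b = K a" using const[of a] const[of b] lt by simp
  then have "f (u b) - b *\<^sub>R u b + integral {a..b} u = f (u a) - a *\<^sub>R u a" by (simp add: K_def)
  then have "f (u b) - f (u a) - a *\<^sub>R (u b - u a) = (b - a) *\<^sub>R u b - integral {a..b} u"
    by (simp add: algebra_simps)
  also have "\<dots> = integral {a..b} (\<lambda>t. u b - u t)"
    by (subst Henstock_Kurzweil_Integration.integral_diff) (use uint lt in auto)
  finally show ?thesis .
qed simp

text \<open>The index is unique because the speeds at a state are distinct. It is locally constant
  because the other speeds differ from \<xi>, which persists nearby, and so it is constant on a
  connected set.\<close>

lemma set_W_speed_index:
  assumes J: "connected J" "J \<subseteq> set_W f v" "J \<noteq> {}"
  obtains i where "i < CARD('n)" "\<And>\<xi>. \<xi> \<in> J \<Longrightarrow> char_speed f i (ess_im_value v \<xi>) = \<xi>"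
proof -
  define idx where "idx \<xi> = (SOME i. i < CARD('n) \<and> char_speed f i (ess_im_value v \<xi>) = \<xi>)" for \<xi>
  have cp: "ess_im_continuity_point v \<xi>" if "\<xi> \<in> J" for \<xi> using J that by (auto simp: set_W_iff)
  have idx: "idx \<xi> < CARD('n)" "char_speed f (idx \<xi>) (ess_im_value v \<xi>) = \<xi>" if "\<xi> \<in> J" for \<xi>
  proof -
    have "\<xi> \<in> real_eigenvalues (flux_matrix f (ess_im_value v \<xi>))" using J that by (auto simp: set_W_iff)
    then have "\<exists>i. i < CARD('n) \<and> char_speed f i (ess_im_value v \<xi>) = \<xi>"
      unfolding char_speed_eigenvalues(1)[OF ess_im_value_SH[OF cp[OF that]]] by auto
    from someI_ex[OF this] show "idx \<xi> < CARD('n)" "char_speed f (idx \<xi>) (ess_im_value v \<xi>) = \<xi>"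
      by (auto simp: idx_def)
  qed
  have uniq: "i = j" if "i < CARD('n)" "j < CARD('n)" "\<xi> \<in> J" "char_speed f i (ess_im_value v \<xi>) = char_speed f j (ess_im_value v \<xi>)" for i j \<xi>
    using char_speed_eigenvalues(2)[OF ess_im_value_SH[OF cp[OF that(3)]], of i j]
      char_speed_eigenvalues(2)[OF ess_im_value_SH[OF cp[OF that(3)]], of j i] that by (cases i j rule: linorder_cases) auto
  have cu: "continuous_on J (ess_im_value v)" by (rule continuous_on_ess_im_value[OF Linf cp])
  have loc: "\<forall>\<xi>\<in>J. \<forall>\<^sub>F \<eta> in at \<xi> within J. idx \<xi> = idx \<eta>"
  proof
    fix \<xi> assume \<xi>: "\<xi> \<in> J"
    have "\<forall>\<^sub>F \<eta> in at \<xi> within J. \<forall>j\<in>{..<CARD('n)} - {idx \<xi>}. char_speed f j (ess_im_value v \<eta>) - \<eta> \<noteq> 0"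
    proof (intro eventually_ball_finite ballI)
      fix j assume j: "j \<in> {..<CARD('n)} - {idx \<xi>}"
      have "continuous_on J (\<lambda>\<eta>. char_speed f j (ess_im_value v \<eta>) - \<eta>)"
        by (intro continuous_intros continuous_on_compose2[OF continuous_on_char_speed[OF open_U C2] cu])
          (use j ess_im_value_SH[OF cp] in auto)
      then have "((\<lambda>\<eta>. char_speed f j (ess_im_value v \<eta>) - \<eta>) \<longlongrightarrow> char_speed f j (ess_im_value v \<xi>) - \<xi>) (at \<xi> within J)"
        using \<xi> by (simp add: continuous_on_def)
      moreover have "char_speed f j (ess_im_value v \<xi>) - \<xi> \<noteq> 0"
        using uniq[of j "idx \<xi>" \<xi>] idx[OF \<xi>] j \<xi> by auto
      ultimately show "\<forall>\<^sub>F \<eta> in at \<xi> within J. char_speed f j (ess_im_value v \<eta>) - \<eta> \<noteq> 0"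
        by (rule tendsto_imp_eventually_ne)
    qed simp
    moreover have "\<forall>\<^sub>F \<eta> in at \<xi> within J. \<eta> \<in> J" by (simp add: eventually_at_filter)
    ultimately show "\<forall>\<^sub>F \<eta> in at \<xi> within J. idx \<xi> = idx \<eta>"
      by eventually_elim (use idx in fastforce)
  qed
  obtain a where a: "a \<in> J" using J by blast
  show ?thesis
  proof (rule that[of "idx a"])
    show "idx a < CARD('n)" by (rule idx[OF a])
    fix \<xi> assume \<xi>: "\<xi> \<in> J"
    have "idx a = idx \<xi>" by (rule connected_local_const[OF J(1) a \<xi> loc])
    then show "char_speed f (idx a) (ess_im_value v \<xi>) = \<xi>" using idx[OF \<xi>] by simp
  qed
qed

lemma eigenvector_field:
  assumes "z \<in> SH" "i < CARD('n)"
  obtains V r where "open V" "z \<in> V" "V \<subseteq> SH" "C1_on V (char_speed f i)" "C1_on V r"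
    "\<And>y. y \<in> V \<Longrightarrow> right_eigenvector (flux_matrix f y) (char_speed f i y) (r y)"
  using strictly_hyperbolic_nhd[OF open_U C2 assms(1)] assms(2) by metis

text \<open>A simple eigenvalue has exactly two unit eigenvectors, and a positive inner product with
  \<rho> selects one of them.\<close>

lemma eigenvector_unique:
  assumes z: "z \<in> SH" and x: "right_eigenvector (flux_matrix f z) l x" "norm x = 1" "x \<bullet> \<rho> > 0"
    and y: "right_eigenvector (flux_matrix f z) l y" "norm y = 1" "y \<bullet> \<rho> > 0"
  shows "x = y"
proof -
  have "card (real_eigenvalues (flux_matrix f z)) = CARD('n)" using z by (simp add: strictly_hyperbolic_set_def)
  from simple_eigenvalue[OF this y(1), of x 0] x(1) obtain c where c: "x = c *\<^sub>R y"
    by (auto simp: right_eigenvector_def)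
  have "\<bar>c\<bar> = 1" using x(2) y(2) c by simp
  moreover have "c > 0" using x(3) y(3) c by (simp add: zero_less_mult_iff)
  ultimately show ?thesis using c by simp
qed

text \<open>Chords of u near \<xi> align with the eigenvector e up to sign, because M bounds their
  part orthogonal to e and is small on them. For the sign: no chord is orthogonal to e, so the
  e-component of u is injective and continuous, hence monotone near \<xi>.\<close>

lemma set_W_tangent:
  assumes J: "open J" "J \<subseteq> set_W f v" and i: "i < CARD('n)"
    and speed: "\<And>\<xi>. \<xi> \<in> J \<Longrightarrow> char_speed f i (ess_im_value v \<xi>) = \<xi>" and \<xi>: "\<xi> \<in> J"
  defines "u \<equiv> ess_im_value v"
  shows "\<exists>\<rho>. right_eigenvector (flux_matrix f (u \<xi>)) \<xi> \<rho> \<and> strong_tangent u J \<xi> \<rho>"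
proof -
  have cp: "ess_im_continuity_point v \<eta>" if "\<eta> \<in> J" for \<eta> using J that by (auto simp: set_W_iff)
  have SH: "u \<eta> \<in> SH" if "\<eta> \<in> J" for \<eta> unfolding u_def by (rule ess_im_value_SH[OF cp[OF that]])
  have cu: "continuous_on J u" unfolding u_def by (rule continuous_on_ess_im_value[OF Linf cp])
  obtain f' where f': "\<And>x. x \<in> \<U> \<Longrightarrow> (f has_derivative blinfun_apply (f' x)) (at x)" "C1_on \<U> f'"
    "\<And>u r. u \<in> \<U> \<Longrightarrow> flux_matrix f u *v r = blinfun_apply (f' u) r"
    using C2_on_flux[OF C2] by blast
  have cf': "continuous_on \<U> f'" by (rule C1_on_imp_continuous_on[OF f'(2)])
  define z where "z = u \<xi>"
  have zU: "z \<in> \<U>" and card: "card (real_eigenvalues (flux_matrix f z)) = CARD('n)"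
    using SH[OF \<xi>] by (auto simp: z_def strictly_hyperbolic_set_def)
  have "\<xi> \<in> real_eigenvalues (flux_matrix f z)" using J \<xi> by (auto simp: set_W_iff z_def u_def)
  then obtain e1 where "right_eigenvector (flux_matrix f z) \<xi> e1" by (auto simp: real_eigenvalues_def)
  define e where "e = e1 /\<^sub>R norm e1"
  have ne: "norm e = 1" and ev: "right_eigenvector (flux_matrix f z) \<xi> e"
    using \<open>right_eigenvector _ _ e1\<close>
    by (auto simp: e_def right_eigenvector_def matrix_vector_mult_scaleR)
  define M where "M x = f' z x - \<xi> *\<^sub>R x" for x
  \<comment> \<open>\<open>M\<close> has kernel \<open>span {e}\<close>; the rank-one correction makes it invertible by simplicity of the eigenvalue.\<close>
  define N where "N x = M x + (x \<bullet> e) *\<^sub>R e" for x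
  have M_e: "M e = 0" using ev f'(3)[OF zU] by (simp add: M_def right_eigenvector_def)
  have linM: "linear M" unfolding M_def
    by (intro linear_compose_sub bounded_linear.linear[OF blinfun.bounded_linear_right] linear_scale_self)
  have linN: "linear N" unfolding N_def
    by (intro linear_compose_add linM bounded_linear.linear[OF bounded_linear_compose[OF bounded_linear_scaleR_left bounded_linear_inner_left]])
  have "inj N"
  proof (subst linear_injective_0[OF linN], safe)
    fix x assume "N x = 0"
    then have "flux_matrix f z *v x - \<xi> *\<^sub>R x = (- (x \<bullet> e)) *\<^sub>R e"
      by (simp add: N_def M_def f'(3)[OF zU] eq_neg_iff_add_eq_0)
    from simple_eigenvalue[OF card ev this] obtain c where "x \<bullet> e = 0" "x = c *\<^sub>R e" by auto
    then show "x = 0" using ne by (auto simp: norm_eq_1)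
  qed
  then obtain \<kappa> where \<kappa>: "\<kappa> > 0" "\<And>x. \<kappa> * norm x \<le> norm (N x)"
    using linear_inj_bounded_below_pos[OF linN] by blast
  have Mbound: "\<kappa> * norm (x - (x \<bullet> e) *\<^sub>R e) \<le> norm (M x)" for x
  proof -
    have "(x - (x \<bullet> e) *\<^sub>R e) \<bullet> e = 0" using ne by (simp add: inner_diff_left norm_eq_1)
    moreover have "M (x - (x \<bullet> e) *\<^sub>R e) = M x"
      using M_e by (simp add: linear_diff[OF linM] linear_cmul[OF linM])
    ultimately have "N (x - (x \<bullet> e) *\<^sub>R e) = M x" by (simp add: N_def)
    then show ?thesis using \<kappa>(2)[of "x - (x \<bullet> e) *\<^sub>R e"] by simp
  qed
  obtain V r where V: "open V" "z \<in> V" and "V \<subseteq> SH" and cs: "C1_on V (char_speed f i)" and "C1_on V r"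
    "\<And>y. y \<in> V \<Longrightarrow> right_eigenvector (flux_matrix f y) (char_speed f i y) (r y)"
    using eigenvector_field[OF SH[OF \<xi>] i] unfolding z_def by blast
  from cs obtain l' where l': "\<And>x. x \<in> V \<Longrightarrow> (char_speed f i has_derivative blinfun_apply (l' x)) (at x)" "continuous_on V l'"
    by (auto simp: C1_on_def)
  obtain d1 where d1: "d1 > 0" "ball z d1 \<subseteq> V"
    "\<forall>x\<in>ball z d1. \<forall>y\<in>ball z d1. norm (char_speed f i y - char_speed f i x - l' z (y - x)) \<le> 1 * norm (y - x)"
    using strongly_differentiable[OF V(1,2) l' zero_less_one] by blast
  \<comment> \<open>A Lipschitz constant of the i-th speed near z; since the speed of
    \<open>u x\<close> is x, it bounds y - x by L times the chord.\<close>
  define L where "L = norm (l' z) + 1"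
  have L: "L > 0" by (simp add: L_def add_nonneg_pos)
  have lip: "\<bar>char_speed f i y - char_speed f i x\<bar> \<le> L * norm (y - x)" if "x \<in> ball z d1" "y \<in> ball z d1" for x y
  proof -
    have "\<bar>char_speed f i y - char_speed f i x - l' z (y - x)\<bar> \<le> norm (y - x)" using d1(3) that by simp
    moreover have "\<bar>l' z (y - x)\<bar> \<le> norm (l' z) * norm (y - x)" using norm_blinfun[of "l' z" "y - x"] by simp
    ultimately have "\<bar>char_speed f i y - char_speed f i x\<bar> \<le> norm (l' z) * norm (y - x) + norm (y - x)" by linarith
    then show ?thesis by (simp add: L_def distrib_right)
  qed
  have near: "\<exists>d>0. ball \<xi> d \<subseteq> J \<and> (\<forall>x\<in>ball \<xi> d. dist z (u x) < s)" if s: "s > 0" for s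
  proof -
    obtain d where d: "d > 0" "\<forall>x\<in>J. dist x \<xi> < d \<longrightarrow> dist (u x) z < s"
      using cu \<xi> s unfolding continuous_on_iff z_def by blast
    obtain d' where d': "d' > 0" "ball \<xi> d' \<subseteq> J" using J(1) \<xi> openE by blast
    have "ball \<xi> (min d d') \<subseteq> J" using d' by auto
    moreover have "\<forall>x\<in>ball \<xi> (min d d'). dist z (u x) < s"
      using d d' by (auto simp: dist_commute subset_iff)
    ultimately show ?thesis using d(1) d'(1) by (intro exI[of _ "min d d'"]) auto
  qed
  have lin: "\<exists>d>0. ball \<xi> d \<subseteq> J \<and> (\<forall>x\<in>ball \<xi> d. \<forall>y\<in>ball \<xi> d. x \<le> y \<longrightarrow>
      y - x \<le> L * norm (u y - u x) \<and>
      norm ((u y - u x) - ((u y - u x) \<bullet> e) *\<^sub>R e) \<le> \<epsilon> * norm (u y - u x))" if \<epsilon>: "\<epsilon> > 0" for \<epsilon>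
  proof -
    \<comment> \<open>Three errors of \<delta> times the chord are expected: the integral, the
      nonlinearity of f, and the shift from \<xi> to x. Together they make \<kappa> \<epsilon> times
      the chord.\<close>
    define \<delta> where "\<delta> = \<epsilon> * \<kappa> / 3"
    have \<delta>: "\<delta> > 0" using \<epsilon> \<kappa> by (simp add: \<delta>_def)
    obtain d2 where d2: "d2 > 0" "ball z d2 \<subseteq> \<U>"
      "\<forall>x\<in>ball z d2. \<forall>y\<in>ball z d2. norm (f y - f x - f' z (y - x)) \<le> \<delta> * norm (y - x)"
      using strongly_differentiable[OF open_U zU f'(1) cf' \<delta>] by blast
    \<comment> \<open>Values of u differ by at most 2 s, so the integral is at most 2 s (y - x)
      \<le> 2 s L times the chord; the bound \<delta> / (2 * L) keeps this below \<delta> times the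
      chord.\<close>
    define s where "s = min (min d1 d2) (\<delta> / (2 * L))"
    have s: "s > 0" "s \<le> d1" "s \<le> d2" "s \<le> \<delta> / (2 * L)" using d1 d2 \<delta> L by (auto simp: s_def)
    obtain d3 where d3: "d3 > 0" "ball \<xi> d3 \<subseteq> J" "\<forall>x\<in>ball \<xi> d3. dist z (u x) < s" using near[OF s(1)] by blast
    define d where "d = min d3 \<delta>"
    have "y - x \<le> L * norm (u y - u x) \<and> norm ((u y - u x) - ((u y - u x) \<bullet> e) *\<^sub>R e) \<le> \<epsilon> * norm (u y - u x)"
      if xy: "x \<in> ball \<xi> d" "y \<in> ball \<xi> d" "x \<le> y" for x y
    proof -
      let ?\<Delta> = "u y - u x"
      have xy3: "x \<in> ball \<xi> d3" "y \<in> ball \<xi> d3" using xy by (auto simp: d_def)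
      have sub3: "{x..y} \<subseteq> ball \<xi> d3" using xy3 by (auto simp: dist_real_def)
      have near: "dist z (u t) < s" if "t \<in> {x..y}" for t using d3(3) sub3 that by blast
      have b: "u x \<in> ball z d1" "u y \<in> ball z d1" "u x \<in> ball z d2" "u y \<in> ball z d2"
        using near[of x] near[of y] xy(3) s by auto
      have sp: "char_speed f i (u x) = x" "char_speed f i (u y) = y" using speed xy3 d3(2) by (auto simp: u_def)
      have lip': "y - x \<le> L * norm ?\<Delta>" using lip[OF b(1,2)] xy(3) by (simp add: sp)
      define E where "E = f (u y) - f (u x) - x *\<^sub>R ?\<Delta>"
      have "E = integral {x..y} (\<lambda>t. u y - u t)"
        unfolding E_def u_def
        by (rule ess_im_value_increment[OF J(1) cp xy(3)]) (use sub3 d3(2) in auto)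
      also have "norm \<dots> \<le> (2 * s) * (y - x)"
      proof (rule norm_integral_le_AE[OF _ xy(3)])
        show "(\<lambda>t. u y - u t) integrable_on {x..y}"
          by (intro integrable_continuous_interval continuous_intros continuous_on_subset[OF cu]) (use sub3 d3(2) in auto)
        show "AE t in lebesgue. t \<in> {x..y} \<longrightarrow> norm (u y - u t) \<le> 2 * s"
        proof (rule AE_I2, rule impI)
          fix t assume t: "t \<in> {x..y}"
          have "dist (u y) (u t) \<le> dist z (u y) + dist z (u t)" by (rule dist_triangle3)
          then show "norm (u y - u t) \<le> 2 * s" using near[OF t] near[of y] xy(3) by (simp add: dist_norm)
        qed
      qed (use s in auto)
      also have "\<dots> \<le> (2 * s) * (L * norm ?\<Delta>)" using s lip' by (intro mult_left_mono) auto
      also have "\<dots> = (2 * L * s) * norm ?\<Delta>" by simp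
      also have "\<dots> \<le> \<delta> * norm ?\<Delta>"
        using s(4) L by (intro mult_right_mono) (auto simp: field_simps)
      finally have E: "norm E \<le> \<delta> * norm ?\<Delta>" .
      have "M ?\<Delta> = E - (f (u y) - f (u x) - f' z ?\<Delta>) + (x - \<xi>) *\<^sub>R ?\<Delta>"
        by (simp add: M_def E_def algebra_simps)
      also have "norm \<dots> \<le> norm E + norm (f (u y) - f (u x) - f' z ?\<Delta>) + norm ((x - \<xi>) *\<^sub>R ?\<Delta>)"
        by (meson add_right_mono norm_triangle_ineq norm_triangle_ineq4 order_trans)
      also have "\<dots> \<le> \<delta> * norm ?\<Delta> + \<delta> * norm ?\<Delta> + \<delta> * norm ?\<Delta>"
      proof (intro add_mono E)
        show "norm (f (u y) - f (u x) - f' z ?\<Delta>) \<le> \<delta> * norm ?\<Delta>" using d2(3) b by blast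
        have "\<bar>x - \<xi>\<bar> \<le> \<delta>" using xy(1) by (auto simp: d_def dist_real_def)
        from mult_right_mono[OF this norm_ge_zero] show "norm ((x - \<xi>) *\<^sub>R ?\<Delta>) \<le> \<delta> * norm ?\<Delta>" by simp
      qed
      also have "\<dots> = \<kappa> * (\<epsilon> * norm ?\<Delta>)" by (simp add: \<delta>_def)
      finally have "\<kappa> * norm (?\<Delta> - (?\<Delta> \<bullet> e) *\<^sub>R e) \<le> \<kappa> * (\<epsilon> * norm ?\<Delta>)" using Mbound[of ?\<Delta>] by linarith
      then have "norm (?\<Delta> - (?\<Delta> \<bullet> e) *\<^sub>R e) \<le> \<epsilon> * norm ?\<Delta>" using \<kappa>(1) by (simp only: mult_le_cancel_left_pos)
      with lip' show ?thesis by blast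
    qed
    moreover have "ball \<xi> d \<subseteq> J" "d > 0" using d3 \<delta> by (auto simp: d_def)
    ultimately show ?thesis by blast
  qed
  \<comment> \<open>The length of a vector and that of its projection to the unit vector e differ by
    at most the orthogonal part.\<close>
  have abs_inner: "\<bar>norm x - \<bar>x \<bullet> e\<bar>\<bar> \<le> norm (x - (x \<bullet> e) *\<^sub>R e)" for x
    using norm_triangle_ineq3[of x "(x \<bullet> e) *\<^sub>R e"] ne by simp
  obtain d0 where d0: "d0 > 0" "ball \<xi> d0 \<subseteq> J" and lin0: "\<forall>x\<in>ball \<xi> d0. \<forall>y\<in>ball \<xi> d0. x \<le> y \<longrightarrow>
      y - x \<le> L * norm (u y - u x) \<and>
      norm ((u y - u x) - ((u y - u x) \<bullet> e) *\<^sub>R e) \<le> 1 / 2 * norm (u y - u x)"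
    using lin[of "1 / 2"] by auto
  \<comment> \<open>If the e-component of the chord vanished, the estimate with 1/2 would make the
    chord at most half of itself, hence zero, against y - x \<le> L times its length.\<close>
  have inj: "u x \<bullet> e \<noteq> u y \<bullet> e" if xy: "x \<in> ball \<xi> d0" "y \<in> ball \<xi> d0" "x < y" for x y
  proof
    assume "u x \<bullet> e = u y \<bullet> e"
    then have 0: "(u y - u x) \<bullet> e = 0" by (simp add: inner_diff_left)
    have A: "y - x \<le> L * norm (u y - u x)" "norm ((u y - u x) - ((u y - u x) \<bullet> e) *\<^sub>R e) \<le> 1 / 2 * norm (u y - u x)"
      using lin0 xy by auto
    have "norm (u y - u x) = 0" using A(2) 0 by simp
    then show False using A(1) xy(3) by simp
  qed
  have cue: "continuous_on (ball \<xi> d0) (\<lambda>x. u x \<bullet> e)"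
    using d0 by (intro continuous_intros continuous_on_subset[OF cu])
  have "\<exists>\<sigma>\<in>{1, - 1 :: real}. \<forall>x\<in>ball \<xi> d0. \<forall>y\<in>ball \<xi> d0. x < y \<longrightarrow> 0 < \<sigma> * ((u y - u x) \<bullet> e)"
  proof -
    have "inj_on (\<lambda>x. u x \<bullet> e) (ball \<xi> d0)" using inj by (intro linorder_inj_onI) auto
    moreover have "is_interval (ball \<xi> d0)" by (simp add: is_interval_convex_1)
    ultimately have "strict_mono_on (ball \<xi> d0) (\<lambda>x. u x \<bullet> e) \<or> strict_antimono_on (ball \<xi> d0) (\<lambda>x. u x \<bullet> e)"
      using cue by (simp add: injective_eq_monotone_map)
    then show ?thesis
    proof
      assume "strict_mono_on (ball \<xi> d0) (\<lambda>x. u x \<bullet> e)"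
      then show ?thesis by (intro bexI[of _ 1]) (auto simp: monotone_on_def inner_diff_left)
    next
      assume "strict_antimono_on (ball \<xi> d0) (\<lambda>x. u x \<bullet> e)"
      then show ?thesis by (intro bexI[of _ "-1"]) (auto simp: monotone_on_def inner_diff_left)
    qed
  qed
  then obtain \<sigma> :: real where \<sigma>: "\<sigma> = 1 \<or> \<sigma> = -1"
    "\<And>x y. x \<in> ball \<xi> d0 \<Longrightarrow> y \<in> ball \<xi> d0 \<Longrightarrow> x < y \<Longrightarrow> 0 < \<sigma> * ((u y - u x) \<bullet> e)" by blast
  show ?thesis
    unfolding strong_tangent_def
  proof (intro exI[of _ "\<sigma> *\<^sub>R e"] conjI allI impI)
    show "norm (\<sigma> *\<^sub>R e) = 1" using \<sigma>(1) ne by auto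
    show "right_eigenvector (flux_matrix f (u \<xi>)) \<xi> (\<sigma> *\<^sub>R e)"
      using ev \<sigma>(1) unfolding z_def right_eigenvector_def by (auto simp: matrix_vector_mult_scaleR)
    fix \<epsilon> :: real assume "\<epsilon> > 0"
    then obtain d where d: "d > 0" "ball \<xi> d \<subseteq> J" and lin': "\<forall>x\<in>ball \<xi> d. \<forall>y\<in>ball \<xi> d. x \<le> y \<longrightarrow>
      y - x \<le> L * norm (u y - u x) \<and>
      norm ((u y - u x) - ((u y - u x) \<bullet> e) *\<^sub>R e) \<le> (\<epsilon> / 2) * norm (u y - u x)"
      using lin[of "\<epsilon> / 2"] by auto
    show "\<exists>d>0. ball \<xi> d \<subseteq> J \<and> (\<forall>x\<in>ball \<xi> d. \<forall>y\<in>ball \<xi> d. x \<le> y \<longrightarrow>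
      norm (u y - u x - norm (u y - u x) *\<^sub>R \<sigma> *\<^sub>R e) \<le> \<epsilon> * norm (u y - u x))"
    proof (intro exI[of _ "min d d0"] conjI ballI impI)
      fix x y assume xy: "x \<in> ball \<xi> (min d d0)" "y \<in> ball \<xi> (min d d0)" "x \<le> y"
      show "norm (u y - u x - norm (u y - u x) *\<^sub>R \<sigma> *\<^sub>R e) \<le> \<epsilon> * norm (u y - u x)"
      proof (cases "x = y")
        case False
        let ?\<Delta> = "u y - u x"
        have pos: "0 < \<sigma> * (?\<Delta> \<bullet> e)" using \<sigma>(2)[of x y] xy False by auto
        have ab: "\<sigma> * \<bar>?\<Delta> \<bullet> e\<bar> = ?\<Delta> \<bullet> e" using \<sigma>(1) pos by auto
        \<comment> \<open>One half of \<epsilon> pays for the part orthogonal to e, the other for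
          replacing the e-component by the full length of the chord.\<close>
        have B: "norm (?\<Delta> - (?\<Delta> \<bullet> e) *\<^sub>R e) \<le> (\<epsilon> / 2) * norm ?\<Delta>" using lin' xy by auto
        have "?\<Delta> - norm ?\<Delta> *\<^sub>R \<sigma> *\<^sub>R e = (?\<Delta> - (?\<Delta> \<bullet> e) *\<^sub>R e) - (\<sigma> * (norm ?\<Delta> - \<bar>?\<Delta> \<bullet> e\<bar>)) *\<^sub>R e"
        proof -
          have "\<sigma> * (norm ?\<Delta> - \<bar>?\<Delta> \<bullet> e\<bar>) = \<sigma> * norm ?\<Delta> - ?\<Delta> \<bullet> e"
            unfolding right_diff_distrib ab ..
          then have "(\<sigma> * (norm ?\<Delta> - \<bar>?\<Delta> \<bullet> e\<bar>)) *\<^sub>R e = norm ?\<Delta> *\<^sub>R \<sigma> *\<^sub>R e - (?\<Delta> \<bullet> e) *\<^sub>R e"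
            by (simp only: scaleR_diff_left scaleR_scaleR mult.commute)
          then show ?thesis by simp
        qed
        then have "norm (?\<Delta> - norm ?\<Delta> *\<^sub>R \<sigma> *\<^sub>R e) \<le> norm (?\<Delta> - (?\<Delta> \<bullet> e) *\<^sub>R e) + norm ((\<sigma> * (norm ?\<Delta> - \<bar>?\<Delta> \<bullet> e\<bar>)) *\<^sub>R e)"
          by (simp only: norm_triangle_ineq4)
        also have "norm ((\<sigma> * (norm ?\<Delta> - \<bar>?\<Delta> \<bullet> e\<bar>)) *\<^sub>R e) = \<bar>norm ?\<Delta> - \<bar>?\<Delta> \<bullet> e\<bar>\<bar>"
          using \<sigma>(1) ne by (auto simp: abs_mult)
        finally show ?thesis using abs_inner[of ?\<Delta>] B by linarith
      qed simp
    qed (use d d0 in auto)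
  qed
qed

text \<open>The arclength parametrization has unit eigenvectors as velocities along the curve. The
  remaining work is to extend them to a C^1 eigenvector field on an open set around the whole curve,
  although such fields are obtained only locally.\<close>

lemma rarefaction_wave_component:
  assumes J: "open_interval J" "J \<subseteq> set_W f v"
  shows "rarefaction_wave f \<U> J (ess_im_value v)"
proof -
  define u where "u = ess_im_value v"
  have J': "open J" "is_interval J" "J \<noteq> {}" using J by (auto simp: open_interval_def)
  then have "connected J" by (simp add: is_interval_connected_1)
  then obtain i where i: "i < CARD('n)" and speed: "\<And>\<xi>. \<xi> \<in> J \<Longrightarrow> char_speed f i (u \<xi>) = \<xi>"
    unfolding u_def using set_W_speed_index[of J] J J' by blast
  have "\<exists>\<rho>. right_eigenvector (flux_matrix f (u \<xi>)) \<xi> \<rho> \<and> strong_tangent u J \<xi> \<rho>" if "\<xi> \<in> J" for \<xi>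
    unfolding u_def by (rule set_W_tangent[OF J'(1) J(2) i _ that]) (use speed in \<open>simp add: u_def\<close>)
  then obtain \<rho> where ev: "\<And>\<xi>. \<xi> \<in> J \<Longrightarrow> right_eigenvector (flux_matrix f (u \<xi>)) \<xi> (\<rho> \<xi>)"
    and str: "\<And>\<xi>. \<xi> \<in> J \<Longrightarrow> strong_tangent u J \<xi> (\<rho> \<xi>)" by metis
  then have \<rho>: "norm (\<rho> \<xi>) = 1" "right_eigenvector (flux_matrix f (u \<xi>)) \<xi> (\<rho> \<xi>)" if "\<xi> \<in> J" for \<xi>
    using that by (auto simp: strong_tangent_def)
  have cp: "ess_im_continuity_point v \<eta>" if "\<eta> \<in> J" for \<eta> using J that by (auto simp: set_W_iff)
  have uSH: "u \<eta> \<in> SH" if "\<eta> \<in> J" for \<eta> unfolding u_def by (rule ess_im_value_SH[OF cp[OF that]])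
  have cu: "continuous_on J u" unfolding u_def by (rule continuous_on_ess_im_value[OF Linf cp])
  have inj: "inj_on u J" by (rule inj_onI) (metis speed)
  obtain I w w' where I: "open_interval I" and hom: "homeomorphism J I w w'"
    and der: "\<And>\<eta>. \<eta> \<in> I \<Longrightarrow> ((\<lambda>\<eta>. u (w' \<eta>)) has_vector_derivative \<rho> (w' \<eta>)) (at \<eta>)" and c\<rho>: "continuous_on J \<rho>"
    using arclength_parametrization[OF J(1) inj cu str] by blast
  define c where "c \<eta> = u (w' \<eta>)" for \<eta>
  have w'J: "w' \<eta> \<in> J" if "\<eta> \<in> I" for \<eta> using hom that by (auto simp: homeomorphism_def)
  define Q where "Q y x \<longleftrightarrow> right_eigenvector (flux_matrix f y) (char_speed f i y) x \<and> norm x = 1 \<and> x \<bullet> \<rho> (char_speed f i y) > 0" for y x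
  \<comment> \<open>On \<open>D\<close> the line field of eigenvectors is oriented by comparison with \<open>\<rho>\<close> at the speed
    \<open>\<lambda>\<^sub>i(y)\<close>; this needs no global choice of eigenvectors, and continuity of \<open>\<rho>\<close> suffices.\<close>
  define D where "D = {y \<in> SH. char_speed f i y \<in> J \<and> (\<exists>x. Q y x)}"
  \<comment> \<open>On D the choice is forced by \<open>eigenvector_unique\<close>, so that local
    C^1 fields satisfying Q agree with r.\<close>
  define r where "r y = (SOME x. Q y x)" for y
  have Qr: "r y = x" if "y \<in> SH" "Q y x" for x y
  proof -
    have "Q y (r y)" unfolding r_def using that(2) by (rule someI)
    then show ?thesis using that eigenvector_unique[OF that(1)] unfolding Q_def by blast
  qed
  have Q\<rho>: "Q (u \<xi>) (\<rho> \<xi>)" if "\<xi> \<in> J" for \<xi>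
    using \<rho>[OF that] speed[OF that] by (simp add: Q_def flip: power2_norm_eq_inner)
  \<comment> \<open>A local unit eigenvector field, multiplied by a constant sign, satisfies Q near
    z, and uniqueness identifies it with r.\<close>
  have loc: "\<exists>W. open W \<and> z \<in> W \<and> W \<subseteq> D \<and> C1_on W r" if z: "z \<in> D" for z
  proof -
    have zSH: "z \<in> SH" and zJ: "char_speed f i z \<in> J" and "\<exists>x. Q z x" using z by (auto simp: D_def)
    obtain V r1 where V: "open V" "z \<in> V" "V \<subseteq> SH" and cs: "C1_on V (char_speed f i)"
      and r1: "C1_on V r1" "\<And>y. y \<in> V \<Longrightarrow> right_eigenvector (flux_matrix f y) (char_speed f i y) (r1 y)"
      using eigenvector_field[OF zSH i] by blast
    define e where "e y = r1 y /\<^sub>R norm (r1 y)" for y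
    have Ce: "C1_on V e" unfolding e_def
      by (rule C1_on_normalize[OF r1(1)]) (use r1(2) in \<open>auto simp: right_eigenvector_def\<close>)
    have e: "right_eigenvector (flux_matrix f y) (char_speed f i y) (e y)" "norm (e y) = 1" if "y \<in> V" for y
      using r1(2)[OF that] by (auto simp: e_def right_eigenvector_def matrix_vector_mult_scaleR)
    let ?\<phi> = "\<lambda>y. e y \<bullet> \<rho> (char_speed f i y)"
    \<comment> \<open>The witness for z in D is a multiple of \<open>e z\<close> and has positive
      inner product with \<rho>, so \<open>e z\<close> is not orthogonal to \<rho> at this
      speed.\<close>
    have nz: "?\<phi> z \<noteq> 0"
    proof
      assume 0: "?\<phi> z = 0"
      obtain x where x: "Q z x" using \<open>\<exists>x. Q z x\<close> by blast
      have card: "card (real_eigenvalues (flux_matrix f z)) = CARD('n)" using zSH by (simp add: strictly_hyperbolic_set_def)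
      obtain k where "x = k *\<^sub>R e z"
        using simple_eigenvalue[OF card e(1)[OF V(2)], of x 0] x by (auto simp: Q_def right_eigenvector_def)
      then show False using x 0 by (simp add: Q_def)
    qed
    define \<sigma> where "\<sigma> = sgn (?\<phi> z)"
    have \<sigma>: "\<sigma> = 1 \<or> \<sigma> = -1" "0 < \<sigma> * ?\<phi> z" using nz by (auto simp: \<sigma>_def sgn_if)
    have ics: "isCont (char_speed f i) z" using C1_on_imp_continuous_on[OF cs] V continuous_on_eq_continuous_at by blast
    have ie: "isCont e z" using C1_on_imp_continuous_on[OF Ce] V continuous_on_eq_continuous_at by blast
    have "isCont \<rho> (char_speed f i z)" using c\<rho> J'(1) zJ continuous_on_eq_continuous_at by blast
    with ics have "isCont (\<lambda>y. \<rho> (char_speed f i y)) z" by (rule isCont_o2)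
    with ie have "isCont (\<lambda>y. \<sigma> * ?\<phi> y) z" by (intro continuous_intros)
    then have "((\<lambda>y. \<sigma> * ?\<phi> y) \<longlongrightarrow> \<sigma> * ?\<phi> z) (nhds z)"
      unfolding isCont_def by (rule iffD1[OF tendsto_at_iff_tendsto_nhds])
    then have "eventually (\<lambda>y. 0 < \<sigma> * ?\<phi> y) (nhds z)" using \<sigma>(2) by (rule order_tendstoD)
    moreover have "eventually (\<lambda>y. char_speed f i y \<in> J) (nhds z)"
    proof -
      have "(char_speed f i \<longlongrightarrow> char_speed f i z) (nhds z)" using ics by (simp add: isCont_def tendsto_at_iff_tendsto_nhds)
      then show ?thesis using J'(1) zJ by (rule topological_tendstoD)
    qed
    moreover have "eventually (\<lambda>y. y \<in> V) (nhds z)" using V by (intro eventually_nhds_in_open)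
    ultimately have "eventually (\<lambda>y. 0 < \<sigma> * ?\<phi> y \<and> char_speed f i y \<in> J \<and> y \<in> V) (nhds z)"
      by (intro eventually_conj)
    then obtain W where W: "open W" "z \<in> W" and W': "\<forall>y\<in>W. 0 < \<sigma> * ?\<phi> y \<and> char_speed f i y \<in> J \<and> y \<in> V"
      unfolding eventually_nhds by blast
    have Q: "Q y (\<sigma> *\<^sub>R e y)" if "y \<in> W" for y
    proof -
      have y: "y \<in> V" "0 < \<sigma> * ?\<phi> y" using W' that by auto
      show ?thesis using e[OF y(1)] y(2) \<sigma>(1) unfolding Q_def right_eigenvector_def
        by (auto simp: matrix_vector_mult_scaleR)
    qed
    have WV: "W \<subseteq> V" using W' by blast
    have "C1_on W (\<lambda>y. \<sigma> *\<^sub>R e y)"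
      using \<sigma>(1) C1_on_subset[OF Ce WV] C1_on_uminus[OF C1_on_subset[OF Ce WV]] by auto
    then have "C1_on W r"
    proof (rule C1_on_cong_open[OF _ W(1)])
      fix y assume "y \<in> W"
      then show "\<sigma> *\<^sub>R e y = r y" using Qr[OF _ Q] W' V(3) by auto
    qed
    moreover have "W \<subseteq> D"
    proof
      fix y assume y: "y \<in> W"
      then have "y \<in> SH" "char_speed f i y \<in> J" using W' V(3) by auto
      then show "y \<in> D" unfolding D_def using Q[OF y] by blast
    qed
    ultimately show ?thesis using W by blast
  qed
  have cD: "c ` I \<subseteq> D"
  proof
    fix y assume "y \<in> c ` I"
    then obtain \<eta> where \<eta>: "\<eta> \<in> I" "y = u (w' \<eta>)" by (auto simp: c_def)
    then show "y \<in> D" unfolding D_def using uSH[OF w'J[OF \<eta>(1)]] speed[OF w'J[OF \<eta>(1)]] w'J[OF \<eta>(1)] Q\<rho>[OF w'J[OF \<eta>(1)]] by auto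
  qed
  \<comment> \<open>Along the curve the velocity itself satisfies Q, so r restricted to the curve is
    the tangent.\<close>
  have rc: "r (c \<eta>) = \<rho> (w' \<eta>)" if "\<eta> \<in> I" for \<eta>
    unfolding c_def by (rule Qr[OF uSH[OF w'J[OF that]] Q\<rho>[OF w'J[OF that]]])
  have curve: "rarefaction_integral_curve f \<U> i I c"
    unfolding rarefaction_integral_curve_def
  proof (intro conjI i I exI[of _ D] exI[of _ r] cD ballI)
    show "c C1_differentiable_on I"
      unfolding C1_differentiable_on_def
    proof (intro exI[of _ "\<lambda>\<eta>. \<rho> (w' \<eta>)"] conjI ballI)
      show "(c has_vector_derivative \<rho> (w' \<eta>)) (at \<eta>)" if "\<eta> \<in> I" for \<eta>
        unfolding c_def by (rule der[OF that])
      have "continuous_on I w'" using hom by (auto simp: homeomorphism_def)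
      then show "continuous_on I (\<lambda>\<eta>. \<rho> (w' \<eta>))"
        by (rule continuous_on_compose2[OF c\<rho>]) (use w'J in auto)
    qed
    show "c ` I \<subseteq> SH" "D \<subseteq> SH" using cD by (auto simp: D_def)
    show "open D"
    proof (subst open_subopen, rule ballI)
      fix z assume "z \<in> D"
      from loc[OF this] show "\<exists>T. open T \<and> z \<in> T \<and> T \<subseteq> D" by blast
    qed
    show "C1_on D r"
    proof (rule C1_on_cover)
      fix z assume "z \<in> D"
      from loc[OF this] show "\<exists>V. open V \<and> z \<in> V \<and> C1_on V r" by blast
    qed
    show "right_eigenvector (flux_matrix f y) (char_speed f i y) (r y)" if "y \<in> D" for y
    proof -
      have "Q y (r y)" unfolding r_def by (rule someI_ex) (use that in \<open>auto simp: D_def\<close>)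
      then show ?thesis by (simp add: Q_def)
    qed
    show "(c has_vector_derivative r (c \<eta>)) (at \<eta>)" if "\<eta> \<in> I" for \<eta>
      unfolding rc[OF that] unfolding c_def by (rule der[OF that])
  qed
  have "\<forall>\<xi>\<in>J. ess_im_value v \<xi> = c (w \<xi>) \<and> char_speed f i (c (w \<xi>)) = \<xi>"
  proof
    fix \<xi> assume \<xi>: "\<xi> \<in> J"
    then have "w' (w \<xi>) = \<xi>" using hom by (auto simp: homeomorphism_def)
    then show "ess_im_value v \<xi> = c (w \<xi>) \<and> char_speed f i (c (w \<xi>)) = \<xi>"
      using speed[OF \<xi>] by (auto simp: c_def u_def)
  qed
  then show ?thesis unfolding rarefaction_wave_def using J(1) curve hom by blast
qed

lemma set_R_component_rarefaction:
  assumes J: "J \<in> components (set_R f v)"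
  shows "\<exists>g. rarefaction_wave f \<U> J g \<and> (AE \<xi> in lebesgue. \<xi> \<in> J \<longrightarrow> v \<xi> = g \<xi>)"
proof (intro exI conjI)
  have W: "J \<subseteq> set_W f v" using in_components_subset[OF J] set_R_subset by blast
  show "rarefaction_wave f \<U> J (ess_im_value v)"
    by (rule rarefaction_wave_component[OF open_real_components(2)[OF open_set_R J] W])
  show "AE \<xi> in lebesgue. \<xi> \<in> J \<longrightarrow> v \<xi> = ess_im_value v \<xi>"
    by (rule AE_eq_ess_im_value[OF Linf open_components[OF open_set_R J]]) (use W in \<open>auto simp: set_W_iff\<close>)
qed

end

theorem theorem8p10:
  fixes f :: "real^'n \<Rightarrow> real^'n" and \<U> :: "(real^'n) set" and v :: "real \<Rightarrow> real^'n"
  assumes "open \<U>"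
    and "C2_on \<U> f"
    and "convex hull (strictly_hyperbolic_set f \<U>) \<subseteq> \<U>"
    and "self_similar_weak_solution f \<U> v"
  shows "(UNIV = set_isoS v \<union> set_R f v \<union> (set_C f v \<union> set_E f v) \<union> set_S' v
          \<and> set_isoS v \<inter> set_R f v = {}
          \<and> set_C f v \<inter> set_E f v = {}
          \<and> (set_isoS v \<union> set_R f v) \<inter> (set_C f v \<union> set_E f v) = {}
          \<and> (set_isoS v \<union> set_R f v \<union> (set_C f v \<union> set_E f v)) \<inter> set_S' v = {})
       \<and> (countable (set_isoS v)
          \<and> (\<forall>\<xi>\<in>set_isoS v. \<not> ess_im_continuity_point v \<xi> \<and>
                \<xi> isolated_in {\<eta>. \<not> ess_im_continuity_point v \<eta>}))
       \<and> (countable (components (set_R f v)) \<and> set_R f v = \<Union>(components (set_R f v))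
          \<and> (\<forall>J\<in>components (set_R f v). open_interval J \<and>
                (\<exists>g. rarefaction_wave f \<U> J g \<and> (AE \<xi> in lebesgue. \<xi> \<in> J \<longrightarrow> v \<xi> = g \<xi>))))
       \<and> (countable (components (set_C f v)) \<and> set_C f v = \<Union>(components (set_C f v))
          \<and> (\<forall>J\<in>components (set_C f v). open_interval J \<and>
                (\<exists>u. AE \<xi> in lebesgue. \<xi> \<in> J \<longrightarrow> v \<xi> = u)))
       \<and> (countable (set_E f v)
          \<and> (\<forall>\<xi>\<in>set_E f v. \<xi> isolated_in set_E f v \<and> ess_im_continuity_point v \<xi> \<and>
                (\<exists>J\<in>components (set_C f v). \<xi> \<in> frontier J)))
       \<and> set_S' v = {\<xi>. \<xi> islimpt {\<eta>. \<not> ess_im_continuity_point v \<eta>}}"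
proof -
  interpret weak_solution f \<U> v using assms by unfold_locales
  have S: "{\<eta>. \<not> ess_im_continuity_point v \<eta>} = set_S v" by (simp add: set_S_def)
  show ?thesis
    unfolding S
  proof (intro conjI ballI)
    fix \<xi> assume \<xi>: "\<xi> \<in> set_isoS v"
    show "\<not> ess_im_continuity_point v \<xi>" using \<xi> by (simp add: set_isoS_def set_S_def)
    show "\<xi> isolated_in set_S v" by (rule set_isoS_isolated[OF \<xi>])
  next
    fix \<xi> assume \<xi>: "\<xi> \<in> set_E f v"
    show "\<xi> isolated_in set_E f v" by (rule set_E_isolated[OF \<xi>])
    show "ess_im_continuity_point v \<xi>" using \<xi> by (simp add: set_E_def set_W_iff)
    show "\<exists>J\<in>components (set_C f v). \<xi> \<in> frontier J" by (rule set_E_endpoint[OF \<xi>])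
  next
    show "set_S' v = {\<xi>. \<xi> islimpt set_S v}" by (simp add: set_S'_def)
    show "countable (set_E f v)" by (rule countable_isolated[OF set_E_isolated])
  qed (fact partition countable_set_isoS open_real_components[OF open_set_R] open_real_components[OF open_set_C]
      Union_components[symmetric] set_R_component_rarefaction set_C_component_constant)+
qed

end
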